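(* Let $W$ be a negative definite $\mathrm{SU}(2)$ connection on $P\to M$, and let $E_W$ be the unique solution (an $\mathfrak{su}(2)$-valued frame 1-form on $P$, compatible with the orientation of $M$) of the equation $F(W)=E_W\wedge E_W$. Let $J_W$ be the almost-complex structure on $P$ defined by the 3-form $\Omega=CS(W)$. Then the connection $W(J_W)$ defined by $J_W$ coincides with $W$, and $E_W$ is a frame for the metric on $M$ defined by $J_W$, i.e. this metric is $-2\,\mathrm{Tr}(E_W\otimes E_W)$.
   Context: Setting. $M$ is an oriented smooth 3-manifold and $P\to M$ is a principal $\mathrm{SU}(2)$ bundle (right action). The 6-manifold $P$ is oriented. The Lie algebra $\mathfrak{su}(2)$ consists of tracefree anti-hermitian $2\times2$ matrices, with basis $\tau_i=-\frac{\mathrm{i}}{2}\sigma_i$ ($\sigma_i$ the Pauli matrices), so $\mathrm{Tr}(\tau_i\tau_j)=-\frac12\delta_{ij}$ and $[\tau_i,\tau_j]=\epsilon_{ijk}\tau_k$. Products of matrix-valued forms combine matrix product and wedge product. A connection is viewed as an $\mathfrak{su}(2)$-valued 1-form $W$ on $P$ (in a trivialisation $W=g^{-1}\mathbf{w}g+g^{-1}dg$), with curvature $F(W)=dW+W\wedge W$. Frames. A frame 1-form is a horizontal $\mathfrak{su}(2)$-valued 1-form $E=E^i\tau_i$ on $P$ which is equivariant ($R_g^*E=g^{-1}Eg$; in a trivialisation $E=g^{-1}\mathbf{e}g$ with $\mathbf{e}$ an $\mathfrak{su}(2)$-valued 1-form on $M$) with $E^1,E^2,E^3$ pointwise linearly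 independent. The pairing $-2\,\mathrm{Tr}(E\otimes E)=\delta_{ij}E^i\otimes E^j$ descends to a Riemannian metric on $M$. It is compatible with the orientation of $M$ if the 3-form $-\frac23\mathrm{Tr}(E\wedge E\wedge E)$, which descends to $M$, is positive. Chern-Simons form. $CS(W)=\mathrm{Tr}\left(W\wedge dW+\frac23W\wedge W\wedge W\right)$, a 3-form on $P$. Stable 3-forms in 6D. For a real 3-form $\Omega$ on $P$ and a positive volume form $v$, define $K_\Omega:T^*P\to T^*P$ by $i_\xi(K_\Omega(\alpha))=\alpha\wedge i_\xi\Omega\wedge\Omega/v$ for all tangent vectors $\xi$. Then $K_\Omega^2=\lambda(\Omega)\,\mathbb{I}$ with $\lambda(\Omega)=\frac16\mathrm{Tr}(K_\Omega^2)$. $\Omega$ is stable if $\lambda(\Omega)\neq0$ everywhere, and of negative type if $\lambda(\Omega)<0$ everywhere; in the latter case $J_\Omega=K_\Omega/\sqrt{-\lambda(\Omega)}$ is an almost-complex structure on $P$ (independent of $v$), acting on vectors by duality, $(J\alpha)(X)=\alpha(JX)$. $W$ is called negative definite if $CS(W)$ is stable of negative type. Connection and metric defined by $J$. Let $J$ be an $\mathrm{SU}(2)$-invariant almost-complex structure on $P$ such that $J(V)\cap V=0$ for the vertical subbundle $V\subset TP$. The connection $W(J)$ defined by $J$ is the one whose horizontal subbundle is $H=J(V)$. The metric on $M$ defined by $J$ is $(\xi,\eta)_M:=(J\xi_H,J\eta_H)_{\mathrm{SU}(2)}$, where $\xi_H,\eta_H$ are the horizontal lifts of $\xi,\eta$,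 and $(\cdot,\cdot)_{\mathrm{SU}(2)}$ is the Killing-Cartan metric on the fibres, normalised as $-2\,\mathrm{Tr}(xy)$ under the identification of vertical vectors with $\mathfrak{su}(2)$. *)

theory Defs
  imports "HOL-Analysis.Analysis"
begin

section \<open>Smooth maps between subsets of normed spaces\<close>

text \<open>\<open>Ck_on k f S\<close> is meant for open \<open>S\<close> in a finite-dimensional space.  On an arbitrary set,
  smoothness is local extendability to a smooth map; for open sets this is the usual notion, and it
  is used below also for \<open>SU2\<close>, viewed as a subset of the space of complex matrices.\<close>

primrec Ck_on :: "nat \<Rightarrow> ('a::real_normed_vector \<Rightarrow> 'b::real_normed_vector) \<Rightarrow> 'a set \<Rightarrow> bool" where
  "Ck_on 0 f S \<longleftrightarrow> continuous_on S f"
| "Ck_on (Suc k) f S \<longleftrightarrow>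
     f differentiable_on S \<and> (\<forall>v. Ck_on k (\<lambda>x. frechet_derivative f (at x) v) S)"

definition smooth_on :: "('a::real_normed_vector \<Rightarrow> 'b::real_normed_vector) \<Rightarrow> 'a set \<Rightarrow> bool" where
  "smooth_on f S \<longleftrightarrow> (\<forall>x\<in>S. \<exists>U F. open U \<and> x \<in> U \<and> (\<forall>k. Ck_on k F U) \<and> (\<forall>y\<in>S \<inter> U. F y = f y))"

section \<open>Oriented smooth manifolds\<close>

text \<open>A manifold is a whole type of class \<open>{t2_space, second_countable_topology}\<close> together with
  an atlas; an orientation is the choice of an atlas with positive transition determinants.\<close>

type_synonym ('m, 'n) chart = "'m set \<times> ('m \<Rightarrow> real^'n)"

definition chart_inv :: "('m, 'n::finite) chart \<Rightarrow> real^'n \<Rightarrow> 'm" where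
  "chart_inv c = inv_into (fst c) (snd c)"

definition is_chart :: "('m::topological_space, 'n::finite) chart \<Rightarrow> bool" where
  "is_chart c \<longleftrightarrow> open (fst c) \<and> open (snd c ` fst c) \<and>
     homeomorphism (fst c) (snd c ` fst c) (snd c) (chart_inv c)"

definition smooth_atlas :: "('m::topological_space, 'n::finite) chart set \<Rightarrow> bool" where
  "smooth_atlas A \<longleftrightarrow> (\<forall>c\<in>A. is_chart c) \<and> (\<Union>c\<in>A. fst c) = UNIV \<and>
     (\<forall>c\<in>A. \<forall>c'\<in>A. smooth_on (snd c' \<circ> chart_inv c) (snd c ` (fst c \<inter> fst c')))"

definition oriented_atlas :: "('m::topological_space, 'n::finite) chart set \<Rightarrow> bool" where
  "oriented_atlas A \<longleftrightarrow> smooth_atlas A \<and>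
     (\<forall>c\<in>A. \<forall>c'\<in>A. \<forall>x\<in>fst c \<inter> fst c'.
        det (matrix (frechet_derivative (snd c' \<circ> chart_inv c) (at (snd c x)))) > 0)"

text \<open>The tangent space at \<open>x\<close> is identified with \<open>real^'n\<close> by means of one chosen chart of the
  atlas around \<open>x\<close>.  Tangent maps, forms and their exterior derivatives are all expressed in
  these coordinates; none of the notions below depends on the choice.\<close>

definition chart_at :: "('m, 'n::finite) chart set \<Rightarrow> 'm \<Rightarrow> ('m, 'n::finite) chart" where
  "chart_at A x = (SOME c. c \<in> A \<and> x \<in> fst c)"

definition coord_at :: "('m, 'n::finite) chart set \<Rightarrow> 'm \<Rightarrow> real^'n" where
  "coord_at A x = snd (chart_at A x) x"

definition tangent_map ::
  "('a, 'n::finite) chart set \<Rightarrow> ('b, 'k::finite) chart set \<Rightarrow> ('a \<Rightarrow> 'b) \<Rightarrow> 'a \<Rightarrow> real^'n \<Rightarrow> real^'k" where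
  "tangent_map A B f x =
     frechet_derivative (snd (chart_at B (f x)) \<circ> f \<circ> chart_inv (chart_at A x)) (at (coord_at A x))"

definition velocity :: "('m, 'n::finite) chart set \<Rightarrow> (real \<Rightarrow> 'm) \<Rightarrow> real \<Rightarrow> real^'n" where
  "velocity A \<gamma> t = vector_derivative (snd (chart_at A (\<gamma> t)) \<circ> \<gamma>) (at t)"

definition smooth_map ::
  "('a::topological_space, 'n::finite) chart set \<Rightarrow> ('b::topological_space, 'k::finite) chart set \<Rightarrow> ('a \<Rightarrow> 'b) \<Rightarrow> bool"
where
  "smooth_map A B f \<longleftrightarrow> continuous_on UNIV f \<and>
     (\<forall>c\<in>A. \<forall>c'\<in>B. smooth_on (snd c' \<circ> f \<circ> chart_inv c) (snd c ` (fst c \<inter> f -` fst c')))"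

text \<open>The vector \<open>u\<close>, given in the chart \<open>c\<close> at the point with coordinates \<open>y\<close>, as a tangent
  vector in the above sense.\<close>

definition from_chart :: "('m, 'n::finite) chart set \<Rightarrow> ('m, 'n::finite) chart \<Rightarrow> real^'n \<Rightarrow> real^'n \<Rightarrow> real^'n" where
  "from_chart A c y u = frechet_derivative (snd (chart_at A (chart_inv c y)) \<circ> chart_inv c) (at y) u"

definition to_chart :: "('m, 'n::finite) chart set \<Rightarrow> ('m, 'n::finite) chart \<Rightarrow> 'm \<Rightarrow> real^'n \<Rightarrow> real^'n" where
  "to_chart A c x u = frechet_derivative (snd c \<circ> chart_inv (chart_at A x)) (at (coord_at A x)) u"

section \<open>Differential forms\<close>

text \<open>A \<open>k\<close>-form on a vector space takes a sequence of vectors, of which only the entries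
  \<open>0, \<dots>, k - 1\<close> matter.\<close>

type_synonym ('v, 'a) form = "(nat \<Rightarrow> 'v) \<Rightarrow> 'a"

definition alternating_form :: "nat \<Rightarrow> ('v::real_vector, 'a::real_vector) form \<Rightarrow> bool" where
  "alternating_form k \<alpha> \<longleftrightarrow>
     (\<forall>X Y. (\<forall>i<k. X i = Y i) \<longrightarrow> \<alpha> X = \<alpha> Y) \<and>
     (\<forall>X. \<forall>i<k. linear (\<lambda>u. \<alpha> (X(i := u)))) \<and>
     (\<forall>X i j. i < j \<and> j < k \<and> X i = X j \<longrightarrow> \<alpha> X = 0)"

abbreviation on_vec :: "('v, 'a) form \<Rightarrow> 'v \<Rightarrow> 'a" where
  "on_vec \<alpha> X \<equiv> \<alpha> (\<lambda>_. X)"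

text \<open>Normalised so that \<open>(\<alpha> \<and> \<beta>)(X, Y) = \<alpha>(X) \<beta>(Y) - \<alpha>(Y) \<beta>(X)\<close> for 1-forms; \<open>m\<close> is the
  product of values.\<close>

definition wedge :: "('a \<Rightarrow> 'b \<Rightarrow> 'c::real_vector) \<Rightarrow> nat \<Rightarrow> nat \<Rightarrow>
    ('v, 'a) form \<Rightarrow> ('v, 'b) form \<Rightarrow> ('v, 'c) form" where
  "wedge m k l \<alpha> \<beta> X = (1 / (fact k * fact l)) *\<^sub>R
     (\<Sum>\<sigma> | \<sigma> permutes {..<k + l}.
        of_int (sign \<sigma>) *\<^sub>R m (\<alpha> (\<lambda>i. X (\<sigma> i))) (\<beta> (\<lambda>i. X (\<sigma> (k + i)))))"

definition interior_product :: "'v \<Rightarrow> ('v, 'a) form \<Rightarrow> ('v, 'a) form" where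
  "interior_product u \<alpha> X = \<alpha> (case_nat u X)"

text \<open>\<open>in_chart A c \<omega>\<close> is the pullback of \<open>\<omega>\<close> under the inverse of the chart \<open>c\<close>.\<close>

definition in_chart :: "('m, 'n::finite) chart set \<Rightarrow> ('m, 'n::finite) chart \<Rightarrow> ('m \<Rightarrow> (real^'n, 'a) form) \<Rightarrow>
    real^'n \<Rightarrow> (real^'n, 'a) form" where
  "in_chart A c \<omega> y X = \<omega> (chart_inv c y) (\<lambda>i. from_chart A c y (X i))"

definition differential_form ::
  "('m, 'n::finite) chart set \<Rightarrow> nat \<Rightarrow> ('m \<Rightarrow> (real^'n, 'a::real_normed_vector) form) \<Rightarrow> bool" where
  "differential_form A k \<omega> \<longleftrightarrow> (\<forall>x. alternating_form k (\<omega> x)) \<and>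
     (\<forall>c\<in>A. \<forall>X. smooth_on (\<lambda>y. in_chart A c \<omega> y X) (snd c ` fst c))"

definition pullback :: "('a, 'n::finite) chart set \<Rightarrow> ('b, 'k::finite) chart set \<Rightarrow> ('a \<Rightarrow> 'b) \<Rightarrow>
    ('b \<Rightarrow> (real^'k, 'v) form) \<Rightarrow> 'a \<Rightarrow> (real^'n, 'v) form" where
  "pullback A B f \<omega> x X = \<omega> (f x) (\<lambda>i. tangent_map A B f x (X i))"

text \<open>Exterior derivative of a \<open>k\<close>-form, first on \<open>real^'n\<close>, then on a manifold, where at each point
  it is computed in the chosen chart.\<close>

definition euclidean_d :: "nat \<Rightarrow> (real^'n \<Rightarrow> (real^'n, 'a::real_normed_vector) form) \<Rightarrow>
    real^'n \<Rightarrow> (real^'n, 'a) form" where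
  "euclidean_d k \<eta> y X = (\<Sum>i\<le>k. (-1) ^ i *\<^sub>R
     frechet_derivative (\<lambda>z. \<eta> z (\<lambda>j. if j < i then X j else X (Suc j))) (at y) (X i))"

definition exterior_d :: "('m, 'n::finite) chart set \<Rightarrow> nat \<Rightarrow>
    ('m \<Rightarrow> (real^'n, 'a::real_normed_vector) form) \<Rightarrow> 'm \<Rightarrow> (real^'n, 'a) form" where
  "exterior_d A k \<omega> x = euclidean_d k (in_chart A (chart_at A x) \<omega>) (coord_at A x)"

text \<open>For the numeral index types \<open>3\<close> and \<open>6\<close> the vectors below are
  \<open>\<partial>\<^sub>1, \<partial>\<^sub>2, \<dots>\<close> in this order (the last index \<open>n\<close> equals \<open>0\<close> in the type \<open>n\<close>).\<close>

definition positive_volume_form ::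
  "('m, 'n::{finite,semiring_1}) chart set \<Rightarrow> ('m \<Rightarrow> ((real, 'n) vec, real) form) \<Rightarrow> bool" where
  "positive_volume_form A v \<longleftrightarrow> differential_form A CARD('n) v \<and>
     (\<forall>x. v x (\<lambda>i. axis (of_nat (Suc i)) 1) > 0)"

section \<open>The group \<open>SU(2)\<close> and its Lie algebra\<close>

type_synonym mat2 = "complex^2^2"

definition hermitian_adjoint :: "mat2 \<Rightarrow> mat2" where
  "hermitian_adjoint A = (\<chi> i j. cnj (A $ j $ i))"

definition SU2 :: "mat2 set" where
  "SU2 = {g. g ** hermitian_adjoint g = mat 1 \<and> det g = 1}"

definition su2 :: "mat2 set" where
  "su2 = {a. hermitian_adjoint a = - a \<and> trace a = 0}"

definition pauli :: "3 \<Rightarrow> mat2" where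
  "pauli i = (if i = 1 then vector [vector [0, 1], vector [1, 0]]
     else if i = 2 then vector [vector [0, - \<i>], vector [\<i>, 0]]
     else vector [vector [1, 0], vector [0, - 1]])"

definition tau :: "3 \<Rightarrow> mat2" where
  "tau i = (\<chi> j k. - (\<i> / 2) * pauli i $ j $ k)"

text \<open>The traces considered here (of products of two or three elements of \<open>su2\<close>, and forms built from
  them) are real; the real part only adjusts the type.\<close>

definition re_trace :: "mat2 \<Rightarrow> real" where
  "re_trace A = Re (trace A)"

text \<open>The coefficients of \<open>a = \<Sum>i. su2_coeff a i *\<^sub>R tau i\<close>, using \<open>Tr (tau i tau j) = - \<delta>\<^sub>i\<^sub>j / 2\<close>.\<close>

definition su2_coeff :: "mat2 \<Rightarrow> 3 \<Rightarrow> real" where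
  "su2_coeff a i = - 2 * re_trace (a ** tau i)"

definition killing :: "mat2 \<Rightarrow> mat2 \<Rightarrow> real" where
  "killing a b = - 2 * re_trace (a ** b)"

primrec matrix_pow :: "mat2 \<Rightarrow> nat \<Rightarrow> mat2" where
  "matrix_pow A 0 = mat 1"
| "matrix_pow A (Suc n) = A ** matrix_pow A n"

definition matrix_exp :: "mat2 \<Rightarrow> mat2" where
  "matrix_exp A = (\<Sum>n. (1 / fact n) *\<^sub>R matrix_pow A n)"

section \<open>Principal \<open>SU(2)\<close> bundles over 3-manifolds\<close>

record ('p, 'm) su2_bundle =
  total_atlas :: "('p, 6) chart set"
  base_atlas :: "('m, 3) chart set"
  proj :: "'p \<Rightarrow> 'm"
  action :: "'p \<Rightarrow> mat2 \<Rightarrow> 'p"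

text \<open>Smoothness of a map \<open>S \<times> SU2 \<rightarrow> N\<close> with \<open>S\<close> open in a manifold.\<close>

definition smooth_times_SU2 :: "('a::topological_space, 'n::finite) chart set \<Rightarrow>
    ('b::topological_space, 'k::finite) chart set \<Rightarrow> 'a set \<Rightarrow> ('a \<Rightarrow> mat2 \<Rightarrow> 'b) \<Rightarrow> bool" where
  "smooth_times_SU2 A B S f \<longleftrightarrow> continuous_on (S \<times> SU2) (\<lambda>(x, g). f x g) \<and>
     (\<forall>c\<in>A. \<forall>c'\<in>B. smooth_on (\<lambda>(y, g). snd c' (f (chart_inv c y) g))
        {(y, g). y \<in> snd c ` (fst c \<inter> S) \<and> g \<in> SU2 \<and> f (chart_inv c y) g \<in> fst c'})"

text \<open>The local trivialisation over \<open>U\<close> is \<open>p \<mapsto> (proj B p, \<theta> p)\<close>, with inverse \<open>\<Psi>\<close>.\<close>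

definition principal_bundle ::
  "('p::{t2_space,second_countable_topology}, 'm::{t2_space,second_countable_topology}) su2_bundle \<Rightarrow> bool"
where
  "principal_bundle B \<longleftrightarrow>
     oriented_atlas (total_atlas B) \<and> oriented_atlas (base_atlas B) \<and>
     smooth_map (total_atlas B) (base_atlas B) (proj B) \<and>
     smooth_times_SU2 (total_atlas B) (total_atlas B) UNIV (action B) \<and>
     (\<forall>p. action B p (mat 1) = p) \<and>
     (\<forall>p. \<forall>g\<in>SU2. \<forall>h\<in>SU2. action B (action B p g) h = action B p (g ** h)) \<and>
     (\<forall>p. \<forall>g\<in>SU2. proj B (action B p g) = proj B p) \<and>
     (\<forall>x. \<exists>U \<theta> \<Psi>. open U \<and> x \<in> U \<and>
        (\<forall>c\<in>total_atlas B. smooth_on (\<theta> \<circ> chart_inv c) (snd c ` (fst c \<inter> proj B -` U))) \<and>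
        smooth_times_SU2 (base_atlas B) (total_atlas B) U \<Psi> \<and>
        (\<forall>p\<in>proj B -` U. \<theta> p \<in> SU2 \<and> \<Psi> (proj B p) (\<theta> p) = p) \<and>
        (\<forall>y\<in>U. \<forall>g\<in>SU2. proj B (\<Psi> y g) = y \<and> \<theta> (\<Psi> y g) = g) \<and>
        (\<forall>p\<in>proj B -` U. \<forall>g\<in>SU2. \<theta> (action B p g) = \<theta> p ** g))"

definition dproj :: "('p, 'm) su2_bundle \<Rightarrow> 'p \<Rightarrow> real^6 \<Rightarrow> real^3" where
  "dproj B = tangent_map (total_atlas B) (base_atlas B) (proj B)"

definition dright :: "('p, 'm) su2_bundle \<Rightarrow> mat2 \<Rightarrow> 'p \<Rightarrow> real^6 \<Rightarrow> real^6" where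
  "dright B g = tangent_map (total_atlas B) (total_atlas B) (\<lambda>p. action B p g)"

definition vertical :: "('p, 'm) su2_bundle \<Rightarrow> 'p \<Rightarrow> (real^6) set" where
  "vertical B p = {X. dproj B p X = 0}"

definition fundamental_vector :: "('p, 'm) su2_bundle \<Rightarrow> 'p \<Rightarrow> mat2 \<Rightarrow> real^6" where
  "fundamental_vector B p a = velocity (total_atlas B) (\<lambda>t. action B p (matrix_exp (t *\<^sub>R a))) 0"

definition vertical_to_su2 :: "('p, 'm) su2_bundle \<Rightarrow> 'p \<Rightarrow> real^6 \<Rightarrow> mat2" where
  "vertical_to_su2 B p X = (THE a. a \<in> su2 \<and> fundamental_vector B p a = X)"

type_synonym 'p mform = "'p \<Rightarrow> (real^6, mat2) form"

text \<open>\<open>R\<^sub>g\<^sup>* \<omega> = g\<^sup>-\<^sup>1 \<omega> g\<close>\<close>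

definition equivariant :: "('p, 'm) su2_bundle \<Rightarrow> 'p mform \<Rightarrow> bool" where
  "equivariant B \<omega> \<longleftrightarrow> (\<forall>g\<in>SU2. \<forall>p X.
     pullback (total_atlas B) (total_atlas B) (\<lambda>p. action B p g) \<omega> p X = matrix_inv g ** \<omega> p X ** g)"

definition connection_form :: "('p, 'm) su2_bundle \<Rightarrow> 'p mform \<Rightarrow> bool" where
  "connection_form B W \<longleftrightarrow> differential_form (total_atlas B) 1 W \<and> (\<forall>p X. W p X \<in> su2) \<and>
     (\<forall>p. \<forall>a\<in>su2. on_vec (W p) (fundamental_vector B p a) = a) \<and> equivariant B W"

definition frame_form :: "('p, 'm) su2_bundle \<Rightarrow> 'p mform \<Rightarrow> bool" where
  "frame_form B E \<longleftrightarrow> differential_form (total_atlas B) 1 E \<and> (\<forall>p X. E p X \<in> su2) \<and>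
     (\<forall>p. \<forall>X\<in>vertical B p. on_vec (E p) X = 0) \<and> equivariant B E \<and>
     (\<forall>p. \<forall>c :: 3 \<Rightarrow> real. (\<forall>X. (\<Sum>i\<in>UNIV. c i * su2_coeff (on_vec (E p) X) i) = 0) \<longrightarrow> (\<forall>i. c i = 0))"

definition wedge2 :: "(real^6, mat2) form \<Rightarrow> (real^6, mat2) form" where
  "wedge2 \<alpha> = wedge (**) 1 1 \<alpha> \<alpha>"

definition wedge3 :: "(real^6, mat2) form \<Rightarrow> (real^6, mat2) form" where
  "wedge3 \<alpha> = wedge (**) 2 1 (wedge2 \<alpha>) \<alpha>"

definition orientation_compatible :: "('p, 'm) su2_bundle \<Rightarrow> 'p mform \<Rightarrow> bool" where
  "orientation_compatible B E \<longleftrightarrow> (\<exists>\<rho>. positive_volume_form (base_atlas B) \<rho> \<and>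
     (\<forall>p X. - (2 / 3) * re_trace (wedge3 (E p) X)
        = pullback (total_atlas B) (base_atlas B) (proj B) \<rho> p X))"

definition curvature :: "('p, 'm) su2_bundle \<Rightarrow> 'p mform \<Rightarrow> 'p mform" where
  "curvature B W p X = exterior_d (total_atlas B) 1 W p X + wedge2 (W p) X"

definition chern_simons :: "('p, 'm) su2_bundle \<Rightarrow> 'p mform \<Rightarrow> 'p \<Rightarrow> (real^6, real) form" where
  "chern_simons B W p X =
     re_trace (wedge (**) 1 2 (W p) (exterior_d (total_atlas B) 1 W p) X + (2 / 3) *\<^sub>R wedge3 (W p) X)"

section \<open>Stable 3-forms in six dimensions\<close>

definition form_ratio :: "('v, real) form \<Rightarrow> ('v, real) form \<Rightarrow> real" where
  "form_ratio \<beta> v = (THE r. \<forall>X. \<beta> X = r * v X)"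

definition hitchin_K :: "(real^6, real) form \<Rightarrow> (real^6, real) form \<Rightarrow> (real^6, real) form \<Rightarrow> (real^6, real) form"
where
  "hitchin_K v \<Omega> \<alpha> X =
     form_ratio (wedge (*) 3 3 (wedge (*) 1 2 \<alpha> (interior_product (X 0) \<Omega>)) \<Omega>) v"

text \<open>The trace over the dual space is taken in the basis \<open>dx\<^sup>i\<close>.\<close>

definition hitchin_lambda :: "(real^6, real) form \<Rightarrow> (real^6, real) form \<Rightarrow> real" where
  "hitchin_lambda v \<Omega> =
     (1 / 6) * (\<Sum>i\<in>UNIV. on_vec (hitchin_K v \<Omega> (hitchin_K v \<Omega> (\<lambda>X. X 0 $ i))) (axis i 1))"

text \<open>Replacing the positive volume form \<open>v\<close> by \<open>f v\<close> multiplies \<open>hitchin_lambda\<close> by \<open>1 / f\<^sup>2\<close>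
  and leaves \<open>J_of_form\<close> unchanged.\<close>

definition stable_form :: "('p \<Rightarrow> (real^6, real) form) \<Rightarrow> ('p \<Rightarrow> (real^6, real) form) \<Rightarrow> bool" where
  "stable_form v \<Omega> \<longleftrightarrow> (\<forall>p. hitchin_lambda (v p) (\<Omega> p) \<noteq> 0)"

definition negative_type :: "('p \<Rightarrow> (real^6, real) form) \<Rightarrow> ('p \<Rightarrow> (real^6, real) form) \<Rightarrow> bool" where
  "negative_type v \<Omega> \<longleftrightarrow> (\<forall>p. hitchin_lambda (v p) (\<Omega> p) < 0)"

definition negative_definite :: "('p, 'm) su2_bundle \<Rightarrow> ('p \<Rightarrow> (real^6, real) form) \<Rightarrow> 'p mform \<Rightarrow> bool" where
  "negative_definite B v W \<longleftrightarrow>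
     stable_form v (chern_simons B W) \<and> negative_type v (chern_simons B W)"

definition J_on_covectors ::
  "(real^6, real) form \<Rightarrow> (real^6, real) form \<Rightarrow> (real^6, real) form \<Rightarrow> (real^6, real) form" where
  "J_on_covectors v \<Omega> \<alpha> X = hitchin_K v \<Omega> \<alpha> X / sqrt (- hitchin_lambda v \<Omega>)"

definition J_of_form ::
  "('p \<Rightarrow> (real^6, real) form) \<Rightarrow> ('p \<Rightarrow> (real^6, real) form) \<Rightarrow> 'p \<Rightarrow> real^6 \<Rightarrow> real^6" where
  "J_of_form v \<Omega> p X = (THE Y. \<forall>\<alpha>. alternating_form 1 \<alpha> \<longrightarrow>
     on_vec \<alpha> Y = on_vec (J_on_covectors (v p) (\<Omega> p) \<alpha>) X)"

section \<open>Connection and metric defined by an almost-complex structure\<close>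

definition almost_complex_structure :: "('p, 'n::finite) chart set \<Rightarrow> ('p \<Rightarrow> real^'n \<Rightarrow> real^'n) \<Rightarrow> bool" where
  "almost_complex_structure A J \<longleftrightarrow> (\<forall>p. linear (J p)) \<and> (\<forall>p X. J p (J p X) = - X) \<and>
     (\<forall>c\<in>A. \<forall>u. smooth_on
        (\<lambda>y. to_chart A c (chart_inv c y) (J (chart_inv c y) (from_chart A c y u))) (snd c ` fst c))"

text \<open>The standing assumptions on \<open>J\<close> under which the connection and the metric are defined.\<close>

definition admissible :: "('p, 'm) su2_bundle \<Rightarrow> ('p \<Rightarrow> real^6 \<Rightarrow> real^6) \<Rightarrow> bool" where
  "admissible B J \<longleftrightarrow> almost_complex_structure (total_atlas B) J \<and>
     (\<forall>g\<in>SU2. \<forall>p X. dright B g p (J p X) = J (action B p g) (dright B g p X)) \<and>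
     (\<forall>p. J p ` vertical B p \<inter> vertical B p = {0})"

definition connection_of :: "('p, 'm) su2_bundle \<Rightarrow> ('p \<Rightarrow> real^6 \<Rightarrow> real^6) \<Rightarrow> 'p mform" where
  "connection_of B J =
     (THE W. connection_form B W \<and> (\<forall>p. {X. on_vec (W p) X = 0} = J p ` vertical B p))"

definition horizontal_lift ::
  "('p, 'm) su2_bundle \<Rightarrow> ('p \<Rightarrow> real^6 \<Rightarrow> real^6) \<Rightarrow> 'p \<Rightarrow> real^3 \<Rightarrow> real^6" where
  "horizontal_lift B J p \<xi> = (THE X. X \<in> J p ` vertical B p \<and> dproj B p X = \<xi>)"

text \<open>The value does not depend on the point \<open>p\<close> of the fibre; this is what \<open>THE\<close> expresses.\<close>

definition metric_of ::
  "('p, 'm) su2_bundle \<Rightarrow> ('p \<Rightarrow> real^6 \<Rightarrow> real^6) \<Rightarrow> 'm \<Rightarrow> real^3 \<Rightarrow> real^3 \<Rightarrow> real" where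
  "metric_of B J x \<xi> \<eta> = (THE r. \<forall>p. proj B p = x \<longrightarrow>
     r = killing (vertical_to_su2 B p (J p (horizontal_lift B J p \<xi>)))
                 (vertical_to_su2 B p (J p (horizontal_lift B J p \<eta>))))"

text \<open>The metric \<open>h\<close> on the base is the one to which \<open>- 2 Tr (E \<otimes> E)\<close> descends.\<close>

definition is_frame_for ::
  "('p, 'm) su2_bundle \<Rightarrow> 'p mform \<Rightarrow> ('m \<Rightarrow> real^3 \<Rightarrow> real^3 \<Rightarrow> real) \<Rightarrow> bool" where
  "is_frame_for B E h \<longleftrightarrow> (\<forall>p X Y.
     h (proj B p) (dproj B p X) (dproj B p Y) = - 2 * re_trace (on_vec (E p) X ** on_vec (E p) Y))"

end

theory Submission
  imports Defs
begin

text \<open>The 1-forms \<open>\<theta>\<^sup>i = W\<^sup>i + \<i> E\<^sup>i\<close> form a complex coframe \<open>T P \<rightarrow> \<complex>\<^sup>3\<close>, and \<open>F(W) = E \<and> E\<close> turns \<open>CS(W)\<close> into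
  \<open>Re (\<theta>\<^sup>1 \<and> \<theta>\<^sup>2 \<and> \<theta>\<^sup>3) / 2\<close>.  On \<open>\<complex>\<^sup>3\<close> the operator dual to \<open>K\<close> commutes with the symmetries
  \<open>diag(-\<i>, 1, \<i>)\<close> and the cyclic permutation of this 3-form and anticommutes with complex conjugation, which
  preserves the form but reverses the orientation; this forces it to be a real multiple of \<open>\<i>\<close>.  So \<open>J\<close> is, up to a
  sign, the complex structure pulled back along \<open>\<theta>\<close>: \<open>W(J X) = \<mp> E(X)\<close> and \<open>E(J X) = \<plusminus> W(X)\<close>.  As \<open>V = ker E\<close>, this gives
  \<open>J(V) = ker W\<close>, and for horizontal \<open>X\<close> the vertical vector \<open>J X\<close> corresponds to \<open>\<mp> E(X)\<close>, whence the metric.\<close>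

section \<open>Alternating forms\<close>

text \<open>Evaluating K on the model would mean expanding wedge products over the 720 permutations
  of six arguments. The symmetry argument avoids this expansion, at the price of leaving one real
  factor undetermined: the volume factor \<open>model_top\<close> is never computed, and nothing
  about the model alone is used to show that it is nonzero. This comes from negative type: if the
  pulled-back \<open>model_top\<close> is c times the volume form, then K is c times an operator of
  square -1, so \<lambda> = - c^2, and \<lambda> < 0 forces c to be nonzero. After normalisation
  only \<open>sgn c\<close> survives in J. The sign is harmless for the connection, since a kernel
  does not see it, and for the metric, where it occurs twice. It does matter for
  \<open>admissible\<close>, which asks J to be smooth and invariant: the sign has to be a smooth
  function on P and the same at all points of a fibre. The first follows from sgn c = c / sqrt (c^2)
  with c smooth and nonzero, the second from the connectedness of SU(2).\<close>

lemma alternating_form_local: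
  "alternating_form k \<alpha> \<Longrightarrow> (\<And>i. i < k \<Longrightarrow> X i = Y i) \<Longrightarrow> \<alpha> X = \<alpha> Y"
  unfolding alternating_form_def by blast

lemma alternating_form_linear:
  "alternating_form k \<alpha> \<Longrightarrow> i < k \<Longrightarrow> linear (\<lambda>u. \<alpha> (X(i := u)))"
  unfolding alternating_form_def by blast

lemma alternating_form_repeated:
  "alternating_form k \<alpha> \<Longrightarrow> i < k \<Longrightarrow> j < k \<Longrightarrow> i \<noteq> j \<Longrightarrow> X i = X j \<Longrightarrow> \<alpha> X = 0"
  unfolding alternating_form_def by (metis linorder_neqE_nat)

lemma alternating_formI:
  assumes "\<And>X Y. (\<And>i. i < k \<Longrightarrow> X i = Y i) \<Longrightarrow> \<alpha> X = \<alpha> Y"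
    and "\<And>X i. i < k \<Longrightarrow> linear (\<lambda>u. \<alpha> (X(i := u)))"
    and "\<And>X i j. i < j \<Longrightarrow> j < k \<Longrightarrow> X i = X j \<Longrightarrow> \<alpha> X = 0"
  shows "alternating_form k \<alpha>"
  using assms unfolding alternating_form_def by blast

text \<open>Polarisation: the form vanishes with \<open>X i + X j\<close> in both slots, and
  expanding leaves only the two mixed terms.\<close>

lemma alternating_form_transpose:
  assumes \<alpha>: "alternating_form k \<alpha>" and ij: "i < k" "j < k" "i \<noteq> j"
  shows "\<alpha> (X \<circ> Transposition.transpose i j) = - \<alpha> X"
proof -
  define f where "f u w = \<alpha> (X(i := u, j := w))" for u w
  have l2: "linear (f u)" for u
    unfolding f_def using alternating_form_linear[OF \<alpha> ij(2), of "X(i := u)"] by simp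
  have l1: "linear (\<lambda>u. f u w)" for w
    using alternating_form_linear[OF \<alpha> ij(1), of "X(j := w)"] ij(3)
    by (simp add: f_def fun_upd_twist)
  have z: "f u u = 0" for u
    unfolding f_def by (rule alternating_form_repeated[OF \<alpha> ij]) (use ij in auto)
  have "f (X i + X j) (X i + X j) = f (X i) (X j) + f (X j) (X i)"
    by (subst linear_add[OF l1], (subst linear_add[OF l2])+) (simp add: z)
  then have "f (X j) (X i) = - f (X i) (X j)"
    by (simp only: z eq_neg_iff_add_eq_0 add.commute)
  moreover have "X \<circ> Transposition.transpose i j = X(i := X j, j := X i)"
    using ij by (auto simp: fun_eq_iff Transposition.transpose_def)
  ultimately show ?thesis by (simp add: f_def)
qed

lemma alternating_form_permute:
  assumes \<alpha>: "alternating_form k \<alpha>" and "\<sigma> permutes {..<k}"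
  shows "\<alpha> (X \<circ> \<sigma>) = of_int (sign \<sigma>) *\<^sub>R \<alpha> X"
  using assms(2) finite_lessThan
proof (induction arbitrary: X rule: permutes_induct)
  case (swap a b p)
  have "sign (Transposition.transpose a b \<circ> p) = - sign p"
    using swap permutation_permutes[of p] by (subst sign_compose) (auto simp: sign_swap_id permutation_swap_id)
  moreover have "\<alpha> (X \<circ> (Transposition.transpose a b \<circ> p)) = of_int (sign p) *\<^sub>R \<alpha> (X \<circ> Transposition.transpose a b)"
    using swap.IH[of "X \<circ> Transposition.transpose a b"] by (simp only: o_assoc)
  ultimately show ?case
    using swap.hyps alternating_form_transpose[OF \<alpha>, of a b X] by (simp add: o_def)
qed (auto simp: sign_id)

lemma alternating_form_scale:
  assumes \<alpha>: "alternating_form k \<alpha>"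
  shows "\<alpha> (\<lambda>i. s i *\<^sub>R X i) = (\<Prod>i<k. s i) *\<^sub>R \<alpha> X"
proof -
  have "m \<le> k \<Longrightarrow> \<alpha> (\<lambda>i. if i < m then s i *\<^sub>R X i else X i) = (\<Prod>i<m. s i) *\<^sub>R \<alpha> X" for m
  proof (induction m)
    case (Suc m)
    let ?Y = "\<lambda>i. if i < m then s i *\<^sub>R X i else X i"
    have "(\<lambda>i. if i < Suc m then s i *\<^sub>R X i else X i) = ?Y(m := s m *\<^sub>R X m)"
      by (auto simp: fun_eq_iff less_Suc_eq)
    moreover have "?Y(m := X m) = ?Y" by (auto simp: fun_eq_iff)
    ultimately show ?case
      using Suc linear_scale[OF alternating_form_linear[OF \<alpha>, of m ?Y], of "s m" "X m"] by simp
  qed auto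
  from this[of k] show ?thesis
    using alternating_form_local[OF \<alpha>, of "\<lambda>i. s i *\<^sub>R X i" "\<lambda>i. if i < k then s i *\<^sub>R X i else X i"]
    by simp
qed

lemma alternating_form_compose:
  assumes \<alpha>: "alternating_form k \<alpha>" and L: "linear L"
  shows "alternating_form k (\<lambda>X. \<alpha> (\<lambda>i. L (X i)))"
proof (rule alternating_formI)
  show "\<alpha> (\<lambda>i. L (X i)) = \<alpha> (\<lambda>i. L (Y i))" if "\<And>i. i < k \<Longrightarrow> X i = Y i" for X Y
    using that by (intro alternating_form_local[OF \<alpha>]) auto
  show "linear (\<lambda>u. \<alpha> (\<lambda>l. L ((X(i := u)) l)))" if "i < k" for X i
  proof -
    have "(\<lambda>l. L ((X(i := u)) l)) = (\<lambda>l. L (X l))(i := L u)" for u by auto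
    then show ?thesis
      using linear_compose[OF L alternating_form_linear[OF \<alpha> that, of "\<lambda>l. L (X l)"]] by (simp add: o_def)
  qed
  show "\<alpha> (\<lambda>i. L (X i)) = 0" if "i < j" "j < k" "X i = X j" for X i j
    using that by (intro alternating_form_repeated[OF \<alpha>, of i j]) auto
qed

lemma alternating_form_scaleR:
  assumes \<alpha>: "alternating_form k \<alpha>"
  shows "alternating_form k (\<lambda>X. c *\<^sub>R \<alpha> X)"
proof (rule alternating_formI)
  show "c *\<^sub>R \<alpha> X = c *\<^sub>R \<alpha> Y" if "\<And>i. i < k \<Longrightarrow> X i = Y i" for X Y
    using alternating_form_local[OF \<alpha>] that by metis
  show "linear (\<lambda>u. c *\<^sub>R \<alpha> (X(i := u)))" if "i < k" for X i
    using alternating_form_linear[OF \<alpha> that] by (rule linear_compose_scale_right)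
  show "c *\<^sub>R \<alpha> X = 0" if "i < j" "j < k" "X i = X j" for X i j
    using alternating_form_repeated[OF \<alpha>, of i j X] that by simp
qed

lemma alternating_form_diff:
  assumes \<alpha>: "alternating_form k \<alpha>" and \<beta>: "alternating_form k \<beta>"
  shows "alternating_form k (\<lambda>X. \<alpha> X - \<beta> X)"
proof (rule alternating_formI)
  show "\<alpha> X - \<beta> X = \<alpha> Y - \<beta> Y" if "\<And>i. i < k \<Longrightarrow> X i = Y i" for X Y
    using alternating_form_local[OF \<alpha>] alternating_form_local[OF \<beta>] that by metis
  show "linear (\<lambda>u. \<alpha> (X(i := u)) - \<beta> (X(i := u)))" if "i < k" for X i
    using alternating_form_linear[OF \<alpha> that] alternating_form_linear[OF \<beta> that]
    by (rule linear_compose_sub)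
  show "\<alpha> X - \<beta> X = 0" if "i < j" "j < k" "X i = X j" for X i j
    using alternating_form_repeated[OF \<alpha>, of i j X] alternating_form_repeated[OF \<beta>, of i j X] that
    by simp
qed

lemma alternating_form_interior_product:
  assumes \<alpha>: "alternating_form (Suc k) \<alpha>"
  shows "alternating_form k (interior_product u \<alpha>)"
proof (rule alternating_formI)
  show "interior_product u \<alpha> X = interior_product u \<alpha> Y" if "\<And>i. i < k \<Longrightarrow> X i = Y i" for X Y
    unfolding interior_product_def using that
    by (intro alternating_form_local[OF \<alpha>]) (auto split: nat.split)
  show "linear (\<lambda>w. interior_product u \<alpha> (X(i := w)))" if "i < k" for X i
  proof -
    have "case_nat u (X(i := w)) = (case_nat u X)(Suc i := w)" for w
      by (auto simp: fun_eq_iff split: nat.split)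
    then show ?thesis
      unfolding interior_product_def using alternating_form_linear[OF \<alpha>, of "Suc i"] that by simp
  qed
  show "interior_product u \<alpha> X = 0" if "i < j" "j < k" "X i = X j" for X i j
    unfolding interior_product_def using that
    by (intro alternating_form_repeated[OF \<alpha>, of "Suc i" "Suc j"]) auto
qed

lemma alternating_form_1_iff:
  "alternating_form 1 \<alpha> \<longleftrightarrow> (\<forall>X. \<alpha> X = on_vec \<alpha> (X 0)) \<and> linear (on_vec \<alpha>)"
proof (intro iffI conjI allI)
  assume \<alpha>: "alternating_form 1 \<alpha>"
  show loc: "\<alpha> X = on_vec \<alpha> (X 0)" for X
    by (rule alternating_form_local[OF \<alpha>]) simp
  have "linear (\<lambda>u. \<alpha> ((\<lambda>_. 0)(0 := u)))"
    by (rule alternating_form_linear[OF \<alpha>]) simp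
  moreover have "\<alpha> ((\<lambda>_. 0)(0 := u)) = on_vec \<alpha> u" for u
    by (subst loc) simp
  ultimately show "linear (on_vec \<alpha>)" by simp
next
  assume *: "(\<forall>X. \<alpha> X = on_vec \<alpha> (X 0)) \<and> linear (on_vec \<alpha>)"
  show "alternating_form 1 \<alpha>"
  proof (rule alternating_formI)
    show "\<alpha> X = \<alpha> Y" if "\<And>i. i < 1 \<Longrightarrow> X i = Y i" for X Y
      using * that[of 0] by (metis less_one)
    show "linear (\<lambda>u. \<alpha> (X(i := u)))" if "i < 1" for X i
    proof -
      have "\<alpha> (X(i := u)) = on_vec \<alpha> u" for u
        using * that by (metis fun_upd_same less_one)
      then show ?thesis using * by simp
    qed
  qed auto
qed

lemma alternating_form_wedge:
  fixes \<alpha> :: "('v::real_vector, 'a::real_vector) form" and \<beta> :: "('v, 'b::real_vector) form"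
    and m :: "'a \<Rightarrow> 'b \<Rightarrow> 'c::real_vector"
  assumes \<alpha>: "alternating_form k \<alpha>" and \<beta>: "alternating_form l \<beta>"
    and m1: "\<And>b. linear (\<lambda>a. m a b)" and m2: "\<And>a. linear (m a)"
  shows "alternating_form (k + l) (wedge m k l \<alpha> \<beta>)"
proof -
  define T where "T \<sigma> X = of_int (sign \<sigma>) *\<^sub>R m (\<alpha> (\<lambda>i. X (\<sigma> i))) (\<beta> (\<lambda>i. X (\<sigma> (k + i))))"
    for \<sigma> :: "nat \<Rightarrow> nat" and X
  define S where "S X = (\<Sum>\<sigma> | \<sigma> permutes {..<k + l}. T \<sigma> X)" for X
  have "alternating_form (k + l) S"
  proof (rule alternating_formI)
    fix X Y :: "nat \<Rightarrow> 'v"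
    assume XY: "X i = Y i" if "i < k + l" for i
    have "T \<sigma> X = T \<sigma> Y" if "\<sigma> permutes {..<k + l}" for \<sigma>
    proof -
      have "\<sigma> i < k + l" if "i < k + l" for i
        using permutes_in_image[OF \<open>\<sigma> permutes _\<close>, of i] that by simp
      then have "\<alpha> (\<lambda>i. X (\<sigma> i)) = \<alpha> (\<lambda>i. Y (\<sigma> i))" "\<beta> (\<lambda>i. X (\<sigma> (k + i))) = \<beta> (\<lambda>i. Y (\<sigma> (k + i)))"
        by (auto intro!: alternating_form_local[OF \<alpha>] alternating_form_local[OF \<beta>] XY)
      then show ?thesis by (simp add: T_def)
    qed
    then show "S X = S Y" unfolding S_def by (intro sum.cong) auto
  next
    fix X :: "nat \<Rightarrow> 'v" and j assume j: "j < k + l"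
    have "linear (\<lambda>u. T \<sigma> (X(j := u)))" if \<sigma>: "\<sigma> permutes {..<k + l}" for \<sigma>
    proof -
      \<comment> \<open>The vector in slot \<open>j\<close> reaches position \<open>i\<close> after
        permuting; it is an argument of \<open>\<alpha>\<close> if \<open>i < k\<close> and of
        \<open>\<beta>\<close> otherwise, so exactly one factor depends on it.\<close>
      define i where "i = inv \<sigma> j"
      have eq: "\<sigma> a = j \<longleftrightarrow> a = i" for a
        using permutes_inverses[OF \<sigma>] unfolding i_def by metis
      have i: "i < k + l"
        using permutes_in_image[OF permutes_inv[OF \<sigma>], of j] j by (simp add: i_def)
      show ?thesis
      proof (cases "i < k")
        case True
        then have "(\<lambda>a. (X(j := u)) (\<sigma> a)) = (\<lambda>a. X (\<sigma> a))(i := u)"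
          and "(\<lambda>a. (X(j := u)) (\<sigma> (k + a))) = (\<lambda>a. X (\<sigma> (k + a)))" for u
          by (auto simp: fun_eq_iff eq)
        then show ?thesis
          unfolding T_def
          using linear_compose[OF alternating_form_linear[OF \<alpha> True] m1]
          by (auto simp: o_def intro!: linear_compose_scale_right)
      next
        case False
        then obtain b where b: "i = k + b" "b < l" using i by (metis add_diff_inverse_nat nat_add_left_cancel_less)
        then have "\<alpha> (\<lambda>a. (X(j := u)) (\<sigma> a)) = \<alpha> (\<lambda>a. X (\<sigma> a))"
          and "(\<lambda>a. (X(j := u)) (\<sigma> (k + a))) = (\<lambda>a. X (\<sigma> (k + a)))(b := u)" for u
          by (auto simp: fun_eq_iff eq intro!: alternating_form_local[OF \<alpha>])
        then show ?thesis
          unfolding T_def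
          using linear_compose[OF alternating_form_linear[OF \<beta> b(2)] m2]
          by (auto simp: o_def intro!: linear_compose_scale_right)
      qed
    qed
    then show "linear (\<lambda>u. S (X(j := u)))"
      unfolding S_def by (intro linear_compose_sum) auto
  next
    fix X :: "nat \<Rightarrow> 'v" and i j assume ij: "i < j" "j < k + l" "X i = X j"
    let ?t = "Transposition.transpose i j"
    have t: "?t permutes {..<k + l}" using ij by (intro permutes_swap_id) auto
    have Xt: "X (?t a) = X a" for a using ij(3) by (auto simp: Transposition.transpose_def)
    have "T (?t \<circ> \<sigma>) X = - T \<sigma> X" if "\<sigma> permutes {..<k + l}" for \<sigma>
    proof -
      have "permutation \<sigma>" using that permutation_permutes finite_lessThan by blast
      then have "sign (?t \<circ> \<sigma>) = - sign \<sigma>"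
        using ij by (subst sign_compose) (auto simp: sign_swap_id permutation_swap_id)
      then show ?thesis by (simp add: T_def Xt)
    qed
    \<comment> \<open>Composing with the transposition only reindexes the sum, yet it changes the
      sign of every term.\<close>
    then have "S X = - S X"
      unfolding S_def by (subst setum_permutations_compose_left[OF t]) (simp add: sum_negf)
    then have "2 *\<^sub>R S X = 0" by (simp add: scaleR_2 eq_neg_iff_add_eq_0)
    then show "S X = 0" by simp
  qed
  then have "alternating_form (k + l) (\<lambda>X. (1 / (fact k * fact l)) *\<^sub>R S X)"
    by (rule alternating_form_scaleR)
  then show ?thesis by (simp add: S_def[abs_def] T_def wedge_def[abs_def])
qed

text \<open>By linearity the arguments can be replaced one slot at a time by members of the spanning
  family. What remains are selections from \<open>b\<close>: with a repetition they give 0,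
  otherwise they permute \<open>b\<close> and give plus or minus \<open>\<alpha> b\<close>. This
  stands in for the one-dimensionality of top forms and is how identities of 6-forms are reduced to
  a single value.\<close>

lemma alternating_form_eq_0:
  assumes \<alpha>: "alternating_form k \<alpha>" and span: "span (b ` {..<k}) = UNIV" and 0: "\<alpha> b = 0"
  shows "\<alpha> X = 0"
proof -
  \<comment> \<open>The first \<open>m\<close> slots are arbitrary, the others already hold members
    of \<open>b\<close>; the induction frees one more slot at a time.\<close>
  have "m \<le> k \<Longrightarrow> (\<And>i. m \<le> i \<Longrightarrow> i < k \<Longrightarrow> X i \<in> b ` {..<k}) \<Longrightarrow> \<alpha> X = 0" for m X
  proof (induction m arbitrary: X)
    case 0
    then have "\<forall>i\<in>{..<k}. \<exists>a. a < k \<and> X i = b a" by fastforce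
    then obtain f where f: "f i < k" "X i = b (f i)" if "i < k" for i by (metis lessThan_iff)
    show ?case
    proof (cases "inj_on f {..<k}")
      case False
      then obtain i j where "i < k" "j < k" "i \<noteq> j" "f i = f j" by (auto simp: inj_on_def)
      then show ?thesis using f by (intro alternating_form_repeated[OF \<alpha>, of i j]) auto
    next
      case True
      \<comment> \<open>\<open>permutes\<close> demands the identity outside \<open>{..<k}\<close>,
        where \<open>f\<close> is unspecified.\<close>
      define \<sigma> where "\<sigma> i = (if i < k then f i else i)" for i
      have "bij_betw f {..<k} {..<k}"
        using True f endo_inj_surj[of "{..<k}" f] by (auto simp: bij_betw_def)
      then have "\<sigma> permutes {..<k}"
        using bij_betw_cong[of "{..<k}" f \<sigma> "{..<k}"]
        by (intro bij_imp_permutes) (auto simp: \<sigma>_def)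
      moreover have "\<alpha> X = \<alpha> (b \<circ> \<sigma>)"
        using f by (intro alternating_form_local[OF \<alpha>]) (auto simp: \<sigma>_def)
      ultimately show ?thesis using alternating_form_permute[OF \<alpha>] assms(3) by simp
    qed
  next
    case (Suc m)
    have lin: "linear (\<lambda>u. \<alpha> (X(m := u)))"
      using Suc.prems by (intro alternating_form_linear[OF \<alpha>]) auto
    have "\<alpha> (X(m := u)) = 0" if "u \<in> span (b ` {..<k})" for u
      using lin linear_zero that
    proof (rule linear_eq_on)
      fix u assume "u \<in> b ` {..<k}"
      then show "\<alpha> (X(m := u)) = 0"
        using Suc.prems by (intro Suc.IH) (auto simp: Suc_le_eq)
    qed
    from this[of "X m"] show ?case using span by simp
  qed
  from this[of k] show ?thesis by simp
qed

lemma top_form_proportional: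
  fixes \<alpha> \<beta> :: "('v::real_vector, real) form"
  assumes \<alpha>: "alternating_form k \<alpha>" and \<beta>: "alternating_form k \<beta>"
    and span: "span (b ` {..<k}) = UNIV" and nz: "\<alpha> b \<noteq> 0"
  shows "\<beta> X = \<beta> b / \<alpha> b * \<alpha> X"
  using alternating_form_eq_0[OF alternating_form_diff[OF \<beta> alternating_form_scaleR[OF \<alpha>, of "\<beta> b / \<alpha> b"]] span, of X]
    nz by simp

section \<open>Wedge and interior products under linear pullback\<close>

lemma wedge_compose:
  "wedge m k l (\<lambda>X. \<alpha> (\<lambda>i. L (X i))) (\<lambda>X. \<beta> (\<lambda>i. L (X i))) X = wedge m k l \<alpha> \<beta> (\<lambda>i. L (X i))"
  by (simp add: wedge_def)

lemma interior_product_compose: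
  "interior_product u (\<lambda>X. \<alpha> (\<lambda>i. L (X i))) X = interior_product (L u) \<alpha> (\<lambda>i. L (X i))"
proof -
  have "(\<lambda>i. L (case_nat u X i)) = case_nat (L u) (\<lambda>i. L (X i))"
    by (auto simp: fun_eq_iff split: nat.split)
  then show ?thesis by (simp add: interior_product_def)
qed

section \<open>The real part of the complex volume form\<close>

lemma wedge_sum_left:
  assumes "\<And>b. linear (\<lambda>a. m a b)"
  shows "wedge m k l (\<lambda>X. \<Sum>b\<in>S. c b *\<^sub>R \<alpha> b X) \<beta> X = (\<Sum>b\<in>S. c b *\<^sub>R wedge m k l (\<alpha> b) \<beta> X)"
proof -
  have "m (\<Sum>b\<in>S. c b *\<^sub>R f b) w = (\<Sum>b\<in>S. c b *\<^sub>R m (f b) w)" for f w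
    using linear_sum[OF assms, of "\<lambda>b. c b *\<^sub>R f b" S w] linear_scale[OF assms] by simp
  then show ?thesis
    by (simp add: wedge_def scaleR_sum_right mult_ac) (rule sum.swap)
qed

lemma wedge_sum_right:
  assumes "\<And>a. linear (m a)"
  shows "wedge m k l \<alpha> (\<lambda>X. \<Sum>b\<in>S. c b *\<^sub>R \<beta> b X) X = (\<Sum>b\<in>S. c b *\<^sub>R wedge m k l \<alpha> (\<beta> b) X)"
proof -
  have "m w (\<Sum>b\<in>S. c b *\<^sub>R f b) = (\<Sum>b\<in>S. c b *\<^sub>R m w (f b))" for f w
    using linear_sum[OF assms, of w "\<lambda>b. c b *\<^sub>R f b" S] linear_scale[OF assms] by simp
  then show ?thesis
    by (simp add: wedge_def scaleR_sum_right mult_ac) (rule sum.swap)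
qed

lemma linear_mult_right: "linear (\<lambda>a. a * (b::real))" and linear_mult_left: "linear ((*) (b::real))"
  by (auto intro!: linearI simp: algebra_simps)

text \<open>The form Re (dz1 \<and> dz2 \<and> dz3) / 2; the factor 1/2 is the one that the traces
  in the Chern-Simons form produce.\<close>

definition model_form :: "(complex^3, real) form" where
  "model_form Z = (1 / 2) * Re (det (vector [Z 0, Z 1, Z 2] :: complex^3^3))"

lemma model_form_alternating: "alternating_form 3 model_form"
proof (rule alternating_formI)
  show "linear (\<lambda>u. model_form (X(i := u)))" if "i < 3" for X i
  proof -
    have "i = 0 \<or> i = 1 \<or> i = 2" using that by auto
    then show ?thesis
      by (elim disjE) (auto intro!: linearI simp: model_form_def det_3 algebra_simps add_divide_distrib diff_divide_distrib
          simp del: times_complex.sel)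
  qed
  show "model_form X = 0" if "i < j" "j < 3" "X i = X j" for X i j
  proof -
    have "(i = 0 \<and> j = 1) \<or> (i = 0 \<and> j = 2) \<or> (i = 1 \<and> j = 2)" using that by auto
    then show ?thesis using that(3)
      by (elim disjE) (auto simp: model_form_def det_3)
  qed
qed (simp add: model_form_def)

text \<open>The 6-form a \<and> i_\<xi> \<Omega> \<and> \<Omega> from the definition of K for the
  model, before division by a volume form. The covector is kept as a function on vectors, so that
  composing it with a symmetry is plain composition.\<close>

definition hitchin_form ::
  "(complex^3 \<Rightarrow> real) \<Rightarrow> complex^3 \<Rightarrow> (complex^3, real) form" where
  "hitchin_form a \<xi> =
     wedge (*) 3 3 (wedge (*) 1 2 (\<lambda>X. a (X 0)) (interior_product \<xi> model_form)) model_form"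

lemma hitchin_form_alternating:
  assumes "linear a"
  shows "alternating_form 6 (hitchin_form a \<xi>)"
proof -
  have "alternating_form 1 (\<lambda>X. a (X 0))"
    using assms by (subst alternating_form_1_iff) simp
  moreover have "alternating_form 2 (interior_product \<xi> model_form)"
    using model_form_alternating by (intro alternating_form_interior_product) (simp add: eval_nat_numeral)
  ultimately have "alternating_form (1 + 2) (wedge (*) 1 2 (\<lambda>X. a (X 0)) (interior_product \<xi> model_form))"
    by (rule alternating_form_wedge[OF _ _ linear_mult_right linear_mult_left])
  then have "alternating_form (3 + 3) (hitchin_form a \<xi>)"
    unfolding hitchin_form_def
    by (intro alternating_form_wedge model_form_alternating linear_mult_right linear_mult_left)
      (simp add: numeral_3_eq_3)
  then show ?thesis by simp
qed

lemma hitchin_form_expand_covector: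
  assumes "linear a"
  shows "hitchin_form a \<xi> X = (\<Sum>b\<in>Basis. a b * hitchin_form (\<lambda>z. z \<bullet> b) \<xi> X)"
proof -
  have "a z = (\<Sum>b\<in>Basis. a b *\<^sub>R (z \<bullet> b))" for z
    using linear_sum[OF assms, of "\<lambda>b. (z \<bullet> b) *\<^sub>R b" Basis]
    by (simp add: linear_scale[OF assms] euclidean_representation mult.commute)
  then have a: "(\<lambda>X::nat \<Rightarrow> complex^3. a (X 0)) = (\<lambda>X. \<Sum>b\<in>Basis. a b *\<^sub>R (X 0 \<bullet> b))"
    by (intro ext)
  have "wedge (*) 1 2 (\<lambda>X. a (X 0)) (interior_product \<xi> model_form) =
      (\<lambda>Z. \<Sum>b\<in>Basis. a b *\<^sub>R wedge (*) 1 2 (\<lambda>X. X 0 \<bullet> b) (interior_product \<xi> model_form) Z)"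
    unfolding a by (intro ext wedge_sum_left linear_mult_right)
  then have "hitchin_form a \<xi> X = (\<Sum>b\<in>Basis. a b *\<^sub>R hitchin_form (\<lambda>z. z \<bullet> b) \<xi> X)"
    unfolding hitchin_form_def by (simp only: wedge_sum_left[OF linear_mult_right])
  then show ?thesis by simp
qed

lemma hitchin_form_expand_vector:
  "hitchin_form a \<xi> X = (\<Sum>b\<in>Basis. (\<xi> \<bullet> b) * hitchin_form a b X)"
proof -
  have lin: "linear (\<lambda>u. interior_product u model_form Z)" for Z
  proof -
    have "interior_product u model_form Z = model_form ((case_nat 0 Z)(0 := u))" for u
      unfolding interior_product_def
      by (rule arg_cong[of _ _ model_form]) (auto simp: fun_eq_iff split: nat.split)
    then show ?thesis
      using alternating_form_linear[OF model_form_alternating, of 0 "case_nat 0 Z"] by simp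
  qed
  have "interior_product \<xi> model_form = (\<lambda>Z. \<Sum>b\<in>Basis. (\<xi> \<bullet> b) *\<^sub>R interior_product b model_form Z)"
    using linear_sum[OF lin, of "\<lambda>b. (\<xi> \<bullet> b) *\<^sub>R b" Basis] linear_scale[OF lin]
    by (simp add: fun_eq_iff euclidean_representation)
  then have "wedge (*) 1 2 (\<lambda>X. a (X 0)) (interior_product \<xi> model_form) =
      (\<lambda>Z. \<Sum>b\<in>Basis. (\<xi> \<bullet> b) *\<^sub>R wedge (*) 1 2 (\<lambda>X. a (X 0)) (interior_product b model_form) Z)"
    by (intro ext) (simp only: wedge_sum_right[OF linear_mult_left])
  then show ?thesis
    unfolding hitchin_form_def by (simp only: wedge_sum_left[OF linear_mult_right]) simp
qed

text \<open>A real basis of C^3 with each axis vector followed by its multiple by \<i>. As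
  \<open>of_nat 0\<close> is 3 in the type \<open>3\<close>, slots 0 and 1 belong to coordinate 3,
  slots 2 and 3 to coordinate 1, slots 4 and 5 to coordinate 2.\<close>

definition c3_basis :: "nat \<Rightarrow> complex^3" where
  "c3_basis n = axis (of_nat (n div 2)) (if even n then 1 else \<i>)"

lemma lessThan_6: "{..<6::nat} = {0, 1, 2, 3, 4, 5}"
  by auto

lemma span_c3_basis: "span (c3_basis ` {..<6}) = UNIV"
proof -
  have "Basis \<subseteq> c3_basis ` {..<6}"
  proof
    fix b :: "complex^3" assume "b \<in> Basis"
    then obtain k u where b: "b = axis k u" "u \<in> {1, \<i>}"
      by (auto simp: Basis_vec_def Basis_complex_def)
    have "\<exists>n<3. k = of_nat n"
    proof -
      have "k = of_nat 1 \<or> k = of_nat 2 \<or> k = of_nat 0" using exhaust_3[of k] by auto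
      moreover have "(0::nat) < 3" "(1::nat) < 3" "(2::nat) < 3" by auto
      ultimately show ?thesis by blast
    qed
    then obtain n where n: "n < 3" "k = of_nat n" by blast
    have "b = c3_basis (2 * n + (if u = 1 then 0 else 1))"
      using b n by (auto simp: c3_basis_def)
    moreover have "2 * n + (if u = 1 then 0 else 1) < 6" using n by auto
    ultimately show "b \<in> c3_basis ` {..<6}" by blast
  qed
  then show ?thesis using span_mono[of Basis "c3_basis ` {..<6}"] unfolding span_Basis by blast
qed

text \<open>A linear symmetry \<open>g\<close> of the model form commutes or anticommutes with \<open>hitchin_map\<close> according
  to its effect \<open>d\<close> on top forms.\<close>

definition hitchin_map :: "complex^3 \<Rightarrow> complex^3" where
  "hitchin_map \<xi> = (\<Sum>b\<in>Basis. hitchin_form (\<lambda>z. z \<bullet> b) \<xi> c3_basis *\<^sub>R b)"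

text \<open>Identifies \<open>hitchin_map\<close> as the operator on vectors dual to the covector
  operator K, where 6-forms are turned into numbers by evaluation at
  \<open>c3_basis\<close>.\<close>

lemma hitchin_map_dual:
  assumes "linear a"
  shows "a (hitchin_map \<xi>) = hitchin_form a \<xi> c3_basis"
proof -
  have "a (hitchin_map \<xi>) = (\<Sum>b\<in>Basis. a (hitchin_form (\<lambda>z. z \<bullet> b) \<xi> c3_basis *\<^sub>R b))"
    unfolding hitchin_map_def by (rule linear_sum[OF assms])
  also have "\<dots> = (\<Sum>b\<in>Basis. a b * hitchin_form (\<lambda>z. z \<bullet> b) \<xi> c3_basis)"
    by (intro sum.cong refl) (simp only: linear_scale[OF assms] real_scaleR_def mult.commute)
  also have "\<dots> = hitchin_form a \<xi> c3_basis"
    by (rule hitchin_form_expand_covector[OF assms, symmetric])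
  finally show ?thesis .
qed

lemma linear_inner_left: "linear (\<lambda>z. z \<bullet> (b::'a::real_inner))"
  by (rule bounded_linear.linear[OF bounded_linear_inner_left])

lemma hitchin_map_linear: "linear hitchin_map"
proof -
  have expand: "hitchin_map \<xi> = (\<Sum>b\<in>Basis. (\<xi> \<bullet> b) *\<^sub>R hitchin_map b)" for \<xi>
  proof (rule euclidean_eqI)
    fix c :: "complex^3" assume "c \<in> Basis"
    show "hitchin_map \<xi> \<bullet> c = (\<Sum>b\<in>Basis. (\<xi> \<bullet> b) *\<^sub>R hitchin_map b) \<bullet> c"
      unfolding inner_sum_left inner_scaleR_left hitchin_map_dual[OF linear_inner_left]
      by (rule hitchin_form_expand_vector)
  qed
  have lin: "linear (\<lambda>\<xi>. \<Sum>b\<in>Basis. (\<xi> \<bullet> b) *\<^sub>R hitchin_map b)"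
    by (intro linear_compose_sum ballI linearI) (simp_all add: inner_left_distrib scaleR_left_distrib)
  show ?thesis
    by (rule iffD2[OF arg_cong[of _ _ linear] lin]) (rule ext, rule expand)
qed

text \<open>Naturality of a \<and> i_\<xi> \<Omega> \<and> \<Omega>: since \<open>g\<close>
  preserves \<open>model_form\<close>, pulling back along \<open>g\<close> turns the covector
  \<open>a\<close> into \<open>a\<close> after \<open>g\<close> and trades \<xi> for
  \<open>g \<xi>\<close>. The value at the image of \<open>c3_basis\<close> differs by the real
  determinant of \<open>g\<close>, which \<open>top\<close> expresses through its action on
  6-forms.\<close>

lemma hitchin_map_symmetry:
  assumes g: "linear g" and inv: "\<And>Z. model_form (\<lambda>i. g (Z i)) = model_form Z"
    and top: "\<And>\<alpha> :: (complex^3, real) form. alternating_form 6 \<alpha> \<Longrightarrow> \<alpha> (\<lambda>i. g (c3_basis i)) = d * \<alpha> c3_basis"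
    and d: "d * d = 1"
  shows "hitchin_map (g \<xi>) = d *\<^sub>R g (hitchin_map \<xi>)"
proof (rule euclidean_eqI)
  fix b :: "complex^3" assume "b \<in> Basis"
  let ?a = "\<lambda>z. z \<bullet> b"
  have a: "linear ?a" by (rule linear_inner_left)
  have ag: "linear (\<lambda>z. g z \<bullet> b)" using linear_compose[OF g a] by (simp add: o_def)
  have "g (hitchin_map \<xi>) \<bullet> b = hitchin_form (\<lambda>z. ?a (g z)) \<xi> c3_basis"
    using hitchin_map_dual[OF ag] by simp
  also have "\<dots> = hitchin_form ?a (g \<xi>) (\<lambda>i. g (c3_basis i))"
  proof -
    have m: "model_form = (\<lambda>X. model_form (\<lambda>i. g (X i)))" using inv by (simp add: fun_eq_iff)
    have i: "interior_product \<xi> model_form = (\<lambda>X. interior_product (g \<xi>) model_form (\<lambda>i. g (X i)))"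
      by (subst m) (simp add: fun_eq_iff interior_product_compose)
    let ?\<omega> = "wedge (*) 1 2 (\<lambda>X. X 0 \<bullet> b) (interior_product (g \<xi>) model_form)"
    have "wedge (*) 1 2 (\<lambda>X. g (X 0) \<bullet> b) (interior_product \<xi> model_form) = (\<lambda>X. ?\<omega> (\<lambda>i. g (X i)))"
      unfolding i by (rule ext, rule wedge_compose)
    then have "hitchin_form (\<lambda>z. ?a (g z)) \<xi> c3_basis =
        wedge (*) 3 3 (\<lambda>X. ?\<omega> (\<lambda>i. g (X i))) (\<lambda>X. model_form (\<lambda>i. g (X i))) c3_basis"
      unfolding hitchin_form_def inv by simp
    also have "\<dots> = hitchin_form ?a (g \<xi>) (\<lambda>i. g (c3_basis i))"
      unfolding hitchin_form_def by (rule wedge_compose)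
    finally show ?thesis .
  qed
  also have "\<dots> = d * (hitchin_map (g \<xi>) \<bullet> b)"
    using top[OF hitchin_form_alternating[OF a]] hitchin_map_dual[OF a] by simp
  finally show "hitchin_map (g \<xi>) \<bullet> b = d *\<^sub>R g (hitchin_map \<xi>) \<bullet> b"
    using d by (simp add: mult.assoc[symmetric])
qed

text \<open>Conjugation negates the three imaginary basis vectors, the odd slots, so its real
  determinant is -1. This symmetry makes the eigenvalue purely imaginary.\<close>

lemma hitchin_map_cnj:
  "hitchin_map (\<chi> k. cnj (\<xi> $ k)) = - (\<chi> k. cnj (hitchin_map \<xi> $ k))"
proof -
  have "hitchin_map (\<chi> k. cnj (\<xi> $ k)) = (-1) *\<^sub>R (\<chi> k. cnj (hitchin_map \<xi> $ k))"
  proof (rule hitchin_map_symmetry[where g="\<lambda>z. \<chi> k. cnj (z $ k)"])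
    show "linear (\<lambda>z::complex^3. \<chi> k. cnj (z $ k))"
      by (auto intro!: linearI simp: vec_eq_iff)
    show "model_form (\<lambda>i. \<chi> k. cnj (Z i $ k)) = model_form Z" for Z
      by (simp add: model_form_def det_3 algebra_simps)
    fix \<alpha> :: "(complex^3, real) form" assume \<alpha>: "alternating_form 6 \<alpha>"
    have "(\<lambda>i. \<chi> k. cnj (c3_basis i $ k)) = (\<lambda>i. (-1) ^ i *\<^sub>R c3_basis i)"
      by (auto simp: fun_eq_iff vec_eq_iff c3_basis_def axis_def)
    moreover have "(\<Prod>i<6::nat. (-1::real) ^ i) = -1" by (simp add: lessThan_6)
    ultimately show "\<alpha> (\<lambda>i. \<chi> k. cnj (c3_basis i $ k)) = -1 * \<alpha> c3_basis"
      using alternating_form_scale[OF \<alpha>, of "\<lambda>i. (-1) ^ i" c3_basis] by simp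
  qed simp
  then show ?thesis by simp
qed

lemma hitchin_map_cyclic:
  "hitchin_map (\<chi> k. \<xi> $ (k - 1)) = (\<chi> k. hitchin_map \<xi> $ (k - 1))"
proof -
  have "hitchin_map (\<chi> k. \<xi> $ (k - 1)) = 1 *\<^sub>R (\<chi> k. hitchin_map \<xi> $ (k - 1))"
  proof (rule hitchin_map_symmetry[where g="\<lambda>z. \<chi> k. z $ (k - 1)"])
    show "linear (\<lambda>z::complex^3. \<chi> k. z $ (k - 1))"
      by (auto intro!: linearI simp: vec_eq_iff)
    \<comment> \<open>For \<open>k = 1\<close> the index \<open>k - 1\<close> is 0, which has to be
      recognised as coordinate 3.\<close>
    have zero3: "(0::3) = 3" by simp
    show "model_form (\<lambda>i. \<chi> k. Z i $ (k - 1)) = model_form Z" for Z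
      by (simp add: model_form_def det_3 zero3 algebra_simps del: times_complex.sel)
    fix \<alpha> :: "(complex^3, real) form" assume \<alpha>: "alternating_form 6 \<alpha>"
    \<comment> \<open>Moving on by one coordinate moves on by two slots. The cube of this
      permutation is the identity, so its sign has cube 1 and is 1.\<close>
    define \<sigma> :: "nat \<Rightarrow> nat" where "\<sigma> i = (if i < 6 then (i + 2) mod 6 else i)" for i
    have "i < 6 \<Longrightarrow> \<sigma> (\<sigma> (\<sigma> i)) = i" for i
      unfolding lessThan_iff[symmetric] lessThan_6 by (auto simp: \<sigma>_def)
    then have 3: "\<sigma> \<circ> \<sigma> \<circ> \<sigma> = id" by (auto simp: fun_eq_iff \<sigma>_def)
    then have "bij \<sigma>" by (metis comp_assoc o_bij)
    then have \<sigma>: "\<sigma> permutes {..<6}"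
      unfolding permutes_def by (auto simp: \<sigma>_def bij_iff)
    then have p: "permutation \<sigma>" using permutation_permutes by blast
    have "sign \<sigma> * sign \<sigma> * sign \<sigma> = 1"
      using 3 p by (metis permutation_compose sign_compose sign_id)
    then have "sign \<sigma> = 1" by (simp add: sign_def split: if_splits)
    moreover have "(\<chi> k. c3_basis i $ (k - 1)) = c3_basis (\<sigma> i)" if "i < 6" for i
      using that unfolding lessThan_iff[symmetric] lessThan_6
      by (auto simp: vec_eq_iff c3_basis_def axis_def \<sigma>_def forall_3)
    ultimately show "\<alpha> (\<lambda>i. \<chi> k. c3_basis i $ (k - 1)) = 1 * \<alpha> c3_basis"
      using alternating_form_permute[OF \<alpha> \<sigma>, of c3_basis]
        alternating_form_local[OF \<alpha>, of "\<lambda>i. \<chi> k. c3_basis i $ (k - 1)" "c3_basis \<circ> \<sigma>"] by simp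
  qed simp
  then show ?thesis by simp
qed

text \<open>The diagonal of an element of SU(3): the product 1 preserves \<open>model_form\<close>,
  the entry 1 at coordinate 2 alone singles out that axis, and the entry \<i> at coordinate 3
  carries \<open>axis 3 1\<close> to \<open>axis 3 \<i>\<close>.\<close>

definition phase :: "3 \<Rightarrow> complex" where
  "phase k = (if k = 1 then - \<i> else if k = 2 then 1 else \<i>)"

lemma hitchin_map_phase:
  "hitchin_map (\<chi> k. phase k * \<xi> $ k) = (\<chi> k. phase k * hitchin_map \<xi> $ k)"
proof -
  have "hitchin_map (\<chi> k. phase k * \<xi> $ k) = 1 *\<^sub>R (\<chi> k. phase k * hitchin_map \<xi> $ k)"
  proof (rule hitchin_map_symmetry[where g="\<lambda>z. \<chi> k. phase k * z $ k"])
    show "linear (\<lambda>z::complex^3. \<chi> k. phase k * z $ k)"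
      by (auto intro!: linearI simp: vec_eq_iff algebra_simps)
    have "det (vector [\<chi> k. phase k * x $ k, \<chi> k. phase k * y $ k, \<chi> k. phase k * z $ k] :: complex^3^3)
        = (phase 1 * phase 2 * phase 3) * det (vector [x, y, z] :: complex^3^3)" for x y z
      by (simp add: det_3 algebra_simps)
    moreover have "phase 1 * phase 2 * phase 3 = 1" by (simp add: phase_def)
    ultimately show "model_form (\<lambda>i. \<chi> k. phase k * Z i $ k) = model_form Z" for Z
      by (simp add: model_form_def)
    fix \<alpha> :: "(complex^3, real) form" assume \<alpha>: "alternating_form 6 \<alpha>"
    \<comment> \<open>Multiplication by \<i> on coordinate 3 (slots 0 and 1) and by -\<i> on
      coordinate 1 (slots 2 and 3) exchanges the two vectors of each pair with one change of sign
      per pair, recorded in \<open>s\<close>. Two transpositions and two signs cancel.\<close>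
    define \<sigma> :: "nat \<Rightarrow> nat" where "\<sigma> = Transposition.transpose 0 1 \<circ> Transposition.transpose 2 3"
    define s :: "nat \<Rightarrow> real" where "s i = (if i = 1 \<or> i = 2 then -1 else 1)" for i
    have \<sigma>: "\<sigma> permutes {..<6}"
      unfolding \<sigma>_def by (intro permutes_compose permutes_swap_id) auto
    have "sign \<sigma> = 1"
      unfolding \<sigma>_def by (subst sign_compose) (auto simp: permutation_swap_id sign_swap_id)
    moreover have "(\<Prod>i<6. s i) = 1" by (simp add: lessThan_6 s_def)
    moreover have "(\<chi> k. phase k * c3_basis i $ k) = s i *\<^sub>R (c3_basis \<circ> \<sigma>) i" if "i < 6" for i
      using that unfolding lessThan_iff[symmetric] lessThan_6
      by (auto simp: vec_eq_iff c3_basis_def axis_def \<sigma>_def forall_3 phase_def s_def Transposition.transpose_def)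
    ultimately show "\<alpha> (\<lambda>i. \<chi> k. phase k * c3_basis i $ k) = 1 * \<alpha> c3_basis"
      using alternating_form_permute[OF \<alpha> \<sigma>, of c3_basis]
        alternating_form_scale[OF \<alpha>, of s "c3_basis \<circ> \<sigma>"]
        alternating_form_local[OF \<alpha>, of "\<lambda>i. \<chi> k. phase k * c3_basis i $ k" "\<lambda>i. s i *\<^sub>R (c3_basis \<circ> \<sigma>) i"] by simp
  qed simp
  then show ?thesis by simp
qed

text \<open>The vector \<open>axis 2 1\<close> is fixed by the phase symmetry, hence so is its
  image, which therefore lies on the same axis; conjugation makes the factor imaginary. The cyclic
  symmetry carries the result to all three axes, and the phase \<i> at coordinate 3 carries it to
  the multiples of the axes by \<i>, so it holds on a real basis. The value 0 for \<open>y\<close>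
  is not excluded here.\<close>

lemma hitchin_map_eq: "\<exists>y. \<forall>\<xi>. hitchin_map \<xi> = y *\<^sub>R (\<i> *s \<xi>)"
proof -
  define z where "z = hitchin_map (axis 2 1) $ 2"
  have "hitchin_map (\<chi> k. phase k * axis 2 1 $ k) = (\<chi> k. phase k * hitchin_map (axis 2 1) $ k)"
    by (rule hitchin_map_phase)
  moreover have "(\<chi> k. phase k * axis 2 1 $ k) = axis 2 1"
    by (simp add: vec_eq_iff forall_3 phase_def axis_def)
  ultimately have fixed: "hitchin_map (axis 2 1) = (\<chi> k. phase k * hitchin_map (axis 2 1) $ k)"
    by (simp only:)
  have phase_fixed: "hitchin_map (axis 2 1) $ k = phase k * hitchin_map (axis 2 1) $ k" for k
    using arg_cong[OF fixed, of "\<lambda>v. v $ k"] by simp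
  have "x = 0" if "x = u * x" "u \<noteq> 1" for x u :: complex using that by simp
  note this[OF phase_fixed]
  from this[of 1] this[of 3] have "hitchin_map (axis 2 1) $ 1 = 0" "hitchin_map (axis 2 1) $ 3 = 0"
    by (simp_all add: phase_def complex_eq_iff)
  then have e2: "hitchin_map (axis 2 1) = axis 2 z"
    by (simp add: vec_eq_iff forall_3 axis_def z_def)
  have "(\<chi> k. cnj (axis 2 1 $ k)) = (axis 2 1 :: complex^3)"
    by (simp add: vec_eq_iff forall_3 axis_def)
  with hitchin_map_cnj[of "axis 2 1"] have "(axis 2 z :: complex^3) = - (\<chi> k. cnj (axis 2 z $ k))"
    by (simp add: e2)
  then have "z = - cnj z" by (simp add: vec_eq_iff forall_3 axis_def)
  then have z: "z = Im z *\<^sub>R \<i>" by (simp add: complex_eq_iff)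
  have cyc: "hitchin_map (axis (k + 1) u) = axis (k + 1) (c::complex)" if "hitchin_map (axis k u) = axis k c" for k u c
  proof -
    have shift: "(\<chi> j. axis k w $ (j - 1)) = axis (k + 1) w" for w :: complex
      by (auto simp: vec_eq_iff axis_def)
    show ?thesis using hitchin_map_cyclic[of "axis k u"] that by (simp add: shift)
  qed
  have four: "3 + 1 = (1::3)" by simp
  have e3: "hitchin_map (axis 3 1) = axis 3 z" using cyc[OF e2] by simp
  then have "hitchin_map (axis 1 1) = axis 1 z" using cyc[OF e3] by (simp only: four)
  then have e: "hitchin_map (axis k 1) = axis k z" for k
    using exhaust_3[of k] e2 e3 by auto
  have scale3: "(\<chi> k. phase k * axis 3 w $ k) = axis 3 (\<i> * w)" for w
    by (simp add: vec_eq_iff forall_3 phase_def axis_def)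
  have i3: "hitchin_map (axis 3 \<i>) = axis 3 (\<i> * z)"
    using hitchin_map_phase[of "axis 3 1"] by (simp add: e scale3)
  have i1: "hitchin_map (axis 1 \<i>) = axis 1 (\<i> * z)" using cyc[OF i3] by (simp only: four)
  have i: "hitchin_map (axis k \<i>) = axis k (\<i> * z)" for k
    using exhaust_3[of k] i3 i1 cyc[OF i1] by auto
  have "hitchin_map \<xi> = Im z *\<^sub>R (\<i> *s \<xi>)" for \<xi>
  proof -
    have "linear (\<lambda>\<xi>::complex^3. Im z *\<^sub>R (\<i> *s \<xi>))"
      by (auto intro!: linearI simp: vec_eq_iff algebra_simps)
    moreover have "hitchin_map b = Im z *\<^sub>R (\<i> *s b)" if "b \<in> Basis" for b
    proof -
      from that obtain k u where b: "b = axis k u" "u \<in> {1, \<i>}"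
        by (auto simp: Basis_vec_def Basis_complex_def)
      have *: "Im z *\<^sub>R (\<i> *s axis k u) = axis k (z * u)"
        by (subst (2) z) (auto simp: vec_eq_iff axis_def)
      show ?thesis unfolding b(1) * using b(2) e i by (auto simp: mult.commute)
    qed
    ultimately show ?thesis
      using linear_eq_on[OF hitchin_map_linear, of "\<lambda>\<xi>. Im z *\<^sub>R (\<i> *s \<xi>)" \<xi> Basis] by (simp add: span_Basis)
  qed
  then show ?thesis by (intro exI allI)
qed

proposition hitchin_form_eq:
  "\<exists>\<beta>. alternating_form 6 \<beta> \<and> (\<forall>a \<xi> X. linear a \<longrightarrow> hitchin_form a \<xi> X = a (\<i> *s \<xi>) * \<beta> X)"
proof -
  from hitchin_map_eq obtain y where "\<forall>\<xi>. hitchin_map \<xi> = y *\<^sub>R (\<i> *s \<xi>)" ..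
  note y = this[rule_format]
  \<comment> \<open>The covector and the vector are chosen so that the coefficient
    \<open>a (\<i> *s \<xi>)\<close> is 1. This makes the required 6-form itself a
    \<open>hitchin_form\<close>, so it is alternating, with value \<open>y\<close> at
    \<open>c3_basis\<close>.\<close>
  define \<beta> where "\<beta> = hitchin_form (\<lambda>z. Re (z $ 1)) (axis 1 (- \<i>))"
  have l: "linear (\<lambda>z::complex^3. Re (z $ 1))" by (auto intro!: linearI)
  have \<beta>: "alternating_form 6 \<beta>" unfolding \<beta>_def by (rule hitchin_form_alternating[OF l])
  have "\<i> *s axis 1 (- \<i>) = (axis 1 1 :: complex^3)" by (simp add: vec_eq_iff axis_def)
  then have \<beta>1: "\<beta> c3_basis = y"
    unfolding \<beta>_def hitchin_map_dual[OF l, symmetric] y by simp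
  have "hitchin_form a \<xi> X = a (\<i> *s \<xi>) * \<beta> X" if a: "linear a" for a \<xi> X
  proof -
    have "hitchin_form a \<xi> c3_basis = y * a (\<i> *s \<xi>)"
      by (simp add: hitchin_map_dual[OF a, symmetric] y linear_scale[OF a])
    then have "hitchin_form a \<xi> c3_basis - a (\<i> *s \<xi>) *\<^sub>R \<beta> c3_basis = 0" by (simp add: \<beta>1)
    from alternating_form_eq_0[OF alternating_form_diff[OF hitchin_form_alternating[OF a] alternating_form_scaleR[OF \<beta>]]
        span_c3_basis this, of X]
    show ?thesis by simp
  qed
  then show ?thesis using \<beta> by (intro exI[of _ \<beta>] conjI allI impI)
qed

section \<open>The Lie algebra \<open>su(2)\<close> and the Chern-Simons form\<close>

lemma re_trace_add: "re_trace (a + b) = re_trace a + re_trace b"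
  and re_trace_diff: "re_trace (a - b) = re_trace a - re_trace b"
  and re_trace_scaleR: "re_trace (r *\<^sub>R a) = r * re_trace a"
  by (simp_all add: re_trace_def trace_def UNIV_2 algebra_simps)

lemma mat2_mult_diff_left: "(a - b) ** c = a ** c - b ** (c::mat2)"
  and mat2_mult_diff_right: "c ** (a - b) = c ** a - c ** b"
  and mat2_mult_add_left: "(a + b) ** c = a ** c + b ** c"
  and mat2_mult_add_right: "c ** (a + b) = c ** a + c ** b"
  and mat2_mult_scaleR_left: "(r *\<^sub>R a) ** c = r *\<^sub>R (a ** c)"
  and mat2_mult_scaleR_right: "c ** (r *\<^sub>R a) = r *\<^sub>R (c ** a)"
  by (simp_all add: vec_eq_iff matrix_matrix_mult_def UNIV_2 algebra_simps)

lemma re_trace_mult_commute: "re_trace (a ** b) = re_trace (b ** a)"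
  by (simp add: re_trace_def trace_def matrix_matrix_mult_def UNIV_2 algebra_simps)

lemma su2_coeff_linear: "linear (\<lambda>a. su2_coeff a i)"
  by (auto intro!: linearI simp: su2_coeff_def mat2_mult_add_left mat2_mult_scaleR_left re_trace_add re_trace_scaleR
      algebra_simps)

lemma su2_iff:
  "a \<in> su2 \<longleftrightarrow> Re (a $ 1 $ 1) = 0 \<and> Re (a $ 2 $ 2) = 0 \<and> Im (a $ 2 $ 2) = - Im (a $ 1 $ 1) \<and>
     Re (a $ 2 $ 1) = - Re (a $ 1 $ 2) \<and> Im (a $ 2 $ 1) = Im (a $ 1 $ 2)"
  unfolding su2_def hermitian_adjoint_def trace_def UNIV_2 vec_eq_iff forall_2 complex_eq_iff by simp argo

lemma su2_entries:
  assumes "a \<in> su2"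
  shows "a $ 1 $ 1 = Complex 0 (- su2_coeff a 3 / 2)"
    and "a $ 1 $ 2 = Complex (- su2_coeff a 2 / 2) (- su2_coeff a 1 / 2)"
    and "a $ 2 $ 1 = Complex (su2_coeff a 2 / 2) (- su2_coeff a 1 / 2)"
    and "a $ 2 $ 2 = Complex 0 (su2_coeff a 3 / 2)"
  using assms
  by (simp_all add: su2_iff su2_coeff_def re_trace_def trace_def matrix_matrix_mult_def
      UNIV_2 tau_def pauli_def complex_eq_iff)

lemma su2_eqI:
  assumes "a \<in> su2" "b \<in> su2" "\<And>i. su2_coeff a i = su2_coeff b i"
  shows "a = b"
  using assms(3) su2_entries[OF assms(1)] su2_entries[OF assms(2)]
  by (simp add: vec_eq_iff forall_2)

lemma su2_subspace: "subspace su2"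
  by (simp add: subspace_def su2_iff)

lemma tau_su2: "tau i \<in> su2"
  using exhaust_3[of i]
  by (auto simp: su2_def hermitian_adjoint_def trace_def UNIV_2 vec_eq_iff forall_2 tau_def pauli_def)

lemma su2_coeff_tau: "su2_coeff (tau i) j = (if i = j then 1 else 0)"
  using exhaust_3[of i] exhaust_3[of j]
  by (auto simp: su2_coeff_def re_trace_def trace_def matrix_matrix_mult_def UNIV_2 tau_def pauli_def)

text \<open>The trace of \<open>tau i ** tau j ** tau k\<close> is -\<epsilon>_ijk / 4, because
  \<open>tau i ** tau j\<close> is half the commutator plus a multiple of the identity, and the
  latter drops out as \<open>tau k\<close> is tracefree.\<close>

lemma re_trace_triple:
  assumes "a \<in> su2" "b \<in> su2" "c \<in> su2"
  shows "re_trace (a ** (b ** c)) =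
    - (1 / 4) * det (vector [\<chi> i. su2_coeff a i, \<chi> i. su2_coeff b i, \<chi> i. su2_coeff c i] :: real^3^3)"
  by (simp add: re_trace_def trace_def matrix_matrix_mult_def UNIV_2 det_3 su2_entries[OF assms(1)]
      su2_entries[OF assms(2)] su2_entries[OF assms(3)] field_simps)

section \<open>Explicit wedge products in low degree and the Chern-Simons form\<close>

lemma sum_permutes_2:
  fixes F :: "nat \<Rightarrow> nat \<Rightarrow> 'a::real_vector"
  shows "(\<Sum>\<sigma> | \<sigma> permutes {..<2}. of_int (sign \<sigma>) *\<^sub>R F (\<sigma> 0) (\<sigma> 1)) = F 0 1 - F 1 0"
proof -
  have s: "{..<2} = insert 0 {1::nat}" by auto
  have f: "finite {1::nat}" "0 \<notin> {1::nat}" by auto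
  show ?thesis
    unfolding s sum_over_permutations_insert[OF f] permutes_sing
    by (simp add: sign_swap_id sign_id Transposition.transpose_def)
qed

lemma sum_permutes_3:
  fixes F :: "nat \<Rightarrow> nat \<Rightarrow> nat \<Rightarrow> 'a::real_vector"
  shows "(\<Sum>\<sigma> | \<sigma> permutes {..<3}. of_int (sign \<sigma>) *\<^sub>R F (\<sigma> 0) (\<sigma> 1) (\<sigma> 2)) =
    F 0 1 2 - F 0 2 1 - F 1 0 2 + F 1 2 0 + F 2 0 1 - F 2 1 0"
proof -
  have s: "{..<3} = insert 0 (insert 1 {2::nat})" by auto
  have f: "finite {1, 2::nat}" "0 \<notin> {1, 2::nat}" "finite {2::nat}" "1 \<notin> {2::nat}" by auto
  show ?thesis
    unfolding s sum_over_permutations_insert[OF f(1,2)] sum_over_permutations_insert[OF f(3,4)] permutes_sing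
    by (simp add: sign_swap_id sign_id sign_compose permutation_swap_id Transposition.transpose_def)
qed

lemma wedge_1_1:
  fixes m :: "'a \<Rightarrow> 'b \<Rightarrow> 'c::real_vector"
  shows "wedge m 1 1 (\<lambda>X. a (X 0)) (\<lambda>X. b (X 0)) X = m (a (X 0)) (b (X 1)) - m (a (X 1)) (b (X 0))"
  unfolding wedge_def using sum_permutes_2[of "\<lambda>i j. m (a (X i)) (b (X j))"]
  by (simp add: eval_nat_numeral)

lemma wedge_1_2:
  fixes m :: "'a \<Rightarrow> 'b \<Rightarrow> 'c::real_vector"
  shows "wedge m 1 2 (\<lambda>X. a (X 0)) (\<lambda>X. b (X 0) (X 1)) X = (1 / 2) *\<^sub>R
    (m (a (X 0)) (b (X 1) (X 2)) - m (a (X 0)) (b (X 2) (X 1)) - m (a (X 1)) (b (X 0) (X 2))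
     + m (a (X 1)) (b (X 2) (X 0)) + m (a (X 2)) (b (X 0) (X 1)) - m (a (X 2)) (b (X 1) (X 0)))"
  unfolding wedge_def using sum_permutes_3[of "\<lambda>i j k. m (a (X i)) (b (X j) (X k))"]
  by (simp add: eval_nat_numeral)

lemma wedge_2_1:
  fixes m :: "'a \<Rightarrow> 'b \<Rightarrow> 'c::real_vector"
  shows "wedge m 2 1 (\<lambda>X. a (X 0) (X 1)) (\<lambda>X. b (X 0)) X = (1 / 2) *\<^sub>R
    (m (a (X 0) (X 1)) (b (X 2)) - m (a (X 0) (X 2)) (b (X 1)) - m (a (X 1) (X 0)) (b (X 2))
     + m (a (X 1) (X 2)) (b (X 0)) + m (a (X 2) (X 0)) (b (X 1)) - m (a (X 2) (X 1)) (b (X 0)))"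
  unfolding wedge_def using sum_permutes_3[of "\<lambda>i j k. m (a (X i) (X j)) (b (X k))"]
  by (simp add: eval_nat_numeral)

definition complex_coframe :: "('v, mat2) form \<Rightarrow> ('v, mat2) form \<Rightarrow> 'v \<Rightarrow> complex^3" where
  "complex_coframe W E X = (\<chi> i. Complex (su2_coeff (on_vec W X) i) (su2_coeff (on_vec E X) i))"

lemma complex_coframe_linear:
  assumes "alternating_form 1 W" "alternating_form 1 E"
  shows "linear (complex_coframe W E)"
proof (rule linearI)
  have l: "linear (\<lambda>X. su2_coeff (on_vec W X) i)" "linear (\<lambda>X. su2_coeff (on_vec E X) i)" for i
    using assms linear_compose[OF _ su2_coeff_linear] unfolding alternating_form_1_iff by (auto simp: o_def)
  show "complex_coframe W E (X + Y) = complex_coframe W E X + complex_coframe W E Y" for X Y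
    by (simp add: complex_coframe_def vec_eq_iff complex_eq_iff linear_add[OF l(1)] linear_add[OF l(2)])
  show "complex_coframe W E (r *\<^sub>R X) = r *\<^sub>R complex_coframe W E X" for r X
    using linear_scale[OF l(1)] linear_scale[OF l(2)]
    by (simp add: complex_coframe_def vec_eq_iff complex_eq_iff)
qed

text \<open>\<open>CS(W) = Tr (W \<and> F - W \<and> W \<and> W / 3)\<close> with \<open>F = E \<and> E\<close> is half the real part of
  \<open>\<theta>\<^sup>1 \<and> \<theta>\<^sup>2 \<and> \<theta>\<^sup>3\<close> for \<open>\<theta> = W + i E\<close>.\<close>

lemma chern_simons_model:
  assumes W: "alternating_form 1 W" "\<And>X. W X \<in> su2" and E: "alternating_form 1 E" "\<And>X. E X \<in> su2"
  shows "re_trace (wedge (**) 1 2 W (\<lambda>X. wedge2 E X - wedge2 W X) X + (2 / 3) *\<^sub>R wedge3 W X) =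
    model_form (\<lambda>i. complex_coframe W E (X i))"
proof -
  define w e where "w = on_vec W" and "e = on_vec E"
  have We: "W = (\<lambda>X. w (X 0))" "E = (\<lambda>X. e (X 0))"
    using W(1) E(1) unfolding alternating_form_1_iff w_def e_def by auto
  have on_vec: "W (\<lambda>_. Y) = w Y" "E (\<lambda>_. Y) = e Y" for Y by (simp_all add: w_def e_def)
  have su2: "w Y \<in> su2" "e Y \<in> su2" for Y using W(2) E(2) by (auto simp: w_def e_def)
  have w2: "wedge2 (\<lambda>X. u (X 0)) = (\<lambda>X. u (X 0) ** u (X 1) - u (X 1) ** u (X 0))" for u
    unfolding wedge2_def by (rule ext) (rule wedge_1_1)
  have lhs: "re_trace (wedge (**) 1 2 W (\<lambda>X. wedge2 E X - wedge2 W X) X + (2 / 3) *\<^sub>R wedge3 W X) =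
      re_trace (w (X 0) ** (e (X 1) ** e (X 2))) - re_trace (w (X 0) ** (e (X 2) ** e (X 1)))
    + re_trace (w (X 1) ** (e (X 2) ** e (X 0))) - re_trace (w (X 1) ** (e (X 0) ** e (X 2)))
    + re_trace (w (X 2) ** (e (X 0) ** e (X 1))) - re_trace (w (X 2) ** (e (X 1) ** e (X 0)))
    - (1 / 3) * (re_trace (w (X 0) ** (w (X 1) ** w (X 2))) - re_trace (w (X 0) ** (w (X 2) ** w (X 1)))
    + re_trace (w (X 1) ** (w (X 2) ** w (X 0))) - re_trace (w (X 1) ** (w (X 0) ** w (X 2)))
    + re_trace (w (X 2) ** (w (X 0) ** w (X 1))) - re_trace (w (X 2) ** (w (X 1) ** w (X 0))))"
    unfolding wedge3_def We w2 wedge_1_2[where b="\<lambda>x y. e x ** e y - e y ** e x - (w x ** w y - w y ** w x)"]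
      wedge_2_1[where a="\<lambda>x y. w x ** w y - w y ** w x"]
    by (simp add: re_trace_add re_trace_diff re_trace_scaleR mat2_mult_diff_left mat2_mult_diff_right
        mat2_mult_add_left mat2_mult_add_right matrix_mul_assoc field_simps)
  show ?thesis
    unfolding lhs
    \<comment> \<open>Both sides become half of det(w, w, w) minus the three mixed determinants with
      one w and two e, which is the real part of the determinant of the rows w + \<i> e.\<close>
    by (simp add: re_trace_triple su2 model_form_def complex_coframe_def det_3 on_vec)
      (simp add: field_simps)
qed

section \<open>The almost-complex structure of a pointwise complex coframe\<close>

definition standard_basis :: "nat \<Rightarrow> real^6" where
  "standard_basis i = axis (of_nat (Suc i)) 1"

lemma span_standard_basis: "span (standard_basis ` {..<6}) = UNIV"
proof -
  have "Basis \<subseteq> standard_basis ` {..<6}"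
  proof
    fix b :: "real^6" assume "b \<in> Basis"
    then obtain k where b: "b = axis k 1" by (auto simp: Basis_vec_def)
    obtain z where z: "k - 1 = of_int z" "0 \<le> z" "z < 6"
      by (cases "k - 1" rule: bit0_cases) auto
    then have "of_nat (nat z) = k - 1" by simp
    then have "of_nat (Suc (nat z)) = k" by (simp add: algebra_simps)
    with b z show "b \<in> standard_basis ` {..<6}"
      by (intro image_eqI[of _ _ "nat z"]) (auto simp: standard_basis_def)
  qed
  then show ?thesis
    using span_mono[of Basis "standard_basis ` {..<6}"] unfolding span_Basis by blast
qed

text \<open>The factor left open by the symmetry argument, kept as a 6-form; only the two properties
  in the choice are used.\<close>

definition model_top :: "(complex^3, real) form" where
  "model_top = (SOME \<beta>. alternating_form 6 \<beta> \<and>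
     (\<forall>a \<xi> X. linear a \<longrightarrow> hitchin_form a \<xi> X = a (\<i> *s \<xi>) * \<beta> X))"

lemma model_top:
  shows model_top_alternating: "alternating_form 6 model_top"
    and hitchin_form_model_top: "linear a \<Longrightarrow> hitchin_form a \<xi> X = a (\<i> *s \<xi>) * model_top X"
  using someI_ex[OF hitchin_form_eq] unfolding model_top_def[symmetric] by blast+

definition complex_structure :: "('v \<Rightarrow> complex^3) \<Rightarrow> 'v \<Rightarrow> 'v" where
  "complex_structure \<Theta> X = inv \<Theta> (\<i> *s \<Theta> X)"

lemma coframe_complex_structure:
  "bij \<Theta> \<Longrightarrow> \<Theta> (complex_structure \<Theta> X) = \<i> *s \<Theta> X"
  by (simp add: complex_structure_def bij_is_surj surj_f_inv_f)

lemma complex_structure_twice: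
  assumes "linear \<Theta>" "bij \<Theta>"
  shows "complex_structure \<Theta> (complex_structure \<Theta> X) = - X"
proof (rule injD[OF bij_is_inj[OF assms(2)]])
  show "\<Theta> (complex_structure \<Theta> (complex_structure \<Theta> X)) = \<Theta> (- X)"
    by (simp add: coframe_complex_structure[OF assms(2)] linear_neg[OF assms(1)] vec_eq_iff mult.assoc[symmetric])
qed

lemma linear_complex_structure:
  assumes "linear \<Theta>" "bij \<Theta>"
  shows "linear (complex_structure \<Theta>)"
proof (rule linearI)
  note inj = injD[OF bij_is_inj[OF assms(2)]]
  show "complex_structure \<Theta> (X + Y) = complex_structure \<Theta> X + complex_structure \<Theta> Y" for X Y
    by (rule inj)
      (simp add: coframe_complex_structure[OF assms(2)] linear_add[OF assms(1)] vec_eq_iff algebra_simps)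
  show "complex_structure \<Theta> (r *\<^sub>R X) = r *\<^sub>R complex_structure \<Theta> X" for r X
    by (rule inj)
      (simp add: coframe_complex_structure[OF assms(2)] linear_scale[OF assms(1)] vec_eq_iff algebra_simps)
qed

text \<open>All ingredients are pulled back from C^3 along \<open>\<Theta>\<close>:
  \<open>\<Omega>\<close> from \<open>model_form\<close>, and \<open>\<alpha>\<close> from
  \<open>a\<close>, its composition with the inverse of \<open>\<Theta>\<close>. The identity is
  then the pullback of the one for \<open>hitchin_form\<close>.\<close>

lemma wedge_model_form:
  fixes \<Theta> :: "real^6 \<Rightarrow> complex^3"
  assumes \<Theta>: "linear \<Theta>" "bij \<Theta>" and \<alpha>: "alternating_form 1 \<alpha>"
  defines "\<Omega> \<equiv> \<lambda>X. model_form (\<lambda>i. \<Theta> (X i))"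
  shows "wedge (*) 3 3 (wedge (*) 1 2 \<alpha> (interior_product u \<Omega>)) \<Omega> X =
    on_vec \<alpha> (complex_structure \<Theta> u) * model_top (\<lambda>i. \<Theta> (X i))"
proof -
  define a where "a z = on_vec \<alpha> (inv \<Theta> z)" for z
  have lin: "linear (on_vec \<alpha>)" and loc: "\<alpha> = (\<lambda>X. on_vec \<alpha> (X 0))"
    using \<alpha> unfolding alternating_form_1_iff by auto
  have inv: "inv \<Theta> (\<Theta> x) = x" for x using bij_is_inj[OF \<Theta>(2)] by (simp add: inv_f_f)
  have "linear (inv \<Theta>)"
  proof (rule linearI)
    show "inv \<Theta> (x + y) = inv \<Theta> x + inv \<Theta> y" for x y
      by (rule injD[OF bij_is_inj[OF \<Theta>(2)]])
        (simp add: linear_add[OF \<Theta>(1)] surj_f_inv_f[OF bij_is_surj[OF \<Theta>(2)]])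
    show "inv \<Theta> (r *\<^sub>R x) = r *\<^sub>R inv \<Theta> x" for r x
      by (rule injD[OF bij_is_inj[OF \<Theta>(2)]])
        (simp add: linear_scale[OF \<Theta>(1)] surj_f_inv_f[OF bij_is_surj[OF \<Theta>(2)]])
  qed
  then have a: "linear a"
    using linear_compose[OF _ lin] by (simp add: a_def[abs_def] o_def)
  have \<alpha>a: "\<alpha> = (\<lambda>X. a (\<Theta> (X 0)))"
    by (subst loc) (simp add: a_def inv)
  have i: "interior_product u \<Omega> = (\<lambda>X. interior_product (\<Theta> u) model_form (\<lambda>i. \<Theta> (X i)))"
    unfolding \<Omega>_def by (rule ext) (rule interior_product_compose)
  have "wedge (*) 1 2 \<alpha> (interior_product u \<Omega>) =
      (\<lambda>X. wedge (*) 1 2 (\<lambda>X. a (X 0)) (interior_product (\<Theta> u) model_form) (\<lambda>i. \<Theta> (X i)))"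
    unfolding \<alpha>a i by (rule ext) (rule wedge_compose)
  then have "wedge (*) 3 3 (wedge (*) 1 2 \<alpha> (interior_product u \<Omega>)) \<Omega> X =
      hitchin_form a (\<Theta> u) (\<lambda>i. \<Theta> (X i))"
    unfolding hitchin_form_def \<Omega>_def by (simp only:) (rule wedge_compose)
  also have "\<dots> = on_vec \<alpha> (complex_structure \<Theta> u) * model_top (\<lambda>i. \<Theta> (X i))"
    by (simp add: hitchin_form_model_top[OF a] a_def complex_structure_def)
  finally show ?thesis .
qed

text \<open>The constant \<open>c\<close> is the ratio of the two top forms; a nonzero value of
  \<open>v\<close> makes the quotient in \<open>form_ratio\<close> unique.\<close>

lemma hitchin_K_model_form:
  fixes \<Theta> :: "real^6 \<Rightarrow> complex^3"
  assumes \<Theta>: "linear \<Theta>" "bij \<Theta>" and \<alpha>: "alternating_form 1 \<alpha>"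
    and c: "\<And>X. model_top (\<lambda>i. \<Theta> (X i)) = c * v X" and v: "v b \<noteq> 0"
  shows "hitchin_K v (\<lambda>X. model_form (\<lambda>i. \<Theta> (X i))) \<alpha> X = c * on_vec \<alpha> (complex_structure \<Theta> (X 0))"
  unfolding hitchin_K_def form_ratio_def wedge_model_form[OF \<Theta> \<alpha>] c
  using v by (intro the_equality) (auto simp: mult_ac dest: spec[of _ b])

text \<open>K is \<open>c\<close> times the dual of a complex structure, so its square is - c^2
  times the identity, and the factor 1/6 averages six equal diagonal entries.\<close>

lemma hitchin_lambda_model_form:
  fixes \<Theta> :: "real^6 \<Rightarrow> complex^3"
  assumes \<Theta>: "linear \<Theta>" "bij \<Theta>"
    and c: "\<And>X. model_top (\<lambda>i. \<Theta> (X i)) = c * v X" and v: "v b \<noteq> 0"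
  shows "hitchin_lambda v (\<lambda>X. model_form (\<lambda>i. \<Theta> (X i))) = - c\<^sup>2"
proof -
  let ?\<Omega> = "\<lambda>X. model_form (\<lambda>i. \<Theta> (X i))"
  have "hitchin_K v ?\<Omega> (hitchin_K v ?\<Omega> (\<lambda>X. X 0 $ i)) (\<lambda>_. axis i 1) = - c\<^sup>2" for i
  proof -
    have l: "linear (\<lambda>X::real^6. X $ i)" by (auto intro!: linearI)
    then have 1: "alternating_form 1 (\<lambda>X::nat \<Rightarrow> real^6. X 0 $ i)" by (subst alternating_form_1_iff) simp
    have K: "hitchin_K v ?\<Omega> (\<lambda>X. X 0 $ i) = (\<lambda>X. c * complex_structure \<Theta> (X 0) $ i)"
      by (rule ext) (simp add: hitchin_K_model_form[OF \<Theta> 1 c v])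
    have "linear (\<lambda>X. c * complex_structure \<Theta> X $ i)"
      using linear_compose_scale_right[OF linear_compose[OF linear_complex_structure[OF \<Theta>] l], of c]
      by (simp add: o_def)
    then have 2: "alternating_form 1 (\<lambda>X. c * complex_structure \<Theta> (X 0) $ i)"
      by (subst alternating_form_1_iff) simp
    show ?thesis
      unfolding K by (simp add: hitchin_K_model_form[OF \<Theta> 2 c v] complex_structure_twice[OF \<Theta>] power2_eq_square)
  qed
  then show ?thesis by (simp add: hitchin_lambda_def)
qed

text \<open>Normalising \<open>c\<close> by the square root of c^2 leaves its sign. The vector is
  unique since the coordinate covectors separate vectors.\<close>

lemma J_of_form_model_form:
  fixes \<Theta> :: "real^6 \<Rightarrow> complex^3"
  assumes \<Theta>: "linear \<Theta>" "bij \<Theta>"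
    and c: "\<And>X. model_top (\<lambda>i. \<Theta> (X i)) = c * v p X" and v: "v p b \<noteq> 0"
    and \<Omega>: "\<Omega> p = (\<lambda>X. model_form (\<lambda>i. \<Theta> (X i)))"
  shows "J_of_form v \<Omega> p X = sgn c *\<^sub>R complex_structure \<Theta> X"
proof -
  have J: "J_on_covectors (v p) (\<Omega> p) \<alpha> (\<lambda>_. X) = on_vec \<alpha> (sgn c *\<^sub>R complex_structure \<Theta> X)"
    if \<alpha>: "alternating_form 1 \<alpha>" for \<alpha>
  proof -
    have "linear (on_vec \<alpha>)" using \<alpha> unfolding alternating_form_1_iff by auto
    from linear_scale[OF this] show ?thesis
      by (simp add: J_on_covectors_def \<Omega> hitchin_K_model_form[OF \<Theta> \<alpha> c v]
          hitchin_lambda_model_form[OF \<Theta> c v] real_sgn_eq)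
  qed
  show ?thesis
    unfolding J_of_form_def
  proof (rule the_equality)
    show "\<forall>\<alpha>. alternating_form 1 \<alpha> \<longrightarrow>
        on_vec \<alpha> (sgn c *\<^sub>R complex_structure \<Theta> X) = on_vec (J_on_covectors (v p) (\<Omega> p) \<alpha>) X"
      using J by simp
    fix Y assume Y: "\<forall>\<alpha>. alternating_form 1 \<alpha> \<longrightarrow> on_vec \<alpha> Y = on_vec (J_on_covectors (v p) (\<Omega> p) \<alpha>) X"
    have "Y $ i = (sgn c *\<^sub>R complex_structure \<Theta> X) $ i" for i
    proof -
      have "linear (\<lambda>X::real^6. X $ i)" by (auto intro!: linearI)
      then have 1: "alternating_form 1 (\<lambda>X::nat \<Rightarrow> real^6. X 0 $ i)" by (subst alternating_form_1_iff) simp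
      show ?thesis using Y[rule_format, OF 1] J[OF 1] by simp
    qed
    then show "Y = sgn c *\<^sub>R complex_structure \<Theta> X" by (simp add: vec_eq_iff)
  qed
qed

lemma model_top_proportional:
  fixes \<Theta> :: "real^6 \<Rightarrow> complex^3"
  assumes "linear \<Theta>" "alternating_form 6 v" "v standard_basis \<noteq> 0"
  obtains c where "\<And>X. model_top (\<lambda>i. \<Theta> (X i)) = c * v X"
  using top_form_proportional[OF assms(2) alternating_form_compose[OF model_top_alternating assms(1)]
      span_standard_basis assms(3)] that by blast

section \<open>Closure properties of smooth maps\<close>

lemma differentiable_on_open_at: "f differentiable_on S \<Longrightarrow> open S \<Longrightarrow> x \<in> S \<Longrightarrow> f differentiable (at x)"
  by (metis at_within_open differentiable_on_def)

lemma frechet_derivative_cong_open: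
  assumes "open S" "x \<in> S" "\<And>y. y \<in> S \<Longrightarrow> f y = g y" "f differentiable (at x)"
  shows "frechet_derivative g (at x) = frechet_derivative f (at x)" "g differentiable (at x)"
proof -
  have "(f has_derivative frechet_derivative f (at x)) (at x)"
    using assms(4) frechet_derivative_works by blast
  then have "(g has_derivative frechet_derivative f (at x)) (at x)"
    by (rule has_derivative_transform_within_open[OF _ assms(1,2)]) (rule assms(3))
  then show "frechet_derivative g (at x) = frechet_derivative f (at x)" "g differentiable (at x)"
    by (auto simp: frechet_derivative_at[symmetric] differentiable_def)
qed

lemma Ck_on_cong:
  assumes "open S" "\<And>x. x \<in> S \<Longrightarrow> f x = g x" "Ck_on k f S"
  shows "Ck_on k g S"
  using assms(2,3)
proof (induction k arbitrary: f g)
  case 0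
  then show ?case using continuous_on_cong[of S S f g] by simp
next
  case (Suc k)
  have d: "f differentiable (at x)" if "x \<in> S" for x
    by (rule differentiable_on_open_at[OF _ assms(1) that]) (use Suc.prems in simp)
  note eq = frechet_derivative_cong_open[OF assms(1) _ Suc.prems(1) d]
  have "g differentiable_on S"
    using eq(2) by (auto simp: differentiable_on_def intro: differentiable_at_withinI)
  moreover have "Ck_on k (\<lambda>x. frechet_derivative g (at x) v) S" for v
  proof (rule Suc.IH)
    show "Ck_on k (\<lambda>x. frechet_derivative f (at x) v) S" using Suc.prems(2) by simp
    show "frechet_derivative f (at x) v = frechet_derivative g (at x) v" if "x \<in> S" for x
      using eq(1) that by simp
  qed
  ultimately show ?case by simp
qed

lemma Ck_on_subset:
  "open S \<Longrightarrow> open T \<Longrightarrow> T \<subseteq> S \<Longrightarrow> Ck_on k f S \<Longrightarrow> Ck_on k f T"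
  by (induction k arbitrary: f) (auto intro: continuous_on_subset differentiable_on_subset)

lemma Ck_on_SucD: "Ck_on (Suc k) f S \<Longrightarrow> Ck_on k f S"
  by (induction k arbitrary: f) (auto intro: differentiable_imp_continuous_on)

lemma Ck_on_const: "Ck_on k (\<lambda>x. c) S"
  by (induction k arbitrary: c) (auto simp: frechet_derivative_const)

lemma Ck_on_Suc_intro:
  assumes "open S" "\<And>x. x \<in> S \<Longrightarrow> (f has_derivative (\<lambda>v. f' v x)) (at x)" "\<And>v. Ck_on k (f' v) S"
  shows "Ck_on (Suc k) f S"
proof -
  have "frechet_derivative f (at x) v = f' v x" if "x \<in> S" for x v
    using frechet_derivative_at[OF assms(2)[OF that]] by metis
  then have "Ck_on k (\<lambda>x. frechet_derivative f (at x) v) S" for v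
    by (intro Ck_on_cong[OF assms(1) _ assms(3)[of v]]) simp
  moreover have "f differentiable_on S"
    using assms(2) by (auto simp: differentiable_on_def differentiable_def intro: has_derivative_at_withinI)
  ultimately show ?thesis by simp
qed

lemma Ck_on_Suc_has_derivative:
  assumes "open S" "Ck_on (Suc k) f S" "x \<in> S"
  shows "(f has_derivative (\<lambda>v. frechet_derivative f (at x) v)) (at x)"
  using assms differentiable_on_open_at[of f S x] frechet_derivative_works by auto

lemma Ck_on_bounded_linear:
  assumes "bounded_linear L" "open S" "Ck_on k f S"
  shows "Ck_on k (\<lambda>x. L (f x)) S"
  using assms(3)
proof (induction k arbitrary: f)
  case 0
  then show ?case using linear_continuous_on[OF assms(1)] continuous_on_compose2[of UNIV L S f] by auto
next
  case (Suc k)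
  show ?case
    using Suc.prems
    by (intro Ck_on_Suc_intro[OF assms(2), where f'="\<lambda>v x. L (frechet_derivative f (at x) v)"]
        bounded_linear.has_derivative[OF assms(1)] Ck_on_Suc_has_derivative[OF assms(2) Suc.prems] Suc.IH) auto
qed

lemma Ck_on_add:
  assumes "open S" "Ck_on k f S" "Ck_on k g S"
  shows "Ck_on k (\<lambda>x. f x + g x) S"
  using assms(2,3)
proof (induction k arbitrary: f g)
  case (Suc k)
  show ?case
  proof (rule Ck_on_Suc_intro[OF assms(1), where
        f'="\<lambda>v x. frechet_derivative f (at x) v + frechet_derivative g (at x) v"])
    show "((\<lambda>x. f x + g x) has_derivative
        (\<lambda>v. frechet_derivative f (at x) v + frechet_derivative g (at x) v)) (at x)" if "x \<in> S" for x
      by (intro has_derivative_add Ck_on_Suc_has_derivative[OF assms(1) Suc.prems(1) that]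
          Ck_on_Suc_has_derivative[OF assms(1) Suc.prems(2) that])
    show "Ck_on k (\<lambda>x. frechet_derivative f (at x) v + frechet_derivative g (at x) v) S" for v
      by (rule Suc.IH) (use Suc.prems in simp_all)
  qed
qed (auto intro: continuous_on_add)

lemma Ck_on_mult:
  fixes f g :: "'a::real_normed_vector \<Rightarrow> 'b::real_normed_algebra"
  assumes "open S" "Ck_on k f S" "Ck_on k g S"
  shows "Ck_on k (\<lambda>x. f x * g x) S"
  using assms(2,3)
proof (induction k arbitrary: f g)
  case (Suc k)
  have fg: "Ck_on k f S" "Ck_on k g S" using Suc.prems Ck_on_SucD by blast+
  show ?case
  proof (rule Ck_on_Suc_intro[OF assms(1), where
        f'="\<lambda>v x. f x * frechet_derivative g (at x) v + frechet_derivative f (at x) v * g x"])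
    show "((\<lambda>x. f x * g x) has_derivative
        (\<lambda>v. f x * frechet_derivative g (at x) v + frechet_derivative f (at x) v * g x)) (at x)" if "x \<in> S" for x
      by (rule has_derivative_mult[OF Ck_on_Suc_has_derivative[OF assms(1) Suc.prems(1) that]
          Ck_on_Suc_has_derivative[OF assms(1) Suc.prems(2) that]])
    show "Ck_on k (\<lambda>x. f x * frechet_derivative g (at x) v + frechet_derivative f (at x) v * g x) S" for v
      by (rule Ck_on_add[OF assms(1) Suc.IH[OF fg(1)] Suc.IH[OF _ fg(2)]]) (use Suc.prems in simp_all)
  qed
qed (auto intro: continuous_on_mult)

text \<open>The derivative of 1/f contains 1/f again, so the induction runs for a fixed
  \<open>f\<close>: the hypothesis at order \<open>k\<close> applies once \<open>Ck_on_SucD\<close>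
  has lowered the order of \<open>f\<close>. The square root is treated in the same way.\<close>

lemma Ck_on_inverse:
  fixes f :: "'a::real_normed_vector \<Rightarrow> real"
  assumes "open S" "\<And>x. x \<in> S \<Longrightarrow> f x \<noteq> 0" "Ck_on k f S"
  shows "Ck_on k (\<lambda>x. inverse (f x)) S"
  using assms(3)
proof (induction k)
  case 0
  then show ?case using assms(2) by (auto intro: continuous_on_inverse)
next
  case (Suc k)
  note inv = Suc.IH[OF Ck_on_SucD[OF Suc.prems]]
  show ?case
  proof (rule Ck_on_Suc_intro[OF assms(1), where
        f'="\<lambda>v x. -1 * (inverse (f x) * frechet_derivative f (at x) v * inverse (f x))"])
    show "((\<lambda>x. inverse (f x)) has_derivative
        (\<lambda>v. -1 * (inverse (f x) * frechet_derivative f (at x) v * inverse (f x)))) (at x)" if "x \<in> S" for x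
      using Deriv.has_derivative_inverse[OF assms(2)[OF that] Ck_on_Suc_has_derivative[OF assms(1) Suc.prems that]]
      by simp
    show "Ck_on k (\<lambda>x. -1 * (inverse (f x) * frechet_derivative f (at x) v * inverse (f x))) S" for v
      using Suc.prems by (intro Ck_on_mult[OF assms(1)] Ck_on_const inv) auto
  qed
qed

lemma Ck_on_sqrt:
  fixes f :: "'a::real_normed_vector \<Rightarrow> real"
  assumes "open S" "\<And>x. x \<in> S \<Longrightarrow> f x > 0" "Ck_on k f S"
  shows "Ck_on k (\<lambda>x. sqrt (f x)) S"
  using assms(3)
proof (induction k)
  case 0
  then show ?case by (auto intro: continuous_on_real_sqrt)
next
  case (Suc k)
  have inv: "Ck_on k (\<lambda>x. inverse (sqrt (f x))) S"
    using Suc.IH[OF Ck_on_SucD[OF Suc.prems]] assms(2) by (intro Ck_on_inverse[OF assms(1)]) force+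
  show ?case
  proof (rule Ck_on_Suc_intro[OF assms(1), where
        f'="\<lambda>v x. (1 / 2) * (inverse (sqrt (f x)) * frechet_derivative f (at x) v)"])
    show "((\<lambda>x. sqrt (f x)) has_derivative
        (\<lambda>v. (1 / 2) * (inverse (sqrt (f x)) * frechet_derivative f (at x) v))) (at x)" if "x \<in> S" for x
      using has_derivative_real_sqrt[OF assms(2)[OF that] Ck_on_Suc_has_derivative[OF assms(1) Suc.prems that]]
      by (simp add: field_simps)
    show "Ck_on k (\<lambda>x. (1 / 2) * (inverse (sqrt (f x)) * frechet_derivative f (at x) v)) S" for v
      using Suc.prems by (intro Ck_on_mult[OF assms(1)] Ck_on_const inv) auto
  qed
qed

text \<open>On an open set a local extension agrees with the function near the point, so it can be
  replaced by the function itself; one neighbourhood serves all orders \<open>k\<close>.\<close>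

lemma smooth_on_open_iff:
  assumes "open S"
  shows "smooth_on f S \<longleftrightarrow> (\<forall>x\<in>S. \<exists>T. open T \<and> x \<in> T \<and> T \<subseteq> S \<and> (\<forall>k. Ck_on k f T))"
proof (intro iffI ballI)
  fix x assume "smooth_on f S" "x \<in> S"
  then obtain U F where UF: "open U" "x \<in> U" "\<And>k. Ck_on k F U" "\<And>y. y \<in> S \<inter> U \<Longrightarrow> F y = f y"
    unfolding smooth_on_def by metis
  have "Ck_on k f (S \<inter> U)" for k
    by (rule Ck_on_cong[OF open_Int[OF assms UF(1)] UF(4) Ck_on_subset[OF UF(1) open_Int[OF assms UF(1)] _ UF(3)]]) auto
  then show "\<exists>T. open T \<and> x \<in> T \<and> T \<subseteq> S \<and> (\<forall>k. Ck_on k f T)"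
    using UF(1,2) assms \<open>x \<in> S\<close> by (intro exI[of _ "S \<inter> U"]) blast
qed (unfold smooth_on_def, metis)

section \<open>From finite order of differentiability to smoothness\<close>

lemma smooth_on_const: "open S \<Longrightarrow> smooth_on (\<lambda>x. c) S"
  by (auto simp: smooth_on_open_iff Ck_on_const)

lemma smooth_on_cong:
  assumes "open S" "\<And>x. x \<in> S \<Longrightarrow> f x = g x" "smooth_on f S"
  shows "smooth_on g S"
  using assms(3) unfolding smooth_on_open_iff[OF assms(1)]
  by (meson Ck_on_cong assms(2) subsetD)

lemma smooth_on_combine:
  assumes "open S" "smooth_on f S" "smooth_on g S"
    and "\<And>k T. open T \<Longrightarrow> Ck_on k f T \<Longrightarrow> Ck_on k g T \<Longrightarrow> T \<subseteq> S \<Longrightarrow> Ck_on k h T"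
  shows "smooth_on h S"
  unfolding smooth_on_open_iff[OF assms(1)]
proof
  fix x assume "x \<in> S"
  then obtain T U where "open T" "x \<in> T" "T \<subseteq> S" "\<And>k. Ck_on k f T" "open U" "x \<in> U" "\<And>k. Ck_on k g U"
    using assms(2,3) unfolding smooth_on_open_iff[OF assms(1)] by metis
  moreover from this have "Ck_on k f (T \<inter> U)" "Ck_on k g (T \<inter> U)" for k
    using Ck_on_subset[of T "T \<inter> U" k f] Ck_on_subset[of U "T \<inter> U" k g] by auto
  ultimately show "\<exists>T. open T \<and> x \<in> T \<and> T \<subseteq> S \<and> (\<forall>k. Ck_on k h T)"
    by (intro exI[of _ "T \<inter> U"]) (auto intro!: assms(4))
qed

lemma smooth_on_add: "open S \<Longrightarrow> smooth_on f S \<Longrightarrow> smooth_on g S \<Longrightarrow> smooth_on (\<lambda>x. f x + g x) S"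
  by (erule (2) smooth_on_combine) (rule Ck_on_add)

lemma smooth_on_mult:
  fixes f g :: "'a::real_normed_vector \<Rightarrow> 'b::real_normed_algebra"
  shows "open S \<Longrightarrow> smooth_on f S \<Longrightarrow> smooth_on g S \<Longrightarrow> smooth_on (\<lambda>x. f x * g x) S"
  by (erule (2) smooth_on_combine) (rule Ck_on_mult)

lemma smooth_on_bounded_linear:
  "bounded_linear L \<Longrightarrow> open S \<Longrightarrow> smooth_on f S \<Longrightarrow> smooth_on (\<lambda>x. L (f x)) S"
  by (rule smooth_on_combine[of S f f]) (auto intro: Ck_on_bounded_linear)

lemma smooth_on_inverse:
  fixes f :: "'a::real_normed_vector \<Rightarrow> real"
  shows "open S \<Longrightarrow> (\<And>x. x \<in> S \<Longrightarrow> f x \<noteq> 0) \<Longrightarrow> smooth_on f S \<Longrightarrow> smooth_on (\<lambda>x. inverse (f x)) S"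
  by (rule smooth_on_combine[of S f f]) (auto intro!: Ck_on_inverse)

lemma smooth_on_sqrt:
  fixes f :: "'a::real_normed_vector \<Rightarrow> real"
  shows "open S \<Longrightarrow> (\<And>x. x \<in> S \<Longrightarrow> f x > 0) \<Longrightarrow> smooth_on f S \<Longrightarrow> smooth_on (\<lambda>x. sqrt (f x)) S"
  by (rule smooth_on_combine[of S f f]) (auto intro!: Ck_on_sqrt)

lemma smooth_on_uminus: "open S \<Longrightarrow> smooth_on f S \<Longrightarrow> smooth_on (\<lambda>x. - f x) S"
  by (rule smooth_on_bounded_linear[OF bounded_linear_minus[OF bounded_linear_ident]])

lemma smooth_on_diff: "open S \<Longrightarrow> smooth_on f S \<Longrightarrow> smooth_on g S \<Longrightarrow> smooth_on (\<lambda>x. f x - g x) S"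
  using smooth_on_add[of S f "\<lambda>x. - g x"] smooth_on_uminus[of S g] by simp

lemma smooth_on_sum:
  "open S \<Longrightarrow> (\<And>i. i \<in> I \<Longrightarrow> smooth_on (f i) S) \<Longrightarrow> smooth_on (\<lambda>x. \<Sum>i\<in>I. f i x) S"
  by (induction I rule: infinite_finite_induct) (auto intro: smooth_on_const smooth_on_add)

lemma smooth_on_scaleR_const: "open S \<Longrightarrow> smooth_on f S \<Longrightarrow> smooth_on (\<lambda>x. c *\<^sub>R f x) S"
  by (rule smooth_on_bounded_linear[OF bounded_linear_scaleR_right])

lemma smooth_on_nth: "open S \<Longrightarrow> smooth_on f S \<Longrightarrow> smooth_on (\<lambda>x. f x $ i) S"
  by (rule smooth_on_bounded_linear[OF bounded_linear_vec_nth])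

lemma smooth_on_vecI:
  fixes f :: "'a::real_normed_vector \<Rightarrow> 'b::euclidean_space ^ 'n"
  assumes "open S" "\<And>i. smooth_on (\<lambda>x. f x $ i) S"
  shows "smooth_on f S"
proof -
  have L: "bounded_linear (axis i :: 'b \<Rightarrow> 'b ^ 'n)" for i
    unfolding linear_conv_bounded_linear[symmetric]
    by (auto intro!: linearI simp: vec_eq_iff axis_def)
  have "f x = (\<Sum>i\<in>UNIV. axis i (f x $ i))" for x
    by (simp add: vec_eq_iff axis_def if_distrib cong: if_cong)
  then show ?thesis
    using smooth_on_sum[OF assms(1), of UNIV "\<lambda>i x. axis i (f x $ i)"]
      smooth_on_bounded_linear[OF L assms(1) assms(2)] by auto
qed

lemma smooth_on_imp_differentiable:
  assumes "smooth_on f S" "open S" "x \<in> S"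
  shows "f differentiable (at x)"
proof -
  obtain T where "open T" "x \<in> T" "Ck_on (Suc 0) f T"
    using assms unfolding smooth_on_open_iff[OF assms(2)] by metis
  then show ?thesis using differentiable_on_open_at[of f T x] by simp
qed

section \<open>Calculus in charts\<close>

lemma smooth_atlas_chart: "smooth_atlas A \<Longrightarrow> c \<in> A \<Longrightarrow> is_chart c"
  by (simp add: smooth_atlas_def)

lemma chart_at_mem:
  assumes "smooth_atlas A"
  shows chart_at_in_atlas: "chart_at A x \<in> A" and chart_at_domain: "x \<in> fst (chart_at A x)"
proof -
  have "\<exists>c. c \<in> A \<and> x \<in> fst c" using assms unfolding smooth_atlas_def by blast
  from someI_ex[OF this] show "chart_at A x \<in> A" "x \<in> fst (chart_at A x)"
    unfolding chart_at_def by auto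
qed

lemma chart_inv_chart: "is_chart c \<Longrightarrow> x \<in> fst c \<Longrightarrow> chart_inv c (snd c x) = x"
  by (auto simp: is_chart_def homeomorphism_def)

lemma chart_chart_inv: "is_chart c \<Longrightarrow> y \<in> snd c ` fst c \<Longrightarrow> snd c (chart_inv c y) = y"
  by (auto simp: is_chart_def homeomorphism_def)

lemma chart_inv_domain: "is_chart c \<Longrightarrow> y \<in> snd c ` fst c \<Longrightarrow> chart_inv c y \<in> fst c"
  by (auto simp: is_chart_def homeomorphism_def)

lemma chart_image_eq:
  assumes "is_chart c"
  shows "snd c ` (fst c \<inter> U) = snd c ` fst c \<inter> chart_inv c -` U"
proof (intro equalityI subsetI)
  fix y assume "y \<in> snd c ` (fst c \<inter> U)"
  then show "y \<in> snd c ` fst c \<inter> chart_inv c -` U" using chart_inv_chart[OF assms] by auto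
next
  fix y assume "y \<in> snd c ` fst c \<inter> chart_inv c -` U"
  then obtain x where "x \<in> fst c" "y = snd c x" "chart_inv c y \<in> U" by blast
  then show "y \<in> snd c ` (fst c \<inter> U)" using chart_inv_chart[OF assms] by auto
qed

lemma open_chart_image:
  assumes "is_chart c" "open U"
  shows "open (snd c ` (fst c \<inter> U))"
proof -
  have "open (snd c ` fst c)" "continuous_on (snd c ` fst c) (chart_inv c)"
    using assms(1) by (auto simp: is_chart_def homeomorphism_def)
  then show ?thesis
    unfolding chart_image_eq[OF assms(1)] using continuous_on_open_vimage assms(2) by (metis Int_commute)
qed

text \<open>Near \<open>y\<close> the map factors as \<open>k \<circ> chart_inv c\<close> after
  \<open>snd c \<circ> h\<close>. All chain rules on the manifold, for transition maps, translations
  and curves, are instances.\<close>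

lemma chart_chain_rule:
  assumes c: "is_chart c" and S: "open S" "y \<in> S" "h ` S \<subseteq> fst c"
    and F: "((snd c \<circ> h) has_derivative F) (at y)"
    and G: "((k \<circ> chart_inv c) has_derivative G) (at (snd c (h y)))"
  shows "((k \<circ> h) has_derivative (G \<circ> F)) (at y)"
proof -
  have "((k \<circ> chart_inv c) \<circ> (snd c \<circ> h) has_derivative (G \<circ> F)) (at y)"
    using diff_chain_at[OF F] G by simp
  then show ?thesis
    by (rule has_derivative_transform_within_open[OF _ S(1,2)])
      (use S(3) chart_inv_chart[OF c] in auto)
qed

lemma has_derivative_id_on:
  assumes "open S" "y \<in> S" "\<And>z. z \<in> S \<Longrightarrow> f z = z" "(f has_derivative F) (at y)"
  shows "F = id"
proof -
  have "(f has_derivative id) (at y)"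
    by (rule has_derivative_transform_within_open[OF has_derivative_id assms(1,2)]) (simp add: assms(3))
  then show ?thesis using has_derivative_unique assms(4) by blast
qed

lemma has_derivative_const_on:
  assumes "open S" "y \<in> S" "\<And>z. z \<in> S \<Longrightarrow> f z = a" "(f has_derivative F) (at y)"
  shows "F = (\<lambda>_. 0)"
proof -
  have "(f has_derivative (\<lambda>_. 0)) (at y)"
    by (rule has_derivative_transform_within_open[OF has_derivative_const assms(1,2)]) (simp add: assms(3))
  then show ?thesis using has_derivative_unique assms(4) by blast
qed

lemma smooth_map_has_derivative:
  assumes A: "smooth_atlas A" and B: "smooth_atlas B" and f: "smooth_map A B f"
    and c: "c \<in> A" "x \<in> fst c" and c': "c' \<in> B" "f x \<in> fst c'"
  shows "((snd c' \<circ> f \<circ> chart_inv c) has_derivative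
    frechet_derivative (snd c' \<circ> f \<circ> chart_inv c) (at (snd c x))) (at (snd c x))"
proof -
  have "open (fst c')" using smooth_atlas_chart[OF B c'(1)] by (simp add: is_chart_def)
  then have "open (f -` fst c')" using f continuous_on_open_vimage[of UNIV f] by (simp add: smooth_map_def)
  then have "open (snd c ` (fst c \<inter> f -` fst c'))" by (rule open_chart_image[OF smooth_atlas_chart[OF A c(1)]])
  moreover have "smooth_on (snd c' \<circ> f \<circ> chart_inv c) (snd c ` (fst c \<inter> f -` fst c'))"
    using f c c' by (auto simp: smooth_map_def)
  ultimately have "(snd c' \<circ> f \<circ> chart_inv c) differentiable (at (snd c x))"
    using smooth_on_imp_differentiable c c' by blast
  then show ?thesis using frechet_derivative_works by blast
qed

lemma smooth_atlas_smooth_map_id: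
  assumes "smooth_atlas A"
  shows "smooth_map A A (\<lambda>x. x)"
  using assms by (auto simp: smooth_map_def smooth_atlas_def o_def)

lemma transition_has_derivative:
  assumes "smooth_atlas A" "c \<in> A" "x \<in> fst c" "c' \<in> A" "x \<in> fst c'"
  shows "((snd c' \<circ> chart_inv c) has_derivative
    frechet_derivative (snd c' \<circ> chart_inv c) (at (snd c x))) (at (snd c x))"
  using smooth_map_has_derivative[OF assms(1,1) smooth_atlas_smooth_map_id[OF assms(1)] assms(2-5)]
  by (simp add: o_def)

lemma transition_inverse:
  assumes A: "smooth_atlas A" and c: "c \<in> A" "x \<in> fst c" and c': "c' \<in> A" "x \<in> fst c'"
  shows "frechet_derivative (snd c \<circ> chart_inv c') (at (snd c' x)) \<circ>
    frechet_derivative (snd c' \<circ> chart_inv c) (at (snd c x)) = id"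
proof -
  note ch = smooth_atlas_chart[OF A c(1)] and ch' = smooth_atlas_chart[OF A c'(1)]
  let ?S = "snd c ` (fst c \<inter> fst c')"
  have S: "open ?S" using open_chart_image[OF ch] ch' by (simp add: is_chart_def)
  have x: "snd c x \<in> ?S" using c c' by auto
  have "((snd c \<circ> chart_inv c) has_derivative (frechet_derivative (snd c \<circ> chart_inv c') (at (snd c' x)) \<circ>
      frechet_derivative (snd c' \<circ> chart_inv c) (at (snd c x)))) (at (snd c x))"
  proof (rule chart_chain_rule[OF ch' S x])
    show "chart_inv c ` ?S \<subseteq> fst c'" using chart_inv_chart[OF ch] by auto
  qed (use transition_has_derivative[OF A c c'] transition_has_derivative[OF A c' c] chart_inv_chart[OF ch c(2)] in simp_all)
  then show ?thesis
    by (rule has_derivative_id_on[OF S x, rotated]) (use chart_inv_chart[OF ch] in auto)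
qed

lemma from_chart_props:
  assumes A: "smooth_atlas A" and c: "c \<in> A" and y: "y \<in> snd c ` fst c"
  shows linear_from_chart: "linear (from_chart A c y)"
    and to_chart_from_chart: "to_chart A c (chart_inv c y) (from_chart A c y u) = u"
    and from_chart_to_chart: "from_chart A c y (to_chart A c (chart_inv c y) u) = u"
proof -
  define x where "x = chart_inv c y"
  define c' where "c' = chart_at A x"
  note ch = smooth_atlas_chart[OF A c]
  have x: "x \<in> fst c" "snd c x = y" using chart_inv_domain[OF ch y] chart_chart_inv[OF ch y] by (simp_all add: x_def)
  have c': "c' \<in> A" "x \<in> fst c'" using chart_at_mem[OF A] by (simp_all add: c'_def)
  have from_eq: "from_chart A c y u = frechet_derivative (snd c' \<circ> chart_inv c) (at (snd c x)) u" for u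
    by (simp add: from_chart_def x c'_def flip: x_def)
  have to_eq: "to_chart A c x u = frechet_derivative (snd c \<circ> chart_inv c') (at (snd c' x)) u" for u
    by (simp add: to_chart_def coord_at_def c'_def)
  have "linear (frechet_derivative (snd c' \<circ> chart_inv c) (at (snd c x)))"
    using transition_has_derivative[OF A c x(1) c'] has_derivative_linear by blast
  then show "linear (from_chart A c y)" using from_eq by (simp add: linear_iff)
  show "to_chart A c (chart_inv c y) (from_chart A c y u) = u"
    using transition_inverse[OF A c x(1) c'] by (simp add: from_eq to_eq fun_eq_iff flip: x_def)
  show "from_chart A c y (to_chart A c (chart_inv c y) u) = u"
    using transition_inverse[OF A c' c x(1)] by (simp add: from_eq to_eq fun_eq_iff flip: x_def)
qed

text \<open>In the application \<open>D\<close> is a subset of a chart image times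
  \<open>SU2\<close>, which is not open in the space of matrices. So a local extension of
  \<open>f\<close> is differentiated; it agrees with \<open>f\<close> along \<open>q\<close>, which
  stays in \<open>D\<close>.\<close>

lemma smooth_on_compose_differentiable:
  assumes f: "smooth_on f D" and q: "q differentiable (at t)" and T: "open T" "t \<in> T" "q ` T \<subseteq> D"
  shows "(\<lambda>s. f (q s)) differentiable (at t)"
proof -
  have "q t \<in> D" using T by auto
  then obtain U F where UF: "open U" "q t \<in> U" "\<And>k. Ck_on k F U" "\<And>y. y \<in> D \<inter> U \<Longrightarrow> F y = f y"
    using f unfolding smooth_on_def by metis
  have "F differentiable_on U" using UF(3)[of "Suc 0"] by simp
  then have "F differentiable (at (q t))" by (rule differentiable_on_open_at[OF _ UF(1,2)])
  then have "(F \<circ> q) differentiable (at t)" using differentiable_chain_at[OF q] by blast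
  then obtain D' where D': "((F \<circ> q) has_derivative D') (at t)" by (auto simp: differentiable_def)
  have "isCont q t" using q by (rule differentiable_imp_continuous_within)
  then have "\<forall>\<^sub>F s in at t. q s \<in> U" using UF(1,2) by (simp add: continuous_within topological_tendstoD)
  moreover have "\<forall>\<^sub>F s in at t. s \<in> T" using T by (simp add: eventually_at_in_open')
  ultimately have "\<forall>\<^sub>F s in at t. (F \<circ> q) s = f (q s)"
    by eventually_elim (use UF(4) T(3) in auto)
  then have "((\<lambda>s. f (q s)) has_derivative D') (at t)"
    using has_derivative_transform_eventually[OF D'] UF T(2,3) by auto
  then show ?thesis by (auto simp: differentiable_def)
qed

section \<open>The exponential map of \<open>SU(2)\<close>\<close>

lemma matrix_pow_square:
  assumes "a ** a = - (\<theta>\<^sup>2) *\<^sub>R mat 1"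
  shows "matrix_pow a (2 * n) = ((-1) ^ n * \<theta> ^ (2 * n)) *\<^sub>R mat 1"
    and "matrix_pow a (Suc (2 * n)) = ((-1) ^ n * \<theta> ^ (2 * n)) *\<^sub>R a"
proof -
  show *: "matrix_pow a (2 * n) = ((-1) ^ n * \<theta> ^ (2 * n)) *\<^sub>R mat 1" for n
  proof (induction n)
    case (Suc n)
    have "matrix_pow a (2 * Suc n) = (a ** a) ** matrix_pow a (2 * n)" by (simp add: matrix_mul_assoc)
    then show ?case
      unfolding assms Suc by (simp add: mat2_mult_scaleR_left mat2_mult_scaleR_right power2_eq_square)
  qed simp
  show "matrix_pow a (Suc (2 * n)) = ((-1) ^ n * \<theta> ^ (2 * n)) *\<^sub>R a"
    by (simp add: * mat2_mult_scaleR_right)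
qed

text \<open>Even powers of \<open>a\<close> are multiples of the identity and odd powers multiples
  of \<open>a\<close>, so the series splits into those of cosine and sine; dividing by
  \<open>\<theta>\<close> corrects the surplus power in the sine part.\<close>

lemma matrix_exp_eq:
  assumes sq: "a ** a = - (\<theta>\<^sup>2) *\<^sub>R mat 1" and "\<theta> \<noteq> 0"
  shows "matrix_exp a = cos \<theta> *\<^sub>R mat 1 + (sin \<theta> / \<theta>) *\<^sub>R a"
proof -
  have "(1 / fact n) *\<^sub>R matrix_pow a n =
      (cos_coeff n *\<^sub>R \<theta> ^ n) *\<^sub>R mat 1 + (sin_coeff n *\<^sub>R \<theta> ^ n / \<theta>) *\<^sub>R a" for n
  proof (cases "even n")
    case True
    then obtain m where "n = 2 * m" by blast
    then show ?thesis by (simp only: matrix_pow_square[OF sq]) (simp add: cos_coeff_def sin_coeff_def)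
  next
    case False
    then obtain m where "n = Suc (2 * m)" using oddE by fastforce
    then show ?thesis
      using \<open>\<theta> \<noteq> 0\<close> by (simp only: matrix_pow_square[OF sq]) (simp add: cos_coeff_def sin_coeff_def)
  qed
  moreover have "(\<lambda>n. (cos_coeff n *\<^sub>R \<theta> ^ n) *\<^sub>R mat 1 + (sin_coeff n *\<^sub>R \<theta> ^ n / \<theta>) *\<^sub>R a)
      sums (cos \<theta> *\<^sub>R mat 1 + (sin \<theta> / \<theta>) *\<^sub>R a)"
    by (intro sums_add bounded_linear.sums[OF bounded_linear_scaleR_left] cos_converges sums_divide sin_converges)
  ultimately show ?thesis unfolding matrix_exp_def by (simp add: sums_unique[symmetric])
qed

lemma matrix_exp_0: "matrix_exp 0 = mat 1"
proof -
  have "matrix_pow 0 (Suc n) = 0" for n by (simp add: vec_eq_iff matrix_matrix_mult_def)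
  then have "matrix_pow 0 n = (if n = 0 then mat 1 else 0)" for n by (cases n) auto
  then have "matrix_exp 0 = (\<Sum>n. if n = 0 then mat 1 else 0)"
    unfolding matrix_exp_def by (intro arg_cong[where f=suminf] ext) simp
  then show ?thesis using sums_unique[OF sums_single[of 0 "\<lambda>_. mat 1 :: mat2"]] by simp
qed

text \<open>Elements of \<open>su2\<close> are imaginary quaternions; the normalisation of
  \<open>tau\<close> makes the norm half the length of the coefficient vector. Hence the halved
  coordinates here and the angle \<open>\<theta>\<close> in \<open>matrix_exp_su2\<close>.\<close>

lemma su2_square:
  assumes "a \<in> su2"
  shows "a ** a = - ((\<Sum>i\<in>UNIV. (su2_coeff a i)\<^sup>2) / 4) *\<^sub>R mat 1"
proof -
  define x y z where "x = su2_coeff a 1 / 2" and "y = su2_coeff a 2 / 2" and "z = su2_coeff a 3 / 2"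
  then have entries: "a $ 1 $ 1 = Complex 0 (- z)" "a $ 1 $ 2 = Complex (- y) (- x)"
      "a $ 2 $ 1 = Complex y (- x)" "a $ 2 $ 2 = Complex 0 z"
    by (simp_all add: su2_entries[OF assms])
  have "(\<Sum>i\<in>UNIV. (su2_coeff a i)\<^sup>2) / 4 = x * x + y * y + z * z"
    unfolding x_def y_def z_def UNIV_3 by (simp add: power2_eq_square)
  moreover have "(a ** a) $ i $ j = (- (x * x + y * y + z * z) *\<^sub>R mat 1) $ i $ j" for i j
    using exhaust_2[of i] exhaust_2[of j]
    unfolding matrix_matrix_mult_def UNIV_2 by (auto simp: mat_def entries complex_eq_iff)
  ultimately show ?thesis by (simp only: vec_eq_iff) simp
qed

text \<open>The hypothesis says that the quaternion with real part \<open>c\<close> and imaginary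
  part \<open>s *\<^sub>R a\<close> has norm 1.\<close>

lemma su2_linear_combination_SU2:
  assumes a: "a \<in> su2" and 1: "c\<^sup>2 + s\<^sup>2 * (\<Sum>i\<in>UNIV. (su2_coeff a i)\<^sup>2) / 4 = 1"
  shows "c *\<^sub>R mat 1 + s *\<^sub>R a \<in> SU2"
proof -
  define g where "g = c *\<^sub>R mat 1 + s *\<^sub>R a"
  define x y z where "x = su2_coeff a 1 / 2" and "y = su2_coeff a 2 / 2" and "z = su2_coeff a 3 / 2"
  then have a: "a $ 1 $ 1 = Complex 0 (- z)" "a $ 1 $ 2 = Complex (- y) (- x)"
      "a $ 2 $ 1 = Complex y (- x)" "a $ 2 $ 2 = Complex 0 z"
    by (simp_all add: su2_entries[OF a])
  have entries: "g $ 1 $ 1 = Complex c (- s * z)" "g $ 1 $ 2 = Complex (- s * y) (- s * x)"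
      "g $ 2 $ 1 = Complex (s * y) (- s * x)" "g $ 2 $ 2 = Complex c (s * z)"
    by (simp_all add: g_def mat_def a complex_eq_iff)
  let ?r = "c * c + s * s * (x * x + y * y + z * z)"
  have "?r = c\<^sup>2 + s\<^sup>2 * (\<Sum>i\<in>UNIV. (su2_coeff a i)\<^sup>2) / 4"
    unfolding x_def y_def z_def UNIV_3 by (simp add: power2_eq_square algebra_simps)
  also have "\<dots> = 1" by (rule 1)
  finally have r: "?r = 1" .
  have "(g ** hermitian_adjoint g) $ i $ j = (if i = j then Complex ?r 0 else 0)" for i j
    using exhaust_2[of i] exhaust_2[of j]
    unfolding matrix_matrix_mult_def hermitian_adjoint_def UNIV_2
    by (auto simp: entries complex_eq_iff algebra_simps)
  then have "g ** hermitian_adjoint g = mat 1"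
    unfolding r by (simp add: vec_eq_iff mat_def complex_eq_iff)
  moreover have "det g = Complex ?r 0"
    unfolding det_2 entries by (simp add: complex_eq_iff algebra_simps)
  then have "det g = 1" unfolding r by (simp add: complex_eq_iff)
  ultimately show ?thesis unfolding SU2_def g_def by simp
qed

lemma SU2_one: "mat 1 \<in> SU2"
  by (simp add: SU2_def hermitian_adjoint_def mat_def vec_eq_iff forall_2 matrix_matrix_mult_def UNIV_2 det_2)

lemma matrix_exp_su2:
  assumes a: "a \<in> su2"
  shows matrix_exp_SU2: "matrix_exp (t *\<^sub>R a) \<in> SU2"
    and matrix_exp_has_vector_derivative: "((\<lambda>t. matrix_exp (t *\<^sub>R a)) has_vector_derivative a) (at 0)"
    and continuous_matrix_exp: "continuous_on UNIV (\<lambda>t. matrix_exp (t *\<^sub>R a))"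
proof -
  have "matrix_exp (t *\<^sub>R a) \<in> SU2 \<and> ((\<lambda>t. matrix_exp (t *\<^sub>R a)) has_vector_derivative a) (at 0) \<and>
      continuous_on UNIV (\<lambda>t. matrix_exp (t *\<^sub>R a))"
  proof (cases "a = 0")
    case True
    then show ?thesis by (simp add: matrix_exp_0 SU2_one)
  next
    case False
    define \<theta> where "\<theta> = sqrt (\<Sum>i\<in>UNIV. (su2_coeff a i)\<^sup>2) / 2"
    have "\<exists>i. su2_coeff a i \<noteq> 0"
      using False su2_eqI[OF a subspace_0[OF su2_subspace]] linear_0[OF su2_coeff_linear] by auto
    then have "(\<Sum>i\<in>UNIV. (su2_coeff a i)\<^sup>2) > 0"
      by (auto intro: sum_pos2 simp: zero_less_power2)
    then have \<theta>: "\<theta> \<noteq> 0" "\<theta>\<^sup>2 = (\<Sum>i\<in>UNIV. (su2_coeff a i)\<^sup>2) / 4"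
      by (auto simp: \<theta>_def power_divide)
    then have sum: "(\<Sum>i\<in>UNIV. (su2_coeff a i)\<^sup>2) = 4 * \<theta>\<^sup>2" by simp
    have sq: "a ** a = - (\<theta>\<^sup>2) *\<^sub>R mat 1" unfolding \<theta>(2) by (rule su2_square[OF a])
    \<comment> \<open>The case \<open>t = 0\<close> is separate because \<open>matrix_exp_eq\<close>
      divides by the angle.\<close>
    have exp: "matrix_exp (t *\<^sub>R a) = cos (t * \<theta>) *\<^sub>R mat 1 + (sin (t * \<theta>) / \<theta>) *\<^sub>R a" for t
    proof (cases "t = 0")
      case True
      then show ?thesis by (simp add: matrix_exp_0)
    next
      case False
      have "(t *\<^sub>R a) ** (t *\<^sub>R a) = - ((t * \<theta>)\<^sup>2) *\<^sub>R mat 1"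
        by (simp add: mat2_mult_scaleR_left mat2_mult_scaleR_right sq power_mult_distrib power2_eq_square)
      from matrix_exp_eq[OF this] show ?thesis using False \<theta> by simp
    qed
    have "matrix_exp (t *\<^sub>R a) \<in> SU2"
    proof -
      define s where "s = sin (t * \<theta>) / \<theta>"
      have "s\<^sup>2 * (\<Sum>i\<in>UNIV. (su2_coeff a i)\<^sup>2) / 4 = (sin (t * \<theta>))\<^sup>2"
        using \<theta>(1) unfolding sum s_def by (simp add: power_divide)
      then have "(cos (t * \<theta>))\<^sup>2 + s\<^sup>2 * (\<Sum>i\<in>UNIV. (su2_coeff a i)\<^sup>2) / 4 = 1" by simp
      then show ?thesis
        unfolding exp s_def[symmetric] by (rule su2_linear_combination_SU2[OF a])
    qed
    moreover have "((\<lambda>t. cos (t * \<theta>) *\<^sub>R mat 1 + (sin (t * \<theta>) / \<theta>) *\<^sub>R a) has_vector_derivative a) (at 0)"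
    proof -
      have "((\<lambda>t. cos (t * \<theta>)) has_real_derivative 0) (at 0)" "((\<lambda>t. sin (t * \<theta>) / \<theta>) has_real_derivative 1) (at 0)"
        using \<theta>(1) by (auto intro!: derivative_eq_intros)
      from has_vector_derivative_add[OF has_vector_derivative_scaleR[OF this(1) has_vector_derivative_const]
          has_vector_derivative_scaleR[OF this(2) has_vector_derivative_const]]
      show ?thesis by simp
    qed
    moreover have "continuous_on UNIV (\<lambda>t. cos (t * \<theta>) *\<^sub>R mat 1 + (sin (t * \<theta>) / \<theta>) *\<^sub>R a)"
      using \<theta>(1) by (intro continuous_intros) auto
    ultimately show ?thesis by (simp add: exp)
  qed
  then show "matrix_exp (t *\<^sub>R a) \<in> SU2" "((\<lambda>t. matrix_exp (t *\<^sub>R a)) has_vector_derivative a) (at 0)"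
    "continuous_on UNIV (\<lambda>t. matrix_exp (t *\<^sub>R a))" by auto
qed

section \<open>The group \<open>SU(2)\<close>\<close>

lemma hermitian_adjoint_mult:
  "hermitian_adjoint (a ** b) = hermitian_adjoint b ** hermitian_adjoint a"
  by (simp add: hermitian_adjoint_def matrix_matrix_mult_def vec_eq_iff UNIV_2 mult.commute)

lemma hermitian_adjoint_twice: "hermitian_adjoint (hermitian_adjoint a) = a"
  by (simp add: hermitian_adjoint_def vec_eq_iff)

lemma SU2_adjoint_left: "g \<in> SU2 \<Longrightarrow> hermitian_adjoint g ** g = mat 1"
  using matrix_left_right_inverse by (auto simp: SU2_def)

lemma SU2_mult:
  assumes "g \<in> SU2" "h \<in> SU2"
  shows "g ** h \<in> SU2"
proof -
  have "(g ** h) ** hermitian_adjoint (g ** h) = g ** (h ** hermitian_adjoint h) ** hermitian_adjoint g"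
    by (simp only: hermitian_adjoint_mult matrix_mul_assoc)
  then show ?thesis using assms by (simp add: SU2_def det_mul)
qed

lemma SU2_adjoint:
  assumes "g \<in> SU2"
  shows "hermitian_adjoint g \<in> SU2"
proof -
  have "det (hermitian_adjoint g) = cnj (det g)"
    by (simp add: det_2 hermitian_adjoint_def mult.commute)
  then show ?thesis
    using assms SU2_adjoint_left[OF assms] by (simp add: SU2_def hermitian_adjoint_twice)
qed

lemma SU2_matrix_inv:
  assumes "g \<in> SU2"
  shows "g ** matrix_inv g = mat 1"
proof -
  have "\<exists>h. g ** h = mat 1 \<and> h ** g = mat 1"
    using assms SU2_adjoint_left[OF assms] by (auto simp: SU2_def)
  from someI_ex[OF this] show ?thesis unfolding matrix_inv_def by blast
qed

lemma re_trace_conjugate: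
  assumes "g \<in> SU2"
  shows "re_trace ((matrix_inv g ** a ** g) ** (matrix_inv g ** b ** g)) = re_trace (a ** b)"
proof -
  have "(matrix_inv g ** a ** g) ** (matrix_inv g ** b ** g) = matrix_inv g ** (a ** (g ** matrix_inv g) ** b ** g)"
    by (simp only: matrix_mul_assoc)
  also have "re_trace \<dots> = re_trace ((a ** b) ** (g ** matrix_inv g))"
    by (subst re_trace_mult_commute) (simp add: SU2_matrix_inv[OF assms] matrix_mul_assoc[symmetric])
  finally show ?thesis by (simp add: SU2_matrix_inv[OF assms])
qed

definition quaternion_matrix :: "complex \<times> complex \<Rightarrow> mat2" where
  "quaternion_matrix z = vector [vector [fst z, snd z], vector [- cnj (snd z), cnj (fst z)]]"

text \<open>The identification with the 3-sphere, which gives connectedness.\<close>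

lemma SU2_eq_image_sphere: "SU2 = quaternion_matrix ` sphere 0 1"
proof (intro equalityI subsetI)
  fix g assume g: "g \<in> SU2"
  \<comment> \<open>The adjugate is the inverse since the determinant is 1, and so is the hermitian
    adjoint; comparing entries gives the quaternion shape.\<close>
  let ?adj = "vector [vector [g $ 2 $ 2, - g $ 1 $ 2], vector [- g $ 2 $ 1, g $ 1 $ 1]] :: mat2"
  have det: "g $ 1 $ 1 * g $ 2 $ 2 - g $ 1 $ 2 * g $ 2 $ 1 = 1"
    using g by (simp add: SU2_def det_2)
  have "g ** ?adj = mat (g $ 1 $ 1 * g $ 2 $ 2 - g $ 1 $ 2 * g $ 2 $ 1)"
    by (simp add: vec_eq_iff forall_2 matrix_matrix_mult_def UNIV_2 mat_def)
  then have "hermitian_adjoint g ** (g ** ?adj) = hermitian_adjoint g" by (simp add: det)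
  then have "hermitian_adjoint g = ?adj" by (simp add: matrix_mul_assoc SU2_adjoint_left[OF g])
  then have "hermitian_adjoint g $ i $ j = ?adj $ i $ j" for i j by simp
  from this[of 1 1] this[of 2 1]
  have 2: "g $ 2 $ 2 = cnj (g $ 1 $ 1)" "g $ 2 $ 1 = - cnj (g $ 1 $ 2)"
    by (simp_all add: hermitian_adjoint_def)
  have "complex_of_real ((cmod (g $ 1 $ 1))\<^sup>2 + (cmod (g $ 1 $ 2))\<^sup>2) = 1"
    using det unfolding 2 of_real_add complex_norm_square by simp
  then have "norm (g $ 1 $ 1, g $ 1 $ 2) = 1"
    unfolding norm_Pair by (metis of_real_eq_1_iff real_sqrt_one)
  moreover have "g = quaternion_matrix (g $ 1 $ 1, g $ 1 $ 2)"
    by (simp add: quaternion_matrix_def vec_eq_iff forall_2 2)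
  ultimately show "g \<in> quaternion_matrix ` sphere 0 1"
    by (intro image_eqI[of _ _ "(g $ 1 $ 1, g $ 1 $ 2)"]) auto
next
  fix g assume "g \<in> quaternion_matrix ` sphere 0 1"
  then obtain z where z: "norm z = 1" "g = quaternion_matrix z" by auto
  have "(cmod (fst z))\<^sup>2 + (cmod (snd z))\<^sup>2 = 1"
    using z(1) by (cases z) (simp add: norm_Pair)
  then have "complex_of_real ((cmod (fst z))\<^sup>2 + (cmod (snd z))\<^sup>2) = 1" by simp
  then have 1: "fst z * cnj (fst z) + snd z * cnj (snd z) = 1"
    unfolding of_real_add complex_norm_square .
  then have 2: "cnj (fst z) * fst z + cnj (snd z) * snd z = 1" by (simp add: mult.commute)
  show "g \<in> SU2"
    unfolding SU2_def z(2)
    by (simp add: quaternion_matrix_def hermitian_adjoint_def vec_eq_iff forall_2 matrix_matrix_mult_def UNIV_2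
        mat_def det_2 1 2 add.commute mult.commute)
qed

lemma connected_SU2: "connected SU2"
proof -
  have "linear quaternion_matrix"
    by (auto intro!: linearI simp: quaternion_matrix_def vec_eq_iff forall_2)
  then have "continuous_on (sphere 0 1) quaternion_matrix"
    by (simp add: linear_continuous_on linear_conv_bounded_linear)
  moreover have "connected (sphere (0 :: complex \<times> complex) 1)"
    by (rule connected_sphere) simp
  ultimately show ?thesis unfolding SU2_eq_image_sphere by (rule connected_continuous_image)
qed

section \<open>Tangent maps of a principal bundle\<close>

locale su2_principal_bundle =
  fixes B :: "('p::{t2_space,second_countable_topology}, 'm::{t2_space,second_countable_topology}) su2_bundle"
  assumes is_bundle: "principal_bundle B"
begin

lemma total_smooth: "smooth_atlas (total_atlas B)" and base_smooth: "smooth_atlas (base_atlas B)"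
  using is_bundle by (auto simp: principal_bundle_def oriented_atlas_def)

lemma proj_smooth: "smooth_map (total_atlas B) (base_atlas B) (proj B)"
  and action_smooth: "smooth_times_SU2 (total_atlas B) (total_atlas B) UNIV (action B)"
  and action_one: "action B p (mat 1) = p"
  and proj_action: "g \<in> SU2 \<Longrightarrow> proj B (action B p g) = proj B p"
  using is_bundle unfolding principal_bundle_def by blast+

lemma continuous_action: "continuous_on (UNIV \<times> SU2) (\<lambda>(p, g). action B p g)"
  using action_smooth by (simp add: smooth_times_SU2_def)

text \<open>In a local trivialisation two points of a fibre differ by the group element (\<theta>
  p)^-1 (\<theta> q), the inverse being the hermitian adjoint. It allows values at different points
  of a fibre to be compared.\<close>

lemma fibre_transitive:
  assumes "proj B p = proj B q"
  obtains g where "g \<in> SU2" "q = action B p g"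
proof -
  have "\<exists>U \<theta> \<Psi>. proj B p \<in> U \<and>
      (\<forall>p\<in>proj B -` U. \<theta> p \<in> SU2 \<and> \<Psi> (proj B p) (\<theta> p) = p) \<and>
      (\<forall>p\<in>proj B -` U. \<forall>g\<in>SU2. \<theta> (action B p g) = \<theta> p ** g)"
    using is_bundle unfolding principal_bundle_def by (elim conjE) (erule allE[of _ "proj B p"], blast)
  then obtain U \<theta> \<Psi> where U: "proj B p \<in> U"
    and \<theta>: "\<And>p. p \<in> proj B -` U \<Longrightarrow> \<theta> p \<in> SU2 \<and> \<Psi> (proj B p) (\<theta> p) = p"
    and \<theta>_action: "\<And>p g. p \<in> proj B -` U \<Longrightarrow> g \<in> SU2 \<Longrightarrow> \<theta> (action B p g) = \<theta> p ** g"
    by blast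
  define g where "g = hermitian_adjoint (\<theta> p) ** \<theta> q"
  have p: "p \<in> proj B -` U" and q: "q \<in> proj B -` U" using U assms by auto
  have g: "g \<in> SU2" unfolding g_def using \<theta>[OF p] \<theta>[OF q] by (blast intro: SU2_mult SU2_adjoint)
  have "\<theta> p ** hermitian_adjoint (\<theta> p) = mat 1" using \<theta>[OF p] by (simp add: SU2_def)
  then have "\<theta> (action B p g) = \<theta> q"
    unfolding \<theta>_action[OF p g] by (simp add: g_def matrix_mul_assoc)
  moreover have "action B p g \<in> proj B -` U" "proj B (action B p g) = proj B q"
    using p proj_action[OF g] assms by auto
  ultimately have "q = action B p g" using \<theta>[OF q] \<theta>[of "action B p g"] by metis
  then show thesis using that g by blast
qed

text \<open>Covers both curves \<open>t \<mapsto> p exp (t a)\<close> and right translations by a fixed \<open>g\<close>.\<close>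

lemma action_differentiable:
  assumes c: "c \<in> total_atlas B" "c' \<in> total_atlas B"
    and y: "y differentiable (at t)" and g: "g differentiable (at t)" and T: "open T" "t \<in> T"
    and dom: "\<And>s. s \<in> T \<Longrightarrow> y s \<in> snd c ` fst c \<and> g s \<in> SU2 \<and> action B (chart_inv c (y s)) (g s) \<in> fst c'"
  shows "(\<lambda>s. snd c' (action B (chart_inv c (y s)) (g s))) differentiable (at t)"
proof -
  let ?D = "{(y, g). y \<in> snd c ` (fst c \<inter> UNIV) \<and> g \<in> SU2 \<and> action B (chart_inv c y) g \<in> fst c'}"
  have "smooth_on (\<lambda>(y, g). snd c' (action B (chart_inv c y) g)) ?D"
    using action_smooth c unfolding smooth_times_SU2_def by blast
  moreover have "(\<lambda>s. (y s, g s)) differentiable (at t)"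
  proof -
    obtain y' g' where "(y has_derivative y') (at t)" "(g has_derivative g') (at t)"
      using y g by (auto simp: differentiable_def)
    from has_derivative_Pair[OF this] show ?thesis by (auto simp: differentiable_def)
  qed
  moreover have "(\<lambda>s. (y s, g s)) ` T \<subseteq> ?D" using dom by auto
  ultimately have "(\<lambda>s. (\<lambda>(y, g). snd c' (action B (chart_inv c y) g)) (y s, g s)) differentiable (at t)"
    by (rule smooth_on_compose_differentiable[OF _ _ T])
  then show ?thesis by simp
qed

lemma dproj_has_derivative:
  "((snd (chart_at (base_atlas B) (proj B p)) \<circ> proj B \<circ> chart_inv (chart_at (total_atlas B) p))
    has_derivative dproj B p) (at (snd (chart_at (total_atlas B) p) p))"
  using smooth_map_has_derivative[OF total_smooth base_smooth proj_smooth
      chart_at_in_atlas[OF total_smooth] chart_at_domain[OF total_smooth]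
      chart_at_in_atlas[OF base_smooth] chart_at_domain[OF base_smooth], of p]
  unfolding dproj_def tangent_map_def coord_at_def .

lemma linear_dproj: "linear (dproj B p)"
  using dproj_has_derivative has_derivative_linear by blast

text \<open>The derivative of the identity that projection after translation by \<open>g\<close> is
  projection.\<close>

lemma dproj_dright:
  assumes g: "g \<in> SU2"
  shows "dproj B (action B p g) (dright B g p X) = dproj B p X"
proof -
  define c c' k where "c = chart_at (total_atlas B) p" and "c' = chart_at (total_atlas B) (action B p g)"
    and "k = snd (chart_at (base_atlas B) (proj B p)) \<circ> proj B"
  have c: "c \<in> total_atlas B" "p \<in> fst c" "c' \<in> total_atlas B" "action B p g \<in> fst c'"
    using chart_at_mem[OF total_smooth] by (auto simp: c_def c'_def)
  note ch = smooth_atlas_chart[OF total_smooth c(1)] and ch' = smooth_atlas_chart[OF total_smooth c(3)]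
  define U where "U = (\<lambda>q. action B q g) -` fst c'"
  have "continuous_on UNIV (\<lambda>q. (q, g))" by (intro continuous_intros)
  from continuous_on_compose2[OF continuous_action this] g
  have "continuous_on UNIV (\<lambda>q. action B q g)" by auto
  moreover have "open (fst c')" using ch' by (simp add: is_chart_def)
  ultimately have "open U" unfolding U_def by (simp add: open_vimage)
  then have S: "open (snd c ` (fst c \<inter> U))" by (rule open_chart_image[OF ch])
  have y: "snd c p \<in> snd c ` (fst c \<inter> U)" using c by (auto simp: U_def)
  have dom: "y \<in> snd c ` fst c" "action B (chart_inv c y) g \<in> fst c'" if "y \<in> snd c ` (fst c \<inter> U)" for y
    using that unfolding chart_image_eq[OF ch] by (auto simp: U_def)
  have "(\<lambda>y. snd c' (action B (chart_inv c y) g)) differentiable (at (snd c p))"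
    using c dom g by (intro action_differentiable[OF _ _ _ _ S y]) auto
  then have "((snd c' \<circ> ((\<lambda>q. action B q g) \<circ> chart_inv c)) has_derivative
      dright B g p) (at (snd c p))"
    unfolding dright_def tangent_map_def coord_at_def c_def[symmetric] c'_def[symmetric]
    using frechet_derivative_works by (auto simp: o_def)
  moreover have "((k \<circ> chart_inv c') has_derivative dproj B (action B p g))
      (at (snd c' (((\<lambda>q. action B q g) \<circ> chart_inv c) (snd c p))))"
    using dproj_has_derivative[of "action B p g"] chart_inv_chart[OF ch c(2)]
    by (simp add: k_def c'_def proj_action[OF g])
  ultimately have "((k \<circ> ((\<lambda>q. action B q g) \<circ> chart_inv c)) has_derivative
      (dproj B (action B p g) \<circ> dright B g p)) (at (snd c p))"
    using dom by (intro chart_chain_rule[OF ch' S y]) auto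
  moreover have "(k \<circ> ((\<lambda>q. action B q g) \<circ> chart_inv c)) = k \<circ> chart_inv c"
    by (simp add: fun_eq_iff k_def proj_action[OF g])
  ultimately have "((k \<circ> chart_inv c) has_derivative (dproj B (action B p g) \<circ> dright B g p)) (at (snd c p))"
    by simp
  moreover have "((k \<circ> chart_inv c) has_derivative dproj B p) (at (snd c p))"
    using dproj_has_derivative[of p] by (simp add: k_def c_def)
  ultimately have "dproj B (action B p g) \<circ> dright B g p = dproj B p"
    by (rule has_derivative_unique)
  then show ?thesis by (simp add: fun_eq_iff)
qed

text \<open>The curve that defines the fundamental vector stays in one fibre, so its projection is
  constant.\<close>

lemma dproj_fundamental_vector:
  assumes a: "a \<in> su2"
  shows "dproj B p (fundamental_vector B p a) = 0"
proof -
  define c k \<gamma> where "c = chart_at (total_atlas B) p"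
    and "k = snd (chart_at (base_atlas B) (proj B p)) \<circ> proj B"
    and "\<gamma> t = action B p (matrix_exp (t *\<^sub>R a))" for t
  have c: "c \<in> total_atlas B" "p \<in> fst c" using chart_at_mem[OF total_smooth] by (auto simp: c_def)
  note ch = smooth_atlas_chart[OF total_smooth c(1)]
  have \<gamma>0: "\<gamma> 0 = p" by (simp add: \<gamma>_def matrix_exp_0 action_one)
  define T where "T = \<gamma> -` fst c"
  have "continuous_on UNIV (\<lambda>t. (p, matrix_exp (t *\<^sub>R a)))"
    by (intro continuous_intros continuous_matrix_exp[OF a])
  from continuous_on_compose2[OF continuous_action this] matrix_exp_SU2[OF a]
  have "continuous_on UNIV \<gamma>" by (auto simp: \<gamma>_def[abs_def])
  moreover have "open (fst c)" using ch by (simp add: is_chart_def)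
  ultimately have T: "open T" unfolding T_def by (simp add: open_vimage)
  have t: "0 \<in> T" using c \<gamma>0 by (simp add: T_def)
  have "(\<lambda>t. snd c (action B (chart_inv c (snd c p)) (matrix_exp (t *\<^sub>R a)))) differentiable (at 0)"
  proof (rule action_differentiable[OF c(1) c(1) _ _ T t])
    show "(\<lambda>t. matrix_exp (t *\<^sub>R a)) differentiable (at 0)"
      using matrix_exp_has_vector_derivative[OF a] by (auto simp: has_vector_derivative_def differentiable_def)
    show "snd c p \<in> snd c ` fst c \<and> matrix_exp (s *\<^sub>R a) \<in> SU2 \<and>
        action B (chart_inv c (snd c p)) (matrix_exp (s *\<^sub>R a)) \<in> fst c" if "s \<in> T" for s
      using that c matrix_exp_SU2[OF a] chart_inv_chart[OF ch c(2)] by (auto simp: T_def \<gamma>_def)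
  qed simp
  then have "(snd c \<circ> \<gamma>) differentiable (at 0)"
    using chart_inv_chart[OF ch c(2)] by (simp add: \<gamma>_def[abs_def] o_def)
  then have "((snd c \<circ> \<gamma>) has_vector_derivative fundamental_vector B p a) (at 0)"
    unfolding fundamental_vector_def velocity_def \<gamma>_def[abs_def, symmetric] \<gamma>0 c_def[symmetric]
    by (simp add: vector_derivative_works)
  then have "((snd c \<circ> \<gamma>) has_derivative (\<lambda>t. t *\<^sub>R fundamental_vector B p a)) (at 0)"
    by (simp add: has_vector_derivative_def)
  moreover have "((k \<circ> chart_inv c) has_derivative dproj B p) (at (snd c (\<gamma> 0)))"
    using dproj_has_derivative[of p] by (simp add: k_def c_def \<gamma>0)
  ultimately have "((k \<circ> \<gamma>) has_derivative (dproj B p \<circ> (\<lambda>t. t *\<^sub>R fundamental_vector B p a))) (at 0)"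
    by (intro chart_chain_rule[OF ch T t]) (auto simp: T_def)
  then have "dproj B p \<circ> (\<lambda>t. t *\<^sub>R fundamental_vector B p a) = (\<lambda>_. 0)"
    by (rule has_derivative_const_on[OF open_UNIV UNIV_I, rotated, where a="k p"])
      (simp add: k_def \<gamma>_def proj_action matrix_exp_SU2[OF a])
  from fun_cong[OF this, of 1] show ?thesis by simp
qed

end

section \<open>Smoothness of forms in charts\<close>

lemma smooth_on_model_form:
  assumes S: "open S" and Z: "\<And>i. smooth_on (Z i) S"
  shows "smooth_on (\<lambda>y. model_form (\<lambda>i. Z i y)) S"
  unfolding model_form_def det_3 vector_3
  by (intro smooth_on_mult[OF S] smooth_on_const[OF S] smooth_on_bounded_linear[OF bounded_linear_Re S]
      smooth_on_add[OF S] smooth_on_diff[OF S] smooth_on_nth[OF S] Z)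

lemma smooth_on_wedge:
  fixes X :: "'a::real_normed_vector \<Rightarrow> nat \<Rightarrow> 'v"
  assumes S: "open S" and \<alpha>: "\<And>\<sigma>. smooth_on (\<lambda>y. \<alpha> y (\<lambda>i. X y (\<sigma> i))) S"
    and \<beta>: "\<And>\<sigma>. smooth_on (\<lambda>y. \<beta> y (\<lambda>i. X y (\<sigma> i))) S"
  shows "smooth_on (\<lambda>y. wedge (*) k l (\<alpha> y) (\<beta> y) (X y) :: real) S"
  unfolding wedge_def
  by (intro smooth_on_scaleR_const[OF S] smooth_on_sum[OF S] smooth_on_mult[OF S] \<alpha> \<beta>)

text \<open>Although \<open>model_top\<close> comes from a choice, pairing a covector and a vector
  with coefficient 1 writes it as a \<open>hitchin_form\<close>, hence through wedge products of
  smooth expressions.\<close>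

lemma smooth_on_model_top:
  assumes S: "open S" and Z: "\<And>i. smooth_on (Z i) S"
  shows "smooth_on (\<lambda>y. model_top (\<lambda>i. Z i y)) S"
proof -
  have l: "linear (\<lambda>z::complex^3. Re (z $ 1))" by (auto intro!: linearI)
  have "\<i> *s axis 1 (- \<i>) = (axis 1 1 :: complex^3)" by (simp add: vec_eq_iff axis_def)
  then have top: "model_top X = hitchin_form (\<lambda>z. Re (z $ 1)) (axis 1 (- \<i>)) X" for X
    by (simp add: hitchin_form_model_top[OF l])
  have inner: "smooth_on (\<lambda>y. interior_product \<xi> model_form (\<lambda>i. Z (\<sigma> i) y)) S" for \<xi> \<sigma>
  proof -
    have eq: "interior_product \<xi> model_form (\<lambda>i. Z (\<sigma> i) y) =
        model_form (\<lambda>i. case_nat (\<lambda>_. \<xi>) (\<lambda>i. Z (\<sigma> i)) i y)" for y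
      unfolding interior_product_def
      by (rule arg_cong[where f=model_form]) (auto simp: fun_eq_iff split: nat.split)
    have "smooth_on (case_nat (\<lambda>_. \<xi>) (\<lambda>i. Z (\<sigma> i)) i) S" for i
      using Z smooth_on_const[OF S] by (cases i) auto
    then show ?thesis unfolding eq by (rule smooth_on_model_form[OF S])
  qed
  show ?thesis
    unfolding top hitchin_form_def
    by (intro smooth_on_wedge[OF S] smooth_on_model_form[OF S] Z inner
        smooth_on_bounded_linear[OF bounded_linear_Re S] smooth_on_nth[OF S])
qed

section \<open>The connection and the metric defined by \<open>J\<close>\<close>

locale framed_connection = su2_principal_bundle B
  for B :: "('p::{t2_space,second_countable_topology}, 'm::{t2_space,second_countable_topology}) su2_bundle" +
  fixes v :: "'p \<Rightarrow> (real^6, real) form" and W E :: "'p mform"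
  assumes volume: "positive_volume_form (total_atlas B) v"
    and connection: "connection_form B W"
    and negative: "negative_type v (chern_simons B W)"
    and frame: "frame_form B E"
    and curvature_eq: "curvature B W = (\<lambda>p. wedge2 (E p))"
begin

section \<open>The pointwise complex coframe of a framed connection\<close>

abbreviation w :: "'p \<Rightarrow> real^6 \<Rightarrow> mat2" where "w p \<equiv> on_vec (W p)"
abbreviation e :: "'p \<Rightarrow> real^6 \<Rightarrow> mat2" where "e p \<equiv> on_vec (E p)"

abbreviation \<Theta> :: "'p \<Rightarrow> real^6 \<Rightarrow> complex^3" where "\<Theta> p \<equiv> complex_coframe (W p) (E p)"

lemma W_alternating: "alternating_form 1 (W p)" and E_alternating: "alternating_form 1 (E p)"
  using connection frame by (auto simp: connection_form_def frame_form_def differential_form_def)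

lemma W_su2: "W p X \<in> su2" and E_su2: "E p X \<in> su2"
  using connection frame by (auto simp: connection_form_def frame_form_def)

lemma linear_w: "linear (w p)" and linear_e: "linear (e p)"
  using W_alternating E_alternating unfolding alternating_form_1_iff by auto

lemma w_fundamental: "a \<in> su2 \<Longrightarrow> w p (fundamental_vector B p a) = a"
  using connection by (simp add: connection_form_def)

lemma e_vertical: "X \<in> vertical B p \<Longrightarrow> e p X = 0"
  using frame by (simp add: frame_form_def)

lemma fundamental_vertical: "a \<in> su2 \<Longrightarrow> fundamental_vector B p a \<in> vertical B p"
  by (simp add: vertical_def dproj_fundamental_vector)

lemma equivariant_on_vec:
  "equivariant B \<omega> \<Longrightarrow> g \<in> SU2 \<Longrightarrow>
    on_vec (\<omega> (action B p g)) (dright B g p X) = matrix_inv g ** on_vec (\<omega> p) X ** g"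
  by (simp add: equivariant_def pullback_def dright_def)

lemma w_dright: "g \<in> SU2 \<Longrightarrow> w (action B p g) (dright B g p X) = matrix_inv g ** w p X ** g"
  and e_dright: "g \<in> SU2 \<Longrightarrow> e (action B p g) (dright B g p X) = matrix_inv g ** e p X ** g"
  using connection frame by (auto simp: connection_form_def frame_form_def equivariant_on_vec)

lemma linear_\<Theta>: "linear (\<Theta> p)"
  by (rule complex_coframe_linear[OF W_alternating E_alternating])

text \<open>\<open>frame_form\<close> states independence as the absence of linear relations among
  the components; a vector orthogonal to a proper range would be such a relation.\<close>

lemma e_surjective: "\<exists>X. \<forall>i. su2_coeff (e p X) i = r i"
proof -
  define f where "f X = (\<chi> i. su2_coeff (e p X) i)" for X
  have l: "linear (\<lambda>X. su2_coeff (e p X) i)" for i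
    using linear_compose[OF linear_e su2_coeff_linear] by (simp add: o_def)
  have f: "linear f"
    by (rule linearI) (simp_all add: f_def vec_eq_iff linear_add[OF l] linear_scale[OF l])
  have "surj f"
  proof (rule ccontr)
    assume "\<not> surj f"
    then have "span (range f) \<noteq> UNIV" using span_eq_iff[of "range f"] subspace_UNIV f
      by (metis linear_subspace_image)
    then obtain a where a: "a \<noteq> 0" "\<And>x. x \<in> span (range f) \<Longrightarrow> a \<bullet> x = 0"
      using span_not_UNIV_orthogonal by blast
    have "(\<Sum>i\<in>UNIV. a $ i * su2_coeff (e p X) i) = 0" for X
      using a(2)[of "f X"] span_base[of "f X" "range f"] by (simp add: f_def inner_vec_def)
    then have "a $ i = 0" for i using frame unfolding frame_form_def by blast
    then show False using a(1) by (simp add: vec_eq_iff)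
  qed
  then obtain X where "f X = (\<chi> i. r i)" by (metis surjD)
  then have "su2_coeff (e p X) i = r i" for i by (simp add: f_def vec_eq_iff)
  then show ?thesis by blast
qed

lemma su2_with_coeffs: "\<exists>a\<in>su2. \<forall>i. su2_coeff a i = r i"
proof (intro bexI allI)
  show "(\<Sum>j\<in>UNIV. r j *\<^sub>R tau j) \<in> su2"
    by (intro subspace_sum[OF su2_subspace] subspace_scale[OF su2_subspace] tau_su2)
  show "su2_coeff (\<Sum>j\<in>UNIV. r j *\<^sub>R tau j) i = r i" for i
    by (simp add: linear_sum[OF su2_coeff_linear] linear_scale[OF su2_coeff_linear] su2_coeff_tau
        if_distrib cong: if_cong)
qed

text \<open>The frame supplies a vector with the prescribed imaginary parts; a fundamental vector
  then corrects the real parts, as \<open>E\<close> vanishes on it and \<open>W\<close> returns its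
  generator. Injectivity follows since both spaces have real dimension 6.\<close>

lemma bij_\<Theta>: "bij (\<Theta> p)"
proof -
  have "surj (\<Theta> p)"
  proof (unfold surj_def, rule allI)
    fix z
    obtain X where X: "\<And>i. su2_coeff (e p X) i = Im (z $ i)"
      using e_surjective[of p "\<lambda>i. Im (z $ i)"] by blast
    obtain a where a: "a \<in> su2" "\<And>i. su2_coeff a i = Re (z $ i) - su2_coeff (w p X) i"
      using su2_with_coeffs[of "\<lambda>i. Re (z $ i) - su2_coeff (w p X) i"] by blast
    have "\<Theta> p (X + fundamental_vector B p a) = z"
      by (simp add: complex_coframe_def vec_eq_iff complex_eq_iff linear_add[OF linear_w] linear_add[OF linear_e]
          w_fundamental[OF a(1)] e_vertical[OF fundamental_vertical[OF a(1)]] linear_add[OF su2_coeff_linear] a(2) X)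
    then show "\<exists>X. z = \<Theta> p X" by (intro exI) (rule sym)
  qed
  moreover have "inj (\<Theta> p)"
    by (rule linear_surjective_imp_injective[OF linear_\<Theta> calculation]) simp
  ultimately show ?thesis by (simp add: bij_def)
qed

lemma coframe_eqI:
  assumes "w p X = w p Y" "e p X = e p Y"
  shows "X = Y"
  by (rule injD[OF bij_is_inj[OF bij_\<Theta>[of p]]]) (simp add: complex_coframe_def assms)

text \<open>If \<open>E\<close> kills \<open>X\<close>, then \<open>X\<close> has the same coframe
  values as the fundamental vector generated by \<open>w p X\<close>, so it equals that vertical
  vector.\<close>

lemma vertical_iff: "X \<in> vertical B p \<longleftrightarrow> e p X = 0"
proof
  assume "e p X = 0"
  then have "X = fundamental_vector B p (w p X)"
    using e_vertical[OF fundamental_vertical[OF W_su2]] by (intro coframe_eqI[of p]) (simp_all add: w_fundamental W_su2)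
  then show "X \<in> vertical B p" using fundamental_vertical[OF W_su2] by metis
qed (rule e_vertical)

lemma vertical_to_su2_eq:
  assumes "X \<in> vertical B p"
  shows "vertical_to_su2 B p X = w p X"
  unfolding vertical_to_su2_def
proof (rule the_equality)
  have "fundamental_vector B p (w p X) = X"
    using e_vertical[OF fundamental_vertical[OF W_su2]] e_vertical[OF assms]
    by (intro coframe_eqI[of p]) (simp_all add: w_fundamental W_su2)
  then show "w p X \<in> su2 \<and> fundamental_vector B p (w p X) = X" by (simp add: W_su2)
qed (auto simp: w_fundamental)

lemma chern_simons_eq: "chern_simons B W p = (\<lambda>X. model_form (\<lambda>i. \<Theta> p (X i)))"
proof -
  have "exterior_d (total_atlas B) 1 W p X = wedge2 (E p) X - wedge2 (W p) X" for X
    using fun_cong[OF fun_cong[OF curvature_eq, of p], of X] by (simp add: curvature_def eq_diff_eq)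
  then have d: "exterior_d (total_atlas B) 1 W p = (\<lambda>X. wedge2 (E p) X - wedge2 (W p) X)" by (rule ext)
  show ?thesis
    unfolding chern_simons_def[abs_def] d
    by (rule ext) (rule chern_simons_model[OF W_alternating W_su2 E_alternating E_su2])
qed

section \<open>The almost-complex structure in terms of the coframe, and its connection\<close>

lemma v_alternating: "alternating_form 6 (v p)" and v_pos: "v p standard_basis > 0"
  using volume by (auto simp: positive_volume_form_def differential_form_def standard_basis_def[abs_def])

definition top_ratio :: "'p \<Rightarrow> real" where
  "top_ratio p = model_top (\<lambda>i. \<Theta> p (standard_basis i)) / v p standard_basis"

lemma model_top_ratio: "model_top (\<lambda>i. \<Theta> p (X i)) = top_ratio p * v p X"
proof -
  have "v p standard_basis \<noteq> 0" using v_pos[of p] by simp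
  from model_top_proportional[OF linear_\<Theta> v_alternating this]
  obtain c where c: "\<And>X. model_top (\<lambda>i. \<Theta> p (X i)) = c * v p X" by blast
  then show ?thesis using v_pos[of p] by (simp add: top_ratio_def)
qed

text \<open>This is where negative type enters: \<lambda> equals minus the square of
  \<open>top_ratio\<close>.\<close>

lemma top_ratio_nonzero: "top_ratio p \<noteq> 0"
proof -
  have "hitchin_lambda (v p) (chern_simons B W p) < 0" using negative by (simp add: negative_type_def)
  then show ?thesis
    using hitchin_lambda_model_form[OF linear_\<Theta> bij_\<Theta> model_top_ratio, of p standard_basis] v_pos[of p]
    by (auto simp: chern_simons_eq)
qed

abbreviation J :: "'p \<Rightarrow> real^6 \<Rightarrow> real^6" where "J \<equiv> J_of_form v (chern_simons B W)"

lemma J_eq: "J p X = sgn (top_ratio p) *\<^sub>R complex_structure (\<Theta> p) X"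
  by (rule J_of_form_model_form[where v=v and b=standard_basis, OF linear_\<Theta> bij_\<Theta> model_top_ratio _ chern_simons_eq])
    (use v_pos[of p] in simp)

lemma sgn_top_ratio: "sgn (top_ratio p) * sgn (top_ratio p) = 1"
  using top_ratio_nonzero[of p] by (simp add: sgn_if)

lemma linear_J: "linear (J p)"
proof -
  have "linear (\<lambda>X. sgn (top_ratio p) *\<^sub>R complex_structure (\<Theta> p) X)"
    by (intro linear_compose_scale_right linear_complex_structure linear_\<Theta> bij_\<Theta>)
  then show ?thesis by (simp add: J_eq[abs_def])
qed

lemma J_J: "J p (J p X) = - X"
  using sgn_top_ratio[of p]
  by (simp add: J_eq linear_scale[OF linear_complex_structure[OF linear_\<Theta> bij_\<Theta>]]
      complex_structure_twice[OF linear_\<Theta> bij_\<Theta>])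

text \<open>Multiplication by \<i> turns W + \<i> E into - E + \<i> W.\<close>

lemma w_J: "w p (J p X) = - sgn (top_ratio p) *\<^sub>R e p X"
  and e_J: "e p (J p X) = sgn (top_ratio p) *\<^sub>R w p X"
proof -
  let ?Y = "complex_structure (\<Theta> p) X"
  have "\<Theta> p ?Y $ i = \<i> * \<Theta> p X $ i" for i by (simp add: coframe_complex_structure[OF bij_\<Theta>])
  then have c: "su2_coeff (w p ?Y) i = - su2_coeff (e p X) i" "su2_coeff (e p ?Y) i = su2_coeff (w p X) i" for i
    by (simp_all add: complex_coframe_def complex_eq_iff)
  have neg: "- e p X \<in> su2" using subspace_neg[OF su2_subspace E_su2] .
  have "w p ?Y = - e p X"
    by (rule su2_eqI[OF W_su2 neg]) (simp add: c linear_neg[OF su2_coeff_linear])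
  moreover have "e p ?Y = w p X"
    by (rule su2_eqI[OF E_su2 W_su2]) (simp add: c)
  ultimately show "w p (J p X) = - sgn (top_ratio p) *\<^sub>R e p X" "e p (J p X) = sgn (top_ratio p) *\<^sub>R w p X"
    by (simp_all add: J_eq linear_scale[OF linear_w] linear_scale[OF linear_e])
qed

lemma J_vertical: "J p ` vertical B p = {X. w p X = 0}"
proof (intro equalityI subsetI)
  fix X assume "X \<in> J p ` vertical B p"
  then show "X \<in> {X. w p X = 0}" by (auto simp: w_J vertical_iff)
next
  fix X assume X: "X \<in> {X. w p X = 0}"
  have "X = J p (- J p X)" by (simp add: linear_neg[OF linear_J] J_J)
  moreover have "- J p X \<in> vertical B p" using X by (simp add: vertical_iff linear_neg[OF linear_e] e_J)
  ultimately show "X \<in> J p ` vertical B p" by blast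
qed

text \<open>A connection form is determined by its kernel: every vector is a fundamental vector,
  where the value is prescribed, plus an element of the kernel.\<close>

lemma connection_of_J: "connection_of B J = W"
  unfolding connection_of_def
proof (rule the_equality)
  show "connection_form B W \<and> (\<forall>p. {X. w p X = 0} = J p ` vertical B p)"
    using connection by (simp add: J_vertical)
  fix W' assume W': "connection_form B W' \<and> (\<forall>p. {X. on_vec (W' p) X = 0} = J p ` vertical B p)"
  have alt: "alternating_form 1 (W' p)" for p
    using W' by (auto simp: connection_form_def differential_form_def)
  then have lin: "linear (on_vec (W' p))" for p unfolding alternating_form_1_iff by auto
  have "on_vec (W' p) X = w p X" for p X
  proof -
    let ?V = "fundamental_vector B p (w p X)"
    have "w p (X - ?V) = 0" by (simp add: linear_diff[OF linear_w] w_fundamental W_su2)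
    then have "on_vec (W' p) (X - ?V) = 0" using W' J_vertical by blast
    moreover have "on_vec (W' p) ?V = w p X" using W' W_su2 by (simp add: connection_form_def)
    ultimately show ?thesis by (simp add: linear_diff[OF lin])
  qed
  then have "W' p X = W p X" for p X
    using alt W_alternating unfolding alternating_form_1_iff by metis
  then show "W' = W" by (intro ext)
qed

section \<open>Horizontal lifts and the metric on the base\<close>

lemma horizontal_lift_eq:
  "horizontal_lift B J p (dproj B p X) = X - fundamental_vector B p (w p X)"
  unfolding horizontal_lift_def
proof (rule the_equality)
  let ?X = "X - fundamental_vector B p (w p X)"
  show "?X \<in> J p ` vertical B p \<and> dproj B p ?X = dproj B p X"
    by (simp add: J_vertical linear_diff[OF linear_w] w_fundamental W_su2 linear_diff[OF linear_dproj]
        dproj_fundamental_vector)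
  fix Y assume Y: "Y \<in> J p ` vertical B p \<and> dproj B p Y = dproj B p X"
  then have "Y - X \<in> vertical B p" by (simp add: vertical_def linear_diff[OF linear_dproj])
  then have "e p Y = e p X" by (simp add: vertical_iff linear_diff[OF linear_e])
  then show "Y = ?X"
    using Y e_vertical[OF fundamental_vertical[OF W_su2]]
    by (intro coframe_eqI[of p])
      (simp_all add: J_vertical linear_diff[OF linear_w] linear_diff[OF linear_e] w_fundamental W_su2)
qed

lemma killing_horizontal_lift:
  "killing (vertical_to_su2 B p (J p (horizontal_lift B J p (dproj B p X))))
     (vertical_to_su2 B p (J p (horizontal_lift B J p (dproj B p Y)))) = - 2 * re_trace (e p X ** e p Y)"
proof -
  have "vertical_to_su2 B p (J p (horizontal_lift B J p (dproj B p Z))) = - sgn (top_ratio p) *\<^sub>R e p Z" for Z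
  proof -
    let ?H = "Z - fundamental_vector B p (w p Z)"
    have "w p ?H = 0" by (simp add: linear_diff[OF linear_w] w_fundamental W_su2)
    then have "J p ?H \<in> vertical B p" by (simp add: vertical_iff e_J)
    then show ?thesis
      using e_vertical[OF fundamental_vertical[OF W_su2]]
      by (simp add: horizontal_lift_eq vertical_to_su2_eq w_J linear_diff[OF linear_e])
  qed
  then show ?thesis
    unfolding killing_def by (simp only: mat2_mult_scaleR_left mat2_mult_scaleR_right re_trace_scaleR)
      (simp add: mult.assoc[symmetric] sgn_top_ratio del: sgn_mult_self_eq)
qed

text \<open>The value must be the same over the whole fibre. Another point is a translate of
  \<open>p\<close>; translating \<open>X\<close> and \<open>Y\<close> along keeps their projections
  and conjugates the values of \<open>E\<close>, which leaves the trace unchanged.\<close>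

lemma is_frame_for_metric: "is_frame_for B E (metric_of B J)"
  unfolding is_frame_for_def metric_of_def
proof (intro allI the_equality impI)
  fix p X Y q assume "proj B q = proj B p"
  then obtain g where g: "g \<in> SU2" "q = action B p g" using fibre_transitive by metis
  have "dproj B q (dright B g p Z) = dproj B p Z" for Z using dproj_dright g by simp
  then show "- 2 * re_trace (e p X ** e p Y) =
      killing (vertical_to_su2 B q (J q (horizontal_lift B J q (dproj B p X))))
        (vertical_to_su2 B q (J q (horizontal_lift B J q (dproj B p Y))))"
    using killing_horizontal_lift[of q "dright B g p X" "dright B g p Y"]
    by (simp add: g(2) e_dright[OF g(1)] re_trace_conjugate[OF g(1)])
qed (use killing_horizontal_lift in auto)

subsection \<open>Smoothness of the almost-complex structure\<close>

context
  fixes c assumes c: "c \<in> total_atlas B"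
begin

abbreviation chart_coframe :: "real^6 \<Rightarrow> real^6 \<Rightarrow> complex^3" where
  "chart_coframe y u \<equiv> \<Theta> (chart_inv c y) (from_chart (total_atlas B) c y u)"

lemma open_chart: "open (snd c ` fst c)"
  using smooth_atlas_chart[OF total_smooth c] by (simp add: is_chart_def)

lemma smooth_chart_coframe: "smooth_on (\<lambda>y. chart_coframe y u) (snd c ` fst c)"
proof (rule smooth_on_vecI[OF open_chart])
  fix i
  have coeff: "bounded_linear (\<lambda>a. su2_coeff a i)"
    using su2_coeff_linear by (simp add: linear_conv_bounded_linear)
  have "smooth_on (\<lambda>y. in_chart (total_atlas B) c W y (\<lambda>_. u)) (snd c ` fst c)"
    and "smooth_on (\<lambda>y. in_chart (total_atlas B) c E y (\<lambda>_. u)) (snd c ` fst c)"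
    using connection frame c by (auto simp: connection_form_def frame_form_def differential_form_def)
  from this[THEN smooth_on_bounded_linear[OF coeff open_chart]]
  have "smooth_on (\<lambda>y. su2_coeff (in_chart (total_atlas B) c W y (\<lambda>_. u)) i *\<^sub>R 1
      + su2_coeff (in_chart (total_atlas B) c E y (\<lambda>_. u)) i *\<^sub>R \<i>) (snd c ` fst c)"
    by (intro smooth_on_add[OF open_chart] smooth_on_bounded_linear[OF bounded_linear_scaleR_left open_chart])
  then show "smooth_on (\<lambda>y. chart_coframe y u $ i) (snd c ` fst c)"
    by (simp add: complex_coframe_def in_chart_def complex_eq_iff Complex_eq scaleR_conv_of_real mult.commute)
qed

text \<open>The transported basis still spans, and a top form that vanished on it would vanish
  identically.\<close>

lemma chart_basis_volume:
  assumes y: "y \<in> snd c ` fst c"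
  shows "v (chart_inv c y) (\<lambda>i. from_chart (total_atlas B) c y (standard_basis i)) \<noteq> 0"
proof
  let ?L = "from_chart (total_atlas B) c y"
  assume 0: "v (chart_inv c y) (\<lambda>i. ?L (standard_basis i)) = 0"
  have "span (?L ` standard_basis ` {..<6}) = ?L ` UNIV"
    by (simp only: linear_span_image[OF linear_from_chart[OF total_smooth c y]] span_standard_basis)
  moreover have "?L ` UNIV = UNIV" using from_chart_to_chart[OF total_smooth c y] by (metis surjI)
  ultimately have "span ((\<lambda>i. ?L (standard_basis i)) ` {..<6}) = UNIV" by (simp add: image_image)
  from alternating_form_eq_0[OF v_alternating this 0, of standard_basis] v_pos[of "chart_inv c y"]
  show False by simp
qed

text \<open>\<open>top_ratio\<close> is defined with the basis of the chart chosen at each point,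
  and this choice need not vary continuously. The ratio of two top forms is the same in every basis,
  so the basis of the fixed chart \<open>c\<close> is used instead.\<close>

lemma smooth_top_ratio: "smooth_on (\<lambda>y. top_ratio (chart_inv c y)) (snd c ` fst c)"
proof -
  have "smooth_on (\<lambda>y. in_chart (total_atlas B) c v y standard_basis) (snd c ` fst c)"
    using volume c by (auto simp: positive_volume_form_def differential_form_def)
  then have "smooth_on (\<lambda>y. model_top (\<lambda>i. chart_coframe y (standard_basis i)) *
      inverse (in_chart (total_atlas B) c v y standard_basis)) (snd c ` fst c)"
    using chart_basis_volume
    by (intro smooth_on_mult smooth_on_model_top smooth_on_inverse smooth_chart_coframe open_chart)
      (simp add: in_chart_def)
  then show ?thesis
    by (rule smooth_on_cong[OF open_chart, rotated])
      (simp add: model_top_ratio in_chart_def chart_basis_volume)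
qed

text \<open>Writing sgn t as t / sqrt (t^2) with t nonzero makes smoothness a matter of closure
  rules.\<close>

lemma smooth_sgn_top_ratio: "smooth_on (\<lambda>y. sgn (top_ratio (chart_inv c y))) (snd c ` fst c)"
proof -
  have "smooth_on (\<lambda>y. top_ratio (chart_inv c y) *
      inverse (sqrt (top_ratio (chart_inv c y) * top_ratio (chart_inv c y)))) (snd c ` fst c)"
    by (intro smooth_on_mult smooth_on_inverse smooth_on_sqrt smooth_top_ratio open_chart)
      (simp_all add: top_ratio_nonzero zero_less_mult_iff linorder_neq_iff[symmetric] flip: not_less)
  then show ?thesis
    by (simp add: real_sgn_eq divide_inverse)
qed

text \<open>The definition of \<open>complex_structure\<close> inverts the coframe, whose inverse
  has no explicit smooth expression here. \<open>wedge_model_form\<close> gives each component as a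
  quotient of two top forms on a fixed basis, with numerator \<open>N\<close> and denominator
  \<open>model_top\<close>, both smooth.\<close>

lemma smooth_chart_J:
  "smooth_on (\<lambda>y. to_chart (total_atlas B) c (chart_inv c y)
     (J (chart_inv c y) (from_chart (total_atlas B) c y u))) (snd c ` fst c)"
proof (rule smooth_on_vecI[OF open_chart])
  fix k
  let ?S = "snd c ` fst c"
  let ?\<Omega> = "\<lambda>y X. model_form (\<lambda>i. chart_coframe y (X i))"
  let ?\<alpha> = "\<lambda>X :: nat \<Rightarrow> real^6. X 0 $ k"
  define N where "N y = wedge (*) 3 3 (wedge (*) 1 2 ?\<alpha> (interior_product u (?\<Omega> y))) (?\<Omega> y) standard_basis" for y
  have "linear (\<lambda>X::real^6. X $ k)" by (auto intro!: linearI)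
  then have \<alpha>: "alternating_form 1 ?\<alpha>" by (subst alternating_form_1_iff) simp
  have "smooth_on N ?S"
    unfolding N_def interior_product_def
    by (intro smooth_on_wedge smooth_on_model_form smooth_on_const smooth_chart_coframe open_chart)
  then have candidate: "smooth_on (\<lambda>y. sgn (top_ratio (chart_inv c y)) *
      (N y * inverse (model_top (\<lambda>i. chart_coframe y (standard_basis i))))) ?S"
    by (intro smooth_on_mult smooth_on_inverse smooth_on_model_top smooth_chart_coframe smooth_sgn_top_ratio open_chart \<open>smooth_on N ?S\<close>)
      (simp add: model_top_ratio top_ratio_nonzero chart_basis_volume)
  show "smooth_on (\<lambda>y. to_chart (total_atlas B) c (chart_inv c y)
      (J (chart_inv c y) (from_chart (total_atlas B) c y u)) $ k) ?S"
  proof (rule smooth_on_cong[OF open_chart _ candidate])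
    fix y assume y: "y \<in> ?S"
    let ?L = "from_chart (total_atlas B) c y" and ?M = "to_chart (total_atlas B) c (chart_inv c y)"
    let ?T = "\<lambda>u. chart_coframe y u" and ?q = "chart_inv c y"
    note from_to = from_chart_to_chart[OF total_smooth c y] and to_from = to_chart_from_chart[OF total_smooth c y]
    have "bij ?L" by (rule o_bij[of ?M]) (auto simp: fun_eq_iff from_to to_from)
    then have bij: "bij ?T" using bij_comp[OF _ bij_\<Theta>, of ?L ?q] by (simp add: o_def)
    have lin: "linear ?T"
      using linear_compose[OF linear_from_chart[OF total_smooth c y] linear_\<Theta>] by (simp add: o_def)
    \<comment> \<open>The coframe read in the chart is the composition with \<open>?L\<close>, so
      its complex structure is the conjugate by \<open>?L\<close>; this is the chart expression
      whose smoothness is claimed.\<close>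
    have "complex_structure ?T u = ?M (complex_structure (\<Theta> ?q) (?L u))"
      by (rule injD[OF bij_is_inj[OF bij]])
        (simp add: coframe_complex_structure[OF bij] coframe_complex_structure[OF bij_\<Theta>] from_to)
    moreover have "linear ?M"
    proof (rule linearI)
      show "?M (a + b) = ?M a + ?M b" for a b
        by (rule injD[OF bij_is_inj[OF \<open>bij ?L\<close>]])
          (simp add: from_to linear_add[OF linear_from_chart[OF total_smooth c y]])
      show "?M (r *\<^sub>R a) = r *\<^sub>R ?M a" for r a
        by (rule injD[OF bij_is_inj[OF \<open>bij ?L\<close>]])
          (simp add: from_to linear_scale[OF linear_from_chart[OF total_smooth c y]])
    qed
    moreover have "N y = complex_structure ?T u $ k * model_top (\<lambda>i. ?T (standard_basis i))"
      unfolding N_def by (rule wedge_model_form[OF lin bij \<alpha>])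
    moreover have "model_top (\<lambda>i. ?T (standard_basis i)) \<noteq> 0"
      by (simp add: model_top_ratio top_ratio_nonzero chart_basis_volume[OF y])
    ultimately show "sgn (top_ratio ?q) * (N y * inverse (model_top (\<lambda>i. ?T (standard_basis i)))) =
        ?M (J ?q (?L u)) $ k"
      by (simp add: J_eq linear_scale)
  qed
qed

end

lemma almost_complex_J: "almost_complex_structure (total_atlas B) J"
  unfolding almost_complex_structure_def using linear_J J_J smooth_chart_J by blast

text \<open>The sign relating \<open>J\<close> to the complex coframe is locally constant, hence constant on the connected fibres.\<close>

lemma continuous_sgn_top_ratio: "continuous_on UNIV (\<lambda>p. sgn (top_ratio p))"
  unfolding continuous_on_eq_continuous_at[OF open_UNIV]
proof
  fix p
  define c where "c = chart_at (total_atlas B) p"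
  have c: "c \<in> total_atlas B" "p \<in> fst c" using chart_at_mem[OF total_smooth] by (auto simp: c_def)
  note ch = smooth_atlas_chart[OF total_smooth c(1)]
  have op: "open (fst c)" and cont: "continuous_on (fst c) (snd c)"
    using ch by (auto simp: is_chart_def homeomorphism_def)
  have "continuous_on (snd c ` fst c) (\<lambda>y. sgn (top_ratio (chart_inv c y)))"
    unfolding continuous_on_eq_continuous_at[OF open_chart[OF c(1)]]
    using smooth_on_imp_differentiable[OF smooth_sgn_top_ratio[OF c(1)] open_chart[OF c(1)]]
      differentiable_imp_continuous_within by blast
  from continuous_on_compose2[OF this cont]
  have "continuous_on (fst c) (\<lambda>q. sgn (top_ratio (chart_inv c (snd c q))))" by auto
  then have "continuous_on (fst c) (\<lambda>q. sgn (top_ratio q))"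
    by (rule continuous_on_eq) (simp add: chart_inv_chart[OF ch])
  then show "isCont (\<lambda>p. sgn (top_ratio p)) p" using op c(2) continuous_on_eq_continuous_at by blast
qed

lemma sgn_top_ratio_action:
  assumes g: "g \<in> SU2"
  shows "sgn (top_ratio (action B p g)) = sgn (top_ratio p)"
proof -
  have "continuous_on SU2 (\<lambda>h. (p, h))" by (intro continuous_intros)
  from continuous_on_compose2[OF continuous_action this]
  have "continuous_on SU2 (\<lambda>h. action B p h)" by auto
  from continuous_on_compose2[OF continuous_sgn_top_ratio this]
  have "continuous_on SU2 (\<lambda>h. sgn (top_ratio (action B p h)))" by auto
  moreover have "finite ((\<lambda>h. sgn (top_ratio (action B p h))) ` SU2)"
    by (rule finite_subset[of _ "{-1, 0, 1}"]) (auto simp: sgn_if)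
  ultimately have "(\<lambda>h. sgn (top_ratio (action B p h))) constant_on SU2"
    using continuous_finite_range_constant[OF connected_SU2] by blast
  then show ?thesis using g SU2_one action_one unfolding constant_on_def by metis
qed

text \<open>Both sides have the same coframe values: \<open>J\<close> exchanges \<open>w\<close> and
  \<open>e\<close> up to signs, translation conjugates both by \<open>g\<close>, and the sign is the
  same at both points.\<close>

lemma dright_J: "g \<in> SU2 \<Longrightarrow> dright B g p (J p X) = J (action B p g) (dright B g p X)"
  by (rule coframe_eqI[of "action B p g"])
    (simp_all add: w_dright e_dright w_J e_J sgn_top_ratio_action mat2_mult_scaleR_left mat2_mult_scaleR_right
      del: scaleR_minus_left)

lemma admissible_J: "admissible B J"
proof -
  have "J p ` vertical B p \<inter> vertical B p = {0}" for p
    unfolding J_vertical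
    by (auto simp: vertical_iff linear_0[OF linear_w] linear_0[OF linear_e] intro!: coframe_eqI[where Y=0])
  then show ?thesis unfolding admissible_def using almost_complex_J dright_J by blast
qed

end

theorem proposition1:
  fixes B :: "('p::{t2_space,second_countable_topology}, 'm::{t2_space,second_countable_topology}) su2_bundle"
    and v :: "'p \<Rightarrow> (real^6, real) form"
    and W E :: "'p mform"
    and J :: "'p \<Rightarrow> real^6 \<Rightarrow> real^6"
  assumes "principal_bundle B"
    and "positive_volume_form (total_atlas B) v"
    and "connection_form B W"
    and "negative_definite B v W"
    and "frame_form B E"
    and "orientation_compatible B E"
    and "curvature B W = (\<lambda>p. wedge2 (E p))"
    and "J = J_of_form v (chern_simons B W)"
  shows "admissible B J \<and> connection_of B J = W \<and> is_frame_for B E (metric_of B J)"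
proof -
  interpret framed_connection B v W E
    using assms by unfold_locales (auto simp: negative_definite_def)
  show ?thesis
    unfolding assms(8) using admissible_J connection_of_J is_frame_for_metric by blast
qed

end
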